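(* Let $H$ be a weak Hopf algebra with invertible antipode $S$. Let ${H_{par}^w}$ be its universal algebra of partial representations and ${A_{par}^w}\subseteq {H_{par}^w}$ the subalgebra generated by the elements $E_h=[h_1][S(h_2)]$, $h\in H$, regarded as a symmetric partial $H$-module algebra via $h\cdot a=[h_1]\,a\,[S(h_2)]$. Then ${H_{par}^w}$ is isomorphic, as an algebra, to the partial smash product ${A_{par}^w}\,\underline{\#}\,H$.
   Context: All algebras are associative and unital over a field $\Bbbk$; Sweedler notation $\Delta(h)=h_1\otimes h_2$, $\Delta(1_H)=1_1\otimes 1_2$. A weak Hopf algebra is $(H,m,u,\Delta,\varepsilon,S)$ with $H$ an algebra, $(H,\Delta,\varepsilon)$ a coalgebra, and for all $g,h,k$: $\Delta(kh)=\Delta(k)\Delta(h)$; $\varepsilon(kh_1)\varepsilon(h_2g)=\varepsilon(khg)=\varepsilon(kh_2)\varepsilon(h_1g)$; $(1\otimes\Delta(1))(\Delta(1)\otimes 1)=\Delta^2(1)=(\Delta(1)\otimes 1)(1\otimes\Delta(1))$; $h_1S(h_2)=\varepsilon_t(h)$; $S(h_1)h_2=\varepsilon_s(h)$; $S(h)=S(h_1)h_2S(h_3)$; where $\varepsilon_t(h)=\varepsilon(1_1h)1_2$, $\varepsilon_s(h)=1_1\varepsilon(h1_2)$. Put $H_t=\varepsilon_t(H)$, $H_s=\varepsilon_s(H)$; the restriction of $S$ gives a bijection $S_R\colon H_s\to H_t$. ${H_{par}^w}=T(H)/I$, where $T(H)$ is the tensor algebra of the vector space $H$ and $I$ is the ideal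 generated by, for all $h,k\in H$: $1_H-1_{T(H)}$; $h\otimes k_1\otimes S(k_2)-hk_1\otimes S(k_2)$; $h\otimes S(k_1)\otimes k_2-hS(k_1)\otimes k_2$; $h_1\otimes S(h_2)\otimes k-h_1\otimes S(h_2)k$; $S(h_1)\otimes h_2\otimes k-S(h_1)\otimes h_2k$; $h-h_1\otimes S(h_2)\otimes h_3$. $[h]$ denotes the class of $h$. A left partial action of $H$ on an algebra $A$ is a linear map $H\otimes A\to A$, $h\otimes a\mapsto h\cdot a$, with (PA1) $h\cdot(ab)=(h_1\cdot a)(h_2\cdot b)$, (PA2) $1_H\cdot a=a$, (PA3) $h\cdot(k\cdot a)=(h_1\cdot 1_A)((h_2k)\cdot a)$; $A$ is then a partial $H$-module algebra, and it is symmetric if moreover (PA4) $h\cdot(k\cdot a)=((h_1k)\cdot a)(h_2\cdot 1_A)$. For a partial $H$-module algebra $A$, the smash product $A\# H$ is $A\otimes_{H_t}H$, where $A$ is a right $H_t$-module via $a\triangleleft z=a(S_R^{-1}(z)\cdot 1_A)$ and $H$ is a left $H_t$-module by multiplication, with product $(a\#h)(b\#g)=a(h_1\cdot b)\#h_2g$. The partial smash product $A\,\underline{\#}\,H$ is the subalgebra of $A\#H$ generated by the elements $a\,\underline{\#}\,h:=(a\#h)(1_A\#1_H)=a(h_1\cdot 1_A)\#h_2$; it is unital with unit $1_A\,\underline{\#}\,1_H$. *)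

theory Defs
  imports Complex_Main
begin

text \<open>An element of a tensor power of H is represented by a finite list of elementary
tensors.  Two such lists denote the same tensor iff every multilinear form to the base
field takes the same value on them (functionals separate points over a field).\<close>

record ('k, 'h) wha =
  sc  :: "'k \<Rightarrow> 'h \<Rightarrow> 'h"
  mu  :: "'h \<Rightarrow> 'h \<Rightarrow> 'h"
  un  :: "'h"
  cm  :: "'h \<Rightarrow> ('h \<times> 'h) list"
  eps :: "'h \<Rightarrow> 'k"
  ant :: "'h \<Rightarrow> 'h"

definition bil :: "('k::field, 'h::ab_group_add) wha \<Rightarrow> ('h \<Rightarrow> 'h \<Rightarrow> 'k) \<Rightarrow> bool" where
  "bil H f \<longleftrightarrow> (\<forall>x. Vector_Spaces.linear (sc H) (*) (f x))
                \<and> (\<forall>y. Vector_Spaces.linear (sc H) (*) (\<lambda>x. f x y))"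

definition tril :: "('k::field, 'h::ab_group_add) wha \<Rightarrow> ('h \<Rightarrow> 'h \<Rightarrow> 'h \<Rightarrow> 'k) \<Rightarrow> bool" where
  "tril H f \<longleftrightarrow> (\<forall>x y. Vector_Spaces.linear (sc H) (*) (f x y))
                \<and> (\<forall>x z. Vector_Spaces.linear (sc H) (*) (\<lambda>y. f x y z))
                \<and> (\<forall>y z. Vector_Spaces.linear (sc H) (*) (\<lambda>x. f x y z))"

definition teq2 :: "('k::field, 'h::ab_group_add) wha \<Rightarrow> ('h \<times> 'h) list \<Rightarrow> ('h \<times> 'h) list \<Rightarrow> bool" where
  "teq2 H xs ys \<longleftrightarrow> (\<forall>f. bil H f \<longrightarrow>
      sum_list (map (\<lambda>(a,b). f a b) xs) = sum_list (map (\<lambda>(a,b). f a b) ys))"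

definition teq3 :: "('k::field, 'h::ab_group_add) wha \<Rightarrow> ('h \<times> 'h \<times> 'h) list \<Rightarrow> ('h \<times> 'h \<times> 'h) list \<Rightarrow> bool" where
  "teq3 H xs ys \<longleftrightarrow> (\<forall>f. tril H f \<longrightarrow>
      sum_list (map (\<lambda>(a,b,c). f a b c) xs) = sum_list (map (\<lambda>(a,b,c). f a b c) ys))"

definition tmul2 :: "('k, 'h) wha \<Rightarrow> ('h \<times> 'h) list \<Rightarrow> ('h \<times> 'h) list \<Rightarrow> ('h \<times> 'h) list" where
  "tmul2 H xs ys = concat (map (\<lambda>(a,b). map (\<lambda>(c,d). (mu H a c, mu H b d)) ys) xs)"

definition tmul3 :: "('k, 'h) wha \<Rightarrow> ('h \<times> 'h \<times> 'h) list \<Rightarrow> ('h \<times> 'h \<times> 'h) list \<Rightarrow> ('h \<times> 'h \<times> 'h) list" where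
  "tmul3 H xs ys = concat (map (\<lambda>(a,b,c). map (\<lambda>(a',b',c'). (mu H a a', mu H b b', mu H c c')) ys) xs)"

definition cm2L :: "('k, 'h) wha \<Rightarrow> 'h \<Rightarrow> ('h \<times> 'h \<times> 'h) list" where
  "cm2L H h = concat (map (\<lambda>(a,b). map (\<lambda>(c,d). (c,d,b)) (cm H a)) (cm H h))"

definition cm2R :: "('k, 'h) wha \<Rightarrow> 'h \<Rightarrow> ('h \<times> 'h \<times> 'h) list" where
  "cm2R H h = concat (map (\<lambda>(a,b). map (\<lambda>(c,d). (a,c,d)) (cm H b)) (cm H h))"

definition eps_t :: "('k::field, 'h::ab_group_add) wha \<Rightarrow> 'h \<Rightarrow> 'h" where
  "eps_t H h = sum_list (map (\<lambda>(a,b). sc H (eps H (mu H a h)) b) (cm H (un H)))"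

definition eps_s :: "('k::field, 'h::ab_group_add) wha \<Rightarrow> 'h \<Rightarrow> 'h" where
  "eps_s H h = sum_list (map (\<lambda>(a,b). sc H (eps H (mu H h b)) a) (cm H (un H)))"

definition weak_hopf_algebra :: "('k::field, 'h::ab_group_add) wha \<Rightarrow> bool" where
  "weak_hopf_algebra H \<longleftrightarrow>
     \<comment> \<open>H is a vector space, an associative unital algebra\<close>
     Vector_Spaces.vector_space (sc H)
   \<and> (\<forall>x. Vector_Spaces.linear (sc H) (sc H) (mu H x))
   \<and> (\<forall>y. Vector_Spaces.linear (sc H) (sc H) (\<lambda>x. mu H x y))
   \<and> (\<forall>x y z. mu H (mu H x y) z = mu H x (mu H y z))
   \<and> (\<forall>x. mu H (un H) x = x \<and> mu H x (un H) = x)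
     \<comment> \<open>(H, \<Delta>, \<epsilon>) is a coalgebra\<close>
   \<and> (\<forall>f. bil H f \<longrightarrow> Vector_Spaces.linear (sc H) (*) (\<lambda>h. sum_list (map (\<lambda>(a,b). f a b) (cm H h))))
   \<and> Vector_Spaces.linear (sc H) (*) (eps H)
   \<and> (\<forall>h. teq3 H (cm2L H h) (cm2R H h))
   \<and> (\<forall>h. sum_list (map (\<lambda>(a,b). sc H (eps H a) b) (cm H h)) = h)
   \<and> (\<forall>h. sum_list (map (\<lambda>(a,b). sc H (eps H b) a) (cm H h)) = h)
     \<comment> \<open>S is linear\<close>
   \<and> Vector_Spaces.linear (sc H) (sc H) (ant H)
     \<comment> \<open>weak bialgebra axioms\<close>
   \<and> (\<forall>k h. teq2 H (cm H (mu H k h)) (tmul2 H (cm H k) (cm H h)))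
   \<and> (\<forall>k h g. sum_list (map (\<lambda>(a,b). eps H (mu H k a) * eps H (mu H b g)) (cm H h))
               = eps H (mu H (mu H k h) g))
   \<and> (\<forall>k h g. eps H (mu H (mu H k h) g)
               = sum_list (map (\<lambda>(a,b). eps H (mu H k b) * eps H (mu H a g)) (cm H h)))
   \<and> teq3 H (tmul3 H (map (\<lambda>(a,b). (un H, a, b)) (cm H (un H)))
                     (map (\<lambda>(a,b). (a, b, un H)) (cm H (un H))))
            (cm2L H (un H))
   \<and> teq3 H (cm2L H (un H))
            (tmul3 H (map (\<lambda>(a,b). (a, b, un H)) (cm H (un H)))
                     (map (\<lambda>(a,b). (un H, a, b)) (cm H (un H))))
     \<comment> \<open>antipode axioms\<close>
   \<and> (\<forall>h. sum_list (map (\<lambda>(a,b). mu H a (ant H b)) (cm H h)) = eps_t H h)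
   \<and> (\<forall>h. sum_list (map (\<lambda>(a,b). mu H (ant H a) b) (cm H h)) = eps_s H h)
   \<and> (\<forall>h. ant H h = sum_list (map (\<lambda>(a,b,c). mu H (mu H (ant H a) b) (ant H c)) (cm2L H h)))"

text \<open>Elements of the free algebra k<H> on the set H: finitely supported functions from
words over H to k.  T(H) is k<H> modulo the linearity relations of the generators, so
H_par^w = T(H)/I is k<H> modulo the ideal generated by the linearity relations and the
generators of I.\<close>

type_synonym ('k, 'h) fa = "'h list \<Rightarrow> 'k"

definition FA :: "('k::zero, 'h) fa set" where
  "FA = {x. finite {w. x w \<noteq> 0}}"

definition fa_zero :: "('k::zero, 'h) fa" where "fa_zero = (\<lambda>w. 0)"
definition fa_one :: "('k::{zero,one}, 'h) fa" where "fa_one = (\<lambda>w. if w = [] then 1 else 0)"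
definition fa_gen :: "'h \<Rightarrow> ('k::{zero,one}, 'h) fa" where "fa_gen h = (\<lambda>w. if w = [h] then 1 else 0)"
definition fa_add :: "('k::plus, 'h) fa \<Rightarrow> ('k, 'h) fa \<Rightarrow> ('k, 'h) fa" where
  "fa_add x y = (\<lambda>w. x w + y w)"
definition fa_scale :: "'k::times \<Rightarrow> ('k, 'h) fa \<Rightarrow> ('k, 'h) fa" where
  "fa_scale c x = (\<lambda>w. c * x w)"
definition fa_diff :: "('k::ring_1, 'h) fa \<Rightarrow> ('k, 'h) fa \<Rightarrow> ('k, 'h) fa" where
  "fa_diff x y = fa_add x (fa_scale (-1) y)"
definition fa_mult :: "('k::comm_semiring_1, 'h) fa \<Rightarrow> ('k, 'h) fa \<Rightarrow> ('k, 'h) fa" where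
  "fa_mult x y = (\<lambda>w. \<Sum>i\<in>{0..length w}. x (take i w) * y (drop i w))"
definition fa_sum :: "('k::comm_monoid_add, 'h) fa list \<Rightarrow> ('k, 'h) fa" where
  "fa_sum xs = foldr fa_add xs fa_zero"

abbreviation fa_mult3 where "fa_mult3 x y z \<equiv> fa_mult (fa_mult x y) z"

definition parI_gens :: "('k::field, 'h::ab_group_add) wha \<Rightarrow> ('k, 'h) fa set" where
  "parI_gens H =
     \<comment> \<open>linearity of h \<mapsto> [h] (presentation of T(H) as a quotient of k<H>)\<close>
     {fa_diff (fa_gen (h + g)) (fa_add (fa_gen h) (fa_gen g)) | h g. True}
   \<union> {fa_diff (fa_gen (sc H c h)) (fa_scale c (fa_gen h)) | c h. True}
     \<comment> \<open>the generators of I\<close>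
   \<union> {fa_diff (fa_gen (un H)) fa_one}
   \<union> {fa_sum (map (\<lambda>(a,b). fa_diff (fa_mult3 (fa_gen h) (fa_gen a) (fa_gen (ant H b)))
                                    (fa_mult (fa_gen (mu H h a)) (fa_gen (ant H b)))) (cm H k)) | h k. True}
   \<union> {fa_sum (map (\<lambda>(a,b). fa_diff (fa_mult3 (fa_gen h) (fa_gen (ant H a)) (fa_gen b))
                                    (fa_mult (fa_gen (mu H h (ant H a))) (fa_gen b))) (cm H k)) | h k. True}
   \<union> {fa_sum (map (\<lambda>(a,b). fa_diff (fa_mult3 (fa_gen a) (fa_gen (ant H b)) (fa_gen k))
                                    (fa_mult (fa_gen a) (fa_gen (mu H (ant H b) k)))) (cm H h)) | h k. True}
   \<union> {fa_sum (map (\<lambda>(a,b). fa_diff (fa_mult3 (fa_gen (ant H a)) (fa_gen b) (fa_gen k))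
                                    (fa_mult (fa_gen (ant H a)) (fa_gen (mu H b k)))) (cm H h)) | h k. True}
   \<union> {fa_diff (fa_gen h)
        (fa_sum (map (\<lambda>(a,b,c). fa_mult3 (fa_gen a) (fa_gen (ant H b)) (fa_gen c)) (cm2L H h))) | h. True}"

inductive_set parI :: "('k::field, 'h::ab_group_add) wha \<Rightarrow> ('k, 'h) fa set" for H where
  gen: "r \<in> parI_gens H \<Longrightarrow> r \<in> parI H"
| zero: "fa_zero \<in> parI H"
| add: "x \<in> parI H \<Longrightarrow> y \<in> parI H \<Longrightarrow> fa_add x y \<in> parI H"
| scale: "x \<in> parI H \<Longrightarrow> fa_scale c x \<in> parI H"
| lmul: "x \<in> parI H \<Longrightarrow> a \<in> FA \<Longrightarrow> fa_mult a x \<in> parI H"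
| rmul: "x \<in> parI H \<Longrightarrow> a \<in> FA \<Longrightarrow> fa_mult x a \<in> parI H"

definition parcong :: "('k::field, 'h::ab_group_add) wha \<Rightarrow> ('k, 'h) fa \<Rightarrow> ('k, 'h) fa \<Rightarrow> bool" where
  "parcong H x y \<longleftrightarrow> fa_diff x y \<in> parI H"

definition Eel :: "('k::field, 'h::ab_group_add) wha \<Rightarrow> 'h \<Rightarrow> ('k, 'h) fa" where
  "Eel H h = fa_sum (map (\<lambda>(a,b). fa_mult (fa_gen a) (fa_gen (ant H b))) (cm H h))"

inductive_set Agen :: "('k::field, 'h::ab_group_add) wha \<Rightarrow> ('k, 'h) fa set" for H where
  one: "fa_one \<in> Agen H"
| E: "Eel H h \<in> Agen H"
| add: "x \<in> Agen H \<Longrightarrow> y \<in> Agen H \<Longrightarrow> fa_add x y \<in> Agen H"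
| scale: "x \<in> Agen H \<Longrightarrow> fa_scale c x \<in> Agen H"
| mult: "x \<in> Agen H \<Longrightarrow> y \<in> Agen H \<Longrightarrow> fa_mult x y \<in> Agen H"

definition Apar :: "('k::field, 'h::ab_group_add) wha \<Rightarrow> ('k, 'h) fa set" where
  "Apar H = {x \<in> FA. \<exists>y \<in> Agen H. parcong H x y}"

definition act :: "('k::field, 'h::ab_group_add) wha \<Rightarrow> 'h \<Rightarrow> ('k, 'h) fa \<Rightarrow> ('k, 'h) fa" where
  "act H h a = fa_sum (map (\<lambda>(p,q). fa_mult3 (fa_gen p) a (fa_gen (ant H q))) (cm H h))"

text \<open>a \<triangleleft> z = a (S_R^{-1}(z) \<cdot> 1_A), with S_R : H_s \<rightarrow> H_t the restriction of S.\<close>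
definition ract :: "('k::field, 'h::ab_group_add) wha \<Rightarrow> ('k, 'h) fa \<Rightarrow> 'h \<Rightarrow> ('k, 'h) fa" where
  "ract H a z = fa_mult a (act H (inv_into (range (eps_s H)) (ant H) z) fa_one)"

text \<open>Linear functionals on A \<otimes>_{H_t} H = H_t-balanced bilinear forms on A \<times> H.\<close>
definition balforms :: "('k::field, 'h::ab_group_add) wha \<Rightarrow> (('k, 'h) fa \<Rightarrow> 'h \<Rightarrow> 'k) set" where
  "balforms H = {\<beta>.
      (\<forall>a\<in>Apar H. \<forall>a'\<in>Apar H. \<forall>h. \<beta> (fa_add a a') h = \<beta> a h + \<beta> a' h)
    \<and> (\<forall>a\<in>Apar H. \<forall>c h. \<beta> (fa_scale c a) h = c * \<beta> a h)
    \<and> (\<forall>a\<in>Apar H. \<forall>a'\<in>Apar H. \<forall>h. parcong H a a' \<longrightarrow> \<beta> a h = \<beta> a' h)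
    \<and> (\<forall>a\<in>Apar H. Vector_Spaces.linear (sc H) (*) (\<beta> a))
    \<and> (\<forall>a\<in>Apar H. \<forall>z\<in>range (eps_t H). \<forall>h. \<beta> (ract H a z) h = \<beta> a (mu H z h))}"

type_synonym ('k, 'h) stens = "(('k, 'h) fa \<times> 'h) list"

definition Atens :: "('k::field, 'h::ab_group_add) wha \<Rightarrow> ('k, 'h) stens set" where
  "Atens H = {xs. \<forall>(a,h)\<in>set xs. a \<in> Apar H}"

definition teqA :: "('k::field, 'h::ab_group_add) wha \<Rightarrow> ('k, 'h) stens \<Rightarrow> ('k, 'h) stens \<Rightarrow> bool" where
  "teqA H xs ys \<longleftrightarrow> (\<forall>\<beta>\<in>balforms H.
      sum_list (map (\<lambda>(a,h). \<beta> a h) xs) = sum_list (map (\<lambda>(a,h). \<beta> a h) ys))"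

definition tscale :: "'k::field \<Rightarrow> ('k, 'h) stens \<Rightarrow> ('k, 'h) stens" where
  "tscale c xs = map (\<lambda>(a,h). (fa_scale c a, h)) xs"

definition smul :: "('k::field, 'h::ab_group_add) wha \<Rightarrow> ('k, 'h) stens \<Rightarrow> ('k, 'h) stens \<Rightarrow> ('k, 'h) stens" where
  "smul H xs ys = concat (map (\<lambda>(a,h). concat (map (\<lambda>(b,g).
      map (\<lambda>(h1,h2). (fa_mult a (act H h1 b), mu H h2 g)) (cm H h)) ys)) xs)"

definition psgen :: "('k::field, 'h::ab_group_add) wha \<Rightarrow> ('k, 'h) fa \<Rightarrow> 'h \<Rightarrow> ('k, 'h) stens" where
  "psgen H a h = smul H [(a, h)] [(fa_one, un H)]"

inductive_set PSgen :: "('k::field, 'h::ab_group_add) wha \<Rightarrow> ('k, 'h) stens set" for H where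
  gen: "a \<in> Apar H \<Longrightarrow> psgen H a h \<in> PSgen H"
| zero: "[] \<in> PSgen H"
| add: "xs \<in> PSgen H \<Longrightarrow> ys \<in> PSgen H \<Longrightarrow> xs @ ys \<in> PSgen H"
| scale: "xs \<in> PSgen H \<Longrightarrow> tscale c xs \<in> PSgen H"
| mult: "xs \<in> PSgen H \<Longrightarrow> ys \<in> PSgen H \<Longrightarrow> smul H xs ys \<in> PSgen H"

definition PS :: "('k::field, 'h::ab_group_add) wha \<Rightarrow> ('k, 'h) stens set" where
  "PS H = {t \<in> Atens H. \<exists>s \<in> PSgen H. teqA H t s}"

text \<open>An algebra isomorphism H_par^w \<rightarrow> A_par^w underline-# H, expressed on representatives:
well defined and injective on classes, onto, k-linear, multiplicative and unital.\<close>
definition Hpar_PS_iso :: "('k::field, 'h::ab_group_add) wha \<Rightarrow> (('k, 'h) fa \<Rightarrow> ('k, 'h) stens) \<Rightarrow> bool" where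
  "Hpar_PS_iso H \<phi> \<longleftrightarrow>
      (\<forall>x\<in>FA. \<phi> x \<in> PS H)
    \<and> (\<forall>x\<in>FA. \<forall>y\<in>FA. parcong H x y \<longleftrightarrow> teqA H (\<phi> x) (\<phi> y))
    \<and> (\<forall>t\<in>PS H. \<exists>x\<in>FA. teqA H (\<phi> x) t)
    \<and> (\<forall>x\<in>FA. \<forall>y\<in>FA. teqA H (\<phi> (fa_add x y)) (\<phi> x @ \<phi> y))
    \<and> (\<forall>c. \<forall>x\<in>FA. teqA H (\<phi> (fa_scale c x)) (tscale c (\<phi> x)))
    \<and> (\<forall>x\<in>FA. \<forall>y\<in>FA. teqA H (\<phi> (fa_mult x y)) (smul H (\<phi> x) (\<phi> y)))
    \<and> teqA H (\<phi> fa_one) (psgen H fa_one (un H))"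

end

theory Submission
  imports Defs "HOL-Library.Function_Algebras"
begin

text \<open>
  Write \<open>P\<close> for the algebra \<open>H\<^sub>p\<^sub>a\<^sub>r\<close> and \<open>A\<close> for its subalgebra generated by the \<open>E\<^sub>h = [h\<^sub>1][S h\<^sub>2]\<close>.
  The elements \<open>E'\<^sub>h = [S h\<^sub>1][h\<^sub>2]\<close> commute with \<open>A\<close>, whence \<open>[h] a = (h\<^sub>1 \<cdot> a)[h\<^sub>2]\<close> for \<open>a \<in> A\<close>, and so
  \<open>\<Psi> (a # h) = a [h]\<close> is multiplicative on the smash product; it is well defined on the tensor product
  over \<open>H\<^sub>t\<close> because \<open>E\<^sub>y [h] = [S(y) h]\<close> for \<open>y \<in> H\<^sub>s\<close>. It maps the generator given by \<open>a\<close> and \<open>h\<close> to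
  \<open>a [h]\<close>, and it is onto since \<open>P\<close> is generated by the \<open>[h]\<close>.

  For injectivity, \<open>[h] \<mapsto> [h\<^sub>1] \<otimes> h\<^sub>2\<close> extends to a multiplicative coaction \<open>x \<mapsto> x\<^sub>0 \<otimes> x\<^sub>1\<close> from \<open>P\<close> to
  \<open>P \<otimes> H\<close>, and \<open>x \<mapsto> x\<^sub>0 [S x\<^sub>1] \<otimes> x\<^sub>2\<close> sends \<open>a [h]\<close> to \<open>a E\<^bsub>h1\<^esub> \<otimes> h\<^sub>2\<close>, which represents the generator of
  the partial smash product given by \<open>a\<close> and \<open>h\<close>. As tensors are only known through the forms on
  them, this coaction appears transposed, as an action of the free algebra on bilinear forms.
\<close>

section \<open>Multilinear maps and Sweedler sums\<close>

text \<open>E'_h commutes with A because E_k travels leftwards through [h_2], turning into E_(h_2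
  k), and then through [S h_1], which turns it back into E_k. The delicate object is the coaction:
  it must respect the relations of I, and it sends [1] only to the idempotent [1_1] \<otimes> 1_2.
  Relations built on k_1 \<otimes> S(k_2) survive because the second tensor factor k_2 S(k_3)
  collapses to a leg of \<Delta>(1). In those built on S(k_1) \<otimes> k_2 nothing collapses, but
  S(k_2) and k_3 are neighbours in the first factor, so that the relation applies there. The same
  collapse shows that A is coinvariant, which is why a [h] goes to a [h_1] \<otimes> h_2 and then to
  a [h_1][S h_2] \<otimes> h_3. The idempotent is tamed by 1_1 lying in H_s, where brackets multiply
  freely. Invertibility of S enters as surjectivity, in H_t = S(H_s) and H_s = S(H_t).\<close>

definition lmap :: "('k \<Rightarrow> 'a \<Rightarrow> 'a) \<Rightarrow> ('k \<Rightarrow> 'b \<Rightarrow> 'b) \<Rightarrow> ('a::plus \<Rightarrow> 'b::plus) \<Rightarrow> bool" where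
  "lmap s t f \<longleftrightarrow> (\<forall>x y. f (x + y) = f x + f y) \<and> (\<forall>c x. f (s c x) = t c (f x))"

lemma lmap_add: "lmap s t f \<Longrightarrow> f (x + y) = f x + f y"
  and lmap_scale: "lmap s t f \<Longrightarrow> f (s c x) = t c (f x)"
  by (simp_all add: lmap_def)

lemma lmap_zero:
  fixes f :: "'a::group_add \<Rightarrow> 'b::group_add"
  assumes "lmap s t f"
  shows "f 0 = 0"
proof -
  have "f 0 + f 0 = f 0 + 0" using lmap_add[OF assms, of 0 0] by simp
  then show ?thesis by (rule add_left_imp_eq)
qed

lemma lmap_sum_list:
  fixes f :: "'a::ab_group_add \<Rightarrow> 'b::ab_group_add"
  shows "lmap s t f \<Longrightarrow> f (sum_list (map g xs)) = (\<Sum>x\<leftarrow>xs. f (g x))"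
  by (induction xs) (auto simp: lmap_zero lmap_add)

lemma linear_iff_lmap:
  "vector_space s \<Longrightarrow> vector_space t \<Longrightarrow> Vector_Spaces.linear s t f \<longleftrightarrow> lmap s t f"
  by (simp add: Vector_Spaces.linear_iff lmap_def)

lemma vector_space_field: "vector_space ((*) :: 'k::field \<Rightarrow> 'k \<Rightarrow> 'k)"
  by unfold_locales (auto simp: algebra_simps)

text \<open>The value 1 at the nonzero vector x - y extends to a linear form. This carries
  identities between tensors, which the definitions assert only for scalar-valued forms, over to
  values in any vector space.\<close>

lemma functionals_separate:
  fixes t :: "'k::field \<Rightarrow> 'w::ab_group_add \<Rightarrow> 'w"
  assumes t: "vector_space t" and eq: "\<And>f. lmap t (*) f \<Longrightarrow> f x = f y"
  shows "x = y"
proof (rule ccontr)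
  assume "x \<noteq> y"
  interpret t: vector_space t by fact
  interpret k: vector_space "(*) :: 'k \<Rightarrow> 'k \<Rightarrow> 'k" by (rule vector_space_field)
  interpret p: vector_space_pair t "(*) :: 'k \<Rightarrow> 'k \<Rightarrow> 'k" ..
  have "t.independent {x - y}" using \<open>x \<noteq> y\<close> by (simp add: t.dependent_single)
  then obtain g where g: "Vector_Spaces.linear t (*) g" "\<forall>z\<in>{x - y}. g z = 1"
    using p.linear_independent_extend[of "{x - y}" "\<lambda>_. 1"] by blast
  have l: "lmap t (*) g" using g(1) linear_iff_lmap[OF t vector_space_field] by blast
  have "g x = g ((x - y) + y)" by simp
  also have "\<dots> = g (x - y) + g y" using l by (rule lmap_add)
  finally show False using g(2) eq[OF l] by simp
qed

text \<open>A subspace has a complement. The projection later extends forms from A to the whole ring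
  and splits the ideal off the free algebra.\<close>

lemma subspace_projection:
  fixes s :: "'k::field \<Rightarrow> 'v::ab_group_add \<Rightarrow> 'v"
  assumes s: "vector_space s" and V: "0 \<in> V" "\<And>x y. x \<in> V \<Longrightarrow> y \<in> V \<Longrightarrow> x + y \<in> V" "\<And>c x. x \<in> V \<Longrightarrow> s c x \<in> V"
  shows "\<exists>\<pi>. lmap s s \<pi> \<and> (\<forall>x. \<pi> x \<in> V) \<and> (\<forall>x\<in>V. \<pi> x = x)"
proof -
  interpret s: vector_space s by (rule s)
  interpret p: vector_space_pair s s ..
  have "Vector_Spaces.linear s s (\<lambda>x. x)"
    by (simp add: linear_iff_lmap[OF s s] lmap_def)
  moreover have "s.subspace V"
    using V by (intro s.subspaceI)
  ultimately obtain \<pi> where "range \<pi> \<subseteq> V" "Vector_Spaces.linear s s \<pi>" "\<forall>x\<in>V. \<pi> x = x"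
    using p.linear_exists_left_inverse_on[of "\<lambda>x. x" V] by (auto simp: inj_on_def)
  then show ?thesis
    using linear_iff_lmap[OF s s] by blast
qed

definition dsum :: "('k, 'h) wha \<Rightarrow> 'h \<Rightarrow> ('h \<Rightarrow> 'h \<Rightarrow> 'w::comm_monoid_add) \<Rightarrow> 'w" where
  "dsum H h F = (\<Sum>(a, b)\<leftarrow>cm H h. F a b)"

lemma sum_list_concat: "sum_list (concat xss) = (\<Sum>xs\<leftarrow>xss. sum_list xs)"
  by (induction xss) auto

lemma sum_list_swap:
  fixes f :: "'a \<Rightarrow> 'b \<Rightarrow> 'w::comm_monoid_add"
  shows "(\<Sum>x\<leftarrow>xs. \<Sum>y\<leftarrow>ys. f x y) = (\<Sum>y\<leftarrow>ys. \<Sum>x\<leftarrow>xs. f x y)"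
  by (induction xs) (auto simp: sum_list_addf)

lemma dsum_swap:
  "dsum H h (\<lambda>a b. dsum H k (\<lambda>c d. F a b c d)) = dsum H k (\<lambda>c d. dsum H h (\<lambda>a b. F a b c d))"
  using sum_list_swap[of "\<lambda>x y. F (fst x) (snd x) (fst y) (snd y)" "cm H k" "cm H h"]
  by (simp add: dsum_def case_prod_unfold)

lemma dsum_add: "dsum H h (\<lambda>a b. F a b + G a b) = dsum H h F + dsum H h G"
  by (simp add: dsum_def case_prod_unfold sum_list_addf)

lemma lmap_dsum:
  fixes f :: "'a::ab_group_add \<Rightarrow> 'b::ab_group_add"
  shows "lmap s t f \<Longrightarrow> f (dsum H h F) = dsum H h (\<lambda>a b. f (F a b))"
  by (simp add: dsum_def case_prod_unfold lmap_sum_list)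

lemma dsum_mult_left: "x * dsum H h F = dsum H h (\<lambda>a b. x * F a b :: 'r::ring)"
  by (simp add: dsum_def case_prod_unfold sum_list_const_mult)

lemma dsum_mult_right: "dsum H h F * x = dsum H h (\<lambda>a b. F a b * x :: 'r::ring)"
  by (simp add: dsum_def case_prod_unfold sum_list_mult_const)

text \<open>Nearly every use of coassociativity or of the unit axioms requires that a Sweedler
  expression be linear in each leg. As \<open>lmap\<close> carries no vector space assumptions,
  these rules settle such goals by following the structure of the term.\<close>

named_theorems lin_rules

lemma lmap_id [lin_rules]: "lmap s s (\<lambda>x. x)"
  by (simp add: lmap_def)

lemma lmap_comp: "lmap t u f \<Longrightarrow> lmap s t g \<Longrightarrow> lmap s u (\<lambda>x. f (g x))"
  by (simp add: lmap_def)

lemma lmap_field_left [lin_rules]: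
  "lmap s (*) g \<Longrightarrow> lmap s (*) (\<lambda>x. g x * (c::'k::field))"
  by (simp add: lmap_def algebra_simps)

lemma lmap_field_right [lin_rules]:
  "lmap s (*) g \<Longrightarrow> lmap s (*) (\<lambda>x. (c::'k::field) * g x)"
  by (simp add: lmap_def algebra_simps)

section \<open>The axioms of a weak Hopf algebra as identities of Sweedler sums\<close>

locale whopf =
  fixes H :: "('k::field, 'h::ab_group_add) wha"
  assumes wha: "weak_hopf_algebra H" and bij_ant: "bij (ant H)"
begin

abbreviation hmul (infixl "\<odot>" 70) where "x \<odot> y \<equiv> mu H x y"
abbreviation hone ("\<one>") where "\<one> \<equiv> un H"
abbreviation "S \<equiv> ant H"
abbreviation "\<epsilon> \<equiv> eps H"
abbreviation "et \<equiv> eps_t H"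
abbreviation "es \<equiv> eps_s H"
abbreviation "\<Delta> \<equiv> dsum H"
abbreviation "hs \<equiv> sc H"

definition blin :: "('k \<Rightarrow> 'w \<Rightarrow> 'w) \<Rightarrow> ('h \<Rightarrow> 'h \<Rightarrow> 'w::plus) \<Rightarrow> bool" where
  "blin t F \<longleftrightarrow> (\<forall>x. lmap hs t (F x)) \<and> (\<forall>y. lmap hs t (\<lambda>x. F x y))"

definition tlin :: "('k \<Rightarrow> 'w \<Rightarrow> 'w) \<Rightarrow> ('h \<Rightarrow> 'h \<Rightarrow> 'h \<Rightarrow> 'w::plus) \<Rightarrow> bool" where
  "tlin t F \<longleftrightarrow> (\<forall>x y. lmap hs t (F x y)) \<and> (\<forall>x z. lmap hs t (\<lambda>y. F x y z))
     \<and> (\<forall>y z. lmap hs t (\<lambda>x. F x y z))"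

lemma blinI [lin_rules]:
  "(\<And>y. lmap hs t (\<lambda>x. F x y)) \<Longrightarrow> (\<And>x. lmap hs t (\<lambda>y. F x y)) \<Longrightarrow> blin t F"
  by (simp add: blin_def)

lemma tlinI [lin_rules]:
  "(\<And>y z. lmap hs t (\<lambda>x. F x y z)) \<Longrightarrow> (\<And>x z. lmap hs t (\<lambda>y. F x y z))
   \<Longrightarrow> (\<And>x y. lmap hs t (\<lambda>z. F x y z)) \<Longrightarrow> tlin t F"
  by (simp add: tlin_def)

lemma blin_1: "blin t F \<Longrightarrow> lmap s hs g \<Longrightarrow> lmap s t (\<lambda>x. F (g x) y)"
  and blin_2: "blin t F \<Longrightarrow> lmap s hs g \<Longrightarrow> lmap s t (\<lambda>x. F y (g x))"
  by (simp_all add: lmap_def blin_def)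

lemma tlin_1: "tlin t F \<Longrightarrow> lmap s hs g \<Longrightarrow> lmap s t (\<lambda>x. F (g x) y z)"
  and tlin_2: "tlin t F \<Longrightarrow> lmap s hs g \<Longrightarrow> lmap s t (\<lambda>x. F y (g x) z)"
  and tlin_3: "tlin t F \<Longrightarrow> lmap s hs g \<Longrightarrow> lmap s t (\<lambda>x. F y z (g x))"
  by (simp_all add: lmap_def tlin_def)

lemmas blin_rules = blin_1 blin_2
lemmas tlin_rules = tlin_1 tlin_2 tlin_3

lemma vector_space_hs: "vector_space hs"
  using wha unfolding weak_hopf_algebra_def by blast

lemma bil_iff_blin: "bil H f \<longleftrightarrow> blin (*) f"
  by (simp add: bil_def blin_def linear_iff_lmap[OF vector_space_hs vector_space_field])

lemma tril_iff_tlin: "tril H f \<longleftrightarrow> tlin (*) f"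
  by (simp add: tril_def tlin_def linear_iff_lmap[OF vector_space_hs vector_space_field])

lemma lmap_hmul_left [lin_rules]: "lmap s hs g \<Longrightarrow> lmap s hs (\<lambda>x. g x \<odot> y)"
  and lmap_hmul_right [lin_rules]: "lmap s hs g \<Longrightarrow> lmap s hs (\<lambda>x. y \<odot> g x)"
  and lmap_ant [lin_rules]: "lmap s hs g \<Longrightarrow> lmap s hs (\<lambda>x. S (g x))"
  and lmap_eps [lin_rules]: "lmap s hs g \<Longrightarrow> lmap s (*) (\<lambda>x. \<epsilon> (g x))"
proof -
  have lin: "\<forall>y. Vector_Spaces.linear hs hs (\<lambda>x. x \<odot> y)" "\<forall>y. Vector_Spaces.linear hs hs (mu H y)"
    "Vector_Spaces.linear hs hs S" "Vector_Spaces.linear hs (*) \<epsilon>"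
    using wha unfolding weak_hopf_algebra_def by - (elim conjE, assumption)+
  have "\<forall>y. lmap hs hs (\<lambda>x. x \<odot> y)" "\<forall>y. lmap hs hs (mu H y)" "lmap hs hs S" "lmap hs (*) \<epsilon>"
    using lin by (simp_all only: simp_thms linear_iff_lmap[OF vector_space_hs vector_space_hs]
        linear_iff_lmap[OF vector_space_hs vector_space_field])
  then show "lmap s hs g \<Longrightarrow> lmap s hs (\<lambda>x. g x \<odot> y)" "lmap s hs g \<Longrightarrow> lmap s hs (\<lambda>x. y \<odot> g x)"
    "lmap s hs g \<Longrightarrow> lmap s hs (\<lambda>x. S (g x))" "lmap s hs g \<Longrightarrow> lmap s (*) (\<lambda>x. \<epsilon> (g x))"
    by (simp_all add: lmap_def)
qed

lemma hmul_assoc: "(x \<odot> y) \<odot> z = x \<odot> (y \<odot> z)"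
  and hmul_one_left [simp]: "\<one> \<odot> x = x"
  and hmul_one_right [simp]: "x \<odot> \<one> = x"
  using wha unfolding weak_hopf_algebra_def by blast+

lemma lmap_scale_left [lin_rules]:
  fixes t :: "'k \<Rightarrow> 'w::ab_group_add \<Rightarrow> 'w"
  assumes "vector_space t" "lmap s (*) g"
  shows "lmap s t (\<lambda>x. t (g x) w)"
proof -
  interpret vector_space t by fact
  show ?thesis using assms(2) by (simp add: lmap_def scale_left_distrib)
qed

lemma lmap_scale_right [lin_rules]:
  fixes t :: "'k \<Rightarrow> 'w::ab_group_add \<Rightarrow> 'w"
  assumes "vector_space t" "lmap s t g"
  shows "lmap s t (\<lambda>x. t c (g x))"
proof -
  interpret vector_space t by fact
  show ?thesis using assms(2) by (simp add: lmap_def scale_right_distrib mult.commute)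
qed

lemma lmap_dsum_const [lin_rules]:
  fixes t :: "'k \<Rightarrow> 'w::ab_group_add \<Rightarrow> 'w"
  assumes t: "vector_space t" and "\<And>a b. lmap s t (\<lambda>x. F x a b)"
  shows "lmap s t (\<lambda>x. \<Delta> h (F x))"
proof -
  have "lmap t t (t c)" for c
    using lmap_scale_right[OF t lmap_id] .
  then have "t c (\<Delta> h (F x)) = \<Delta> h (\<lambda>a b. t c (F x a b))" for c x
    by (rule lmap_dsum)
  moreover have "F (x + y) = (\<lambda>a b. F x a b + F y a b)" "F (s c x) = (\<lambda>a b. t c (F x a b))" for x y c
    by (simp_all add: fun_eq_iff lmap_add[OF assms(2)] lmap_scale[OF assms(2)])
  ultimately show ?thesis
    by (simp add: lmap_def dsum_add)
qed

lemma dsum_linear: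
  "bil H f \<Longrightarrow> Vector_Spaces.linear hs (*) (\<lambda>h. \<Sum>(a, b)\<leftarrow>cm H h. f a b)"
  using wha unfolding weak_hopf_algebra_def by blast

text \<open>The list \<open>cm H h\<close> is only a representative and need not depend linearly on
  h; its value under a bilinear map does. For scalar values this is an axiom, and separating
  functionals give the general case. \<open>coassoc\<close>, \<open>dsum_hmul\<close> and
  \<open>weak_unit\<close> follow the same pattern.\<close>

lemma lmap_dsum_arg [lin_rules]:
  fixes t :: "'k \<Rightarrow> 'w::ab_group_add \<Rightarrow> 'w"
  assumes t: "vector_space t" and F: "blin t F" and g: "lmap s hs g"
  shows "lmap s t (\<lambda>x. \<Delta> (g x) F)"
proof -
  have scalar: "lmap hs (*) (\<lambda>h. \<Delta> h (\<lambda>a b. f (F a b)))" if f: "lmap t (*) f" for f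
  proof -
    have "bil H (\<lambda>a b. f (F a b))"
      unfolding bil_iff_blin by (intro lin_rules lmap_comp[OF f] blin_rules[OF F])
    then show ?thesis
      unfolding linear_iff_lmap[OF vector_space_hs vector_space_field, symmetric] dsum_def
      using dsum_linear by blast
  qed
  have "lmap hs t (\<lambda>h. \<Delta> h F)"
    unfolding lmap_def
  proof (intro conjI allI functionals_separate[OF t])
    fix f x y assume f: "lmap t (*) f"
    show "f (\<Delta> (x + y) F) = f (\<Delta> x F + \<Delta> y F)"
      using lmap_add[OF scalar[OF f]] by (simp add: lmap_add[OF f] lmap_dsum[OF f])
  next
    fix f x c assume f: "lmap t (*) f"
    show "f (\<Delta> (hs c x) F) = f (t c (\<Delta> x F))"
      using lmap_scale[OF scalar[OF f]] by (simp add: lmap_scale[OF f] lmap_dsum[OF f])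
  qed
  from lmap_comp[OF this g] show ?thesis .
qed

lemma coassoc:
  fixes t :: "'k \<Rightarrow> 'w::ab_group_add \<Rightarrow> 'w"
  assumes t: "vector_space t" and F: "tlin t F"
  shows "\<Delta> h (\<lambda>a b. \<Delta> a (\<lambda>c d. F c d b)) = \<Delta> h (\<lambda>a b. \<Delta> b (\<lambda>c d. F a c d))"
proof (rule functionals_separate[OF t])
  fix f assume f: "lmap t (*) f"
  have "tril H (\<lambda>a b c. f (F a b c))"
    unfolding tril_iff_tlin by (intro lin_rules lmap_comp[OF f] tlin_rules[OF F])
  moreover have "teq3 H (cm2L H h) (cm2R H h)"
    using wha unfolding weak_hopf_algebra_def by blast
  ultimately have "(\<Sum>(a, b, c)\<leftarrow>cm2L H h. f (F a b c)) = (\<Sum>(a, b, c)\<leftarrow>cm2R H h. f (F a b c))"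
    by (simp add: teq3_def)
  then show "f (\<Delta> h (\<lambda>a b. \<Delta> a (\<lambda>c d. F c d b))) = f (\<Delta> h (\<lambda>a b. \<Delta> b (\<lambda>c d. F a c d)))"
    unfolding lmap_dsum[OF f]
    by (simp add: dsum_def cm2L_def cm2R_def case_prod_unfold map_concat
        sum_list_concat o_def)
qed

lemma dsum_hmul:
  fixes t :: "'k \<Rightarrow> 'w::ab_group_add \<Rightarrow> 'w"
  assumes t: "vector_space t" and F: "blin t F"
  shows "\<Delta> (h \<odot> k) F = \<Delta> h (\<lambda>a b. \<Delta> k (\<lambda>c d. F (a \<odot> c) (b \<odot> d)))"
proof (rule functionals_separate[OF t])
  fix f assume f: "lmap t (*) f"
  have "bil H (\<lambda>a b. f (F a b))"
    unfolding bil_iff_blin by (intro lin_rules lmap_comp[OF f] blin_rules[OF F])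
  moreover have "teq2 H (cm H (h \<odot> k)) (tmul2 H (cm H h) (cm H k))"
    using wha unfolding weak_hopf_algebra_def by blast
  ultimately have "(\<Sum>(a, b)\<leftarrow>cm H (h \<odot> k). f (F a b)) = (\<Sum>(a, b)\<leftarrow>tmul2 H (cm H h) (cm H k). f (F a b))"
    by (simp add: teq2_def)
  then show "f (\<Delta> (h \<odot> k) F) = f (\<Delta> h (\<lambda>a b. \<Delta> k (\<lambda>c d. F (a \<odot> c) (b \<odot> d))))"
    unfolding lmap_dsum[OF f]
    by (simp add: dsum_def tmul2_def case_prod_unfold map_concat
        sum_list_concat o_def)
qed

lemma counit_left: "lmap hs t f \<Longrightarrow> \<Delta> h (\<lambda>a b. t (\<epsilon> a) (f b)) = f h"
  for t :: "'k \<Rightarrow> 'w::ab_group_add \<Rightarrow> 'w"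
proof -
  assume f: "lmap hs t f"
  have "\<Delta> h (\<lambda>a b. hs (\<epsilon> a) b) = h"
    using wha unfolding weak_hopf_algebra_def dsum_def by blast
  then show ?thesis using lmap_dsum[OF f, of H h "\<lambda>a b. hs (\<epsilon> a) b"] by (simp add: lmap_scale[OF f])
qed

lemma counit_right: "lmap hs t f \<Longrightarrow> \<Delta> h (\<lambda>a b. t (\<epsilon> b) (f a)) = f h"
  for t :: "'k \<Rightarrow> 'w::ab_group_add \<Rightarrow> 'w"
proof -
  assume f: "lmap hs t f"
  have "\<Delta> h (\<lambda>a b. hs (\<epsilon> b) a) = h"
    using wha unfolding weak_hopf_algebra_def dsum_def by blast
  then show ?thesis using lmap_dsum[OF f, of H h "\<lambda>a b. hs (\<epsilon> b) a"] by (simp add: lmap_scale[OF f])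
qed

text \<open>The substitute for \<Delta>(1) = 1 \<otimes> 1: read from right to left it splits
  \<Delta>^2(1) into two independent copies of \<Delta>(1). Having both orders of the middle product
  is what makes H_t and H_s commute.\<close>

lemma weak_unit:
  fixes t :: "'k \<Rightarrow> 'w::ab_group_add \<Rightarrow> 'w"
  assumes t: "vector_space t" and F: "tlin t F"
  shows "\<Delta> \<one> (\<lambda>a b. \<Delta> \<one> (\<lambda>c d. F a (c \<odot> b) d)) = \<Delta> \<one> (\<lambda>a b. \<Delta> b (\<lambda>c d. F a c d))" (is ?L)
    and "\<Delta> \<one> (\<lambda>a b. \<Delta> \<one> (\<lambda>c d. F a (b \<odot> c) d)) = \<Delta> \<one> (\<lambda>a b. \<Delta> b (\<lambda>c d. F a c d))" (is ?R)
proof -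
  let ?X = "map (\<lambda>(a, b). (\<one>, a, b)) (cm H \<one>)" and ?Y = "map (\<lambda>(a, b). (a, b, \<one>)) (cm H \<one>)"
  have scalar: "f (\<Delta> \<one> (\<lambda>c d. \<Delta> \<one> (\<lambda>a b. F a (c \<odot> b) d))) = f (\<Delta> \<one> (\<lambda>a b. \<Delta> a (\<lambda>c d. F c d b)))
     \<and> f (\<Delta> \<one> (\<lambda>a b. \<Delta> \<one> (\<lambda>c d. F a (b \<odot> c) d))) = f (\<Delta> \<one> (\<lambda>a b. \<Delta> a (\<lambda>c d. F c d b)))"
    if f: "lmap t (*) f" for f
  proof -
    have "tril H (\<lambda>a b c. f (F a b c))"
      unfolding tril_iff_tlin by (intro lin_rules lmap_comp[OF f] tlin_rules[OF F])
    moreover have "teq3 H (tmul3 H ?X ?Y) (cm2L H \<one>)" "teq3 H (cm2L H \<one>) (tmul3 H ?Y ?X)"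
      using wha unfolding weak_hopf_algebra_def by blast+
    ultimately have
      "(\<Sum>(a, b, c)\<leftarrow>tmul3 H ?X ?Y. f (F a b c)) = (\<Sum>(a, b, c)\<leftarrow>cm2L H \<one>. f (F a b c))"
      "(\<Sum>(a, b, c)\<leftarrow>tmul3 H ?Y ?X. f (F a b c)) = (\<Sum>(a, b, c)\<leftarrow>cm2L H \<one>. f (F a b c))"
      by (simp_all add: teq3_def)
    then show ?thesis
      unfolding lmap_dsum[OF f]
    by (simp add: dsum_def cm2L_def tmul3_def case_prod_unfold map_concat
          sum_list_concat o_def)
  qed
  note co = coassoc[OF t F, of \<one>]
  show ?L
    unfolding dsum_swap[of H \<one> \<one> "\<lambda>a b c d. F a (c \<odot> b) d"] co[symmetric]
    by (rule functionals_separate[OF t]) (use scalar in blast)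
  show ?R
    unfolding co[symmetric] by (rule functionals_separate[OF t]) (use scalar in blast)
qed

lemma eps_mult: "\<Delta> h (\<lambda>a b. \<epsilon> (k \<odot> a) * \<epsilon> (b \<odot> g)) = \<epsilon> (k \<odot> h \<odot> g)"
  using wha unfolding weak_hopf_algebra_def dsum_def by blast

lemma eps_mult': "\<Delta> h (\<lambda>a b. \<epsilon> (k \<odot> b) * \<epsilon> (a \<odot> g)) = \<epsilon> (k \<odot> h \<odot> g)"
proof (rule sym)
  show "\<epsilon> (k \<odot> h \<odot> g) = \<Delta> h (\<lambda>a b. \<epsilon> (k \<odot> b) * \<epsilon> (a \<odot> g))"
    using wha unfolding weak_hopf_algebra_def dsum_def by blast
qed

lemma et_eq: "et h = \<Delta> \<one> (\<lambda>a b. hs (\<epsilon> (a \<odot> h)) b)"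
  and es_eq: "es h = \<Delta> \<one> (\<lambda>a b. hs (\<epsilon> (h \<odot> b)) a)"
  by (simp_all add: eps_t_def eps_s_def dsum_def)

lemma ant_right: "\<Delta> h (\<lambda>a b. a \<odot> S b) = et h"
  and ant_left: "\<Delta> h (\<lambda>a b. S a \<odot> b) = es h"
  using wha unfolding weak_hopf_algebra_def dsum_def by blast+

lemma ant_ant: "\<Delta> h (\<lambda>a b. \<Delta> a (\<lambda>c d. S c \<odot> d \<odot> S b)) = S h"
proof -
  have "S h = (\<Sum>(a, b, c)\<leftarrow>cm2L H h. S a \<odot> b \<odot> S c)"
    using wha unfolding weak_hopf_algebra_def by blast
  then show ?thesis
    by (simp only: dsum_def cm2L_def case_prod_unfold map_concat sum_list_concat map_map o_def fst_conv snd_conv)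
qed

lemma lmap_et [lin_rules]: "lmap s hs g \<Longrightarrow> lmap s hs (\<lambda>x. et (g x))"
  and lmap_es [lin_rules]: "lmap s hs g \<Longrightarrow> lmap s hs (\<lambda>x. es (g x))"
  unfolding et_eq es_eq by (intro lin_rules vector_space_hs; assumption)+

end

section \<open>Weak Hopf algebras\<close>

context whopf
begin

lemmas lin_all = lin_rules vector_space_hs vector_space_field

section \<open>Coproducts and the counital maps\<close>

context
  fixes t :: "'k \<Rightarrow> 'w::ab_group_add \<Rightarrow> 'w"
  assumes t: "vector_space t"
begin

lemma dsum_one_left: "blin t F \<Longrightarrow> \<Delta> \<one> (\<lambda>a b. \<Delta> h (\<lambda>c d. F (a \<odot> c) (b \<odot> d))) = \<Delta> h F"
  and dsum_one_right: "blin t F \<Longrightarrow> \<Delta> h (\<lambda>a b. \<Delta> \<one> (\<lambda>c d. F (a \<odot> c) (b \<odot> d))) = \<Delta> h F"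
  using dsum_hmul[OF t, of F \<one> h] dsum_hmul[OF t, of F h \<one>] by simp_all

lemma lmap_et_apply: "lmap hs t f \<Longrightarrow> f (et h) = \<Delta> \<one> (\<lambda>a b. t (\<epsilon> (a \<odot> h)) (f b))"
  and lmap_es_apply: "lmap hs t f \<Longrightarrow> f (es h) = \<Delta> \<one> (\<lambda>a b. t (\<epsilon> (h \<odot> b)) (f a))"
  by (simp_all add: et_eq es_eq lmap_dsum lmap_scale)

text \<open>Insert the counit into 1_1 h and split the resulting \<Delta>^2(1) by
  \<open>weak_unit\<close>: one copy of \<Delta>(1) forms \<epsilon>_t, the other is absorbed by
  \<Delta>(h).\<close>

lemma dsum_et_right:
  assumes F: "blin t F"
  shows "\<Delta> h (\<lambda>a b. F a (et b)) = \<Delta> \<one> (\<lambda>a b. F (a \<odot> h) b)"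
proof -
  note L = lin_all t blin_rules[OF F]
  have "\<Delta> \<one> (\<lambda>a b. F (a \<odot> h) b) = \<Delta> \<one> (\<lambda>a b. \<Delta> (a \<odot> h) (\<lambda>p q. t (\<epsilon> q) (F p b)))"
    by (subst counit_right) (intro L refl)+
  also have "\<dots> = \<Delta> \<one> (\<lambda>a b. \<Delta> a (\<lambda>a1 a2. \<Delta> h (\<lambda>h1 h2. t (\<epsilon> (a2 \<odot> h2)) (F (a1 \<odot> h1) b))))"
    by (subst dsum_hmul[OF t]) (intro L refl)+
  also have "\<dots> = \<Delta> \<one> (\<lambda>a b. \<Delta> b (\<lambda>c d. \<Delta> h (\<lambda>h1 h2. t (\<epsilon> (c \<odot> h2)) (F (a \<odot> h1) d))))"
    by (rule coassoc[OF t]) (intro L)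
  also have "\<dots> = \<Delta> \<one> (\<lambda>a b. \<Delta> \<one> (\<lambda>c d. \<Delta> h (\<lambda>h1 h2. t (\<epsilon> ((c \<odot> b) \<odot> h2)) (F (a \<odot> h1) d))))"
    by (rule weak_unit(1)[OF t, symmetric]) (intro L)
  also have "\<dots> = \<Delta> \<one> (\<lambda>a b. \<Delta> h (\<lambda>h1 h2. F (a \<odot> h1) (et (b \<odot> h2))))"
    by (subst dsum_swap) (subst lmap_et_apply, intro L, simp add: hmul_assoc)
  also have "\<dots> = \<Delta> h (\<lambda>a b. F a (et b))"
    by (rule dsum_one_left) (intro L)
  finally show ?thesis by simp
qed

lemma dsum_es_left:
  assumes F: "blin t F"
  shows "\<Delta> h (\<lambda>a b. F (es a) b) = \<Delta> \<one> (\<lambda>a b. F a (h \<odot> b))"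
proof -
  note L = lin_all t blin_rules[OF F]
  have "\<Delta> \<one> (\<lambda>a b. F a (h \<odot> b)) = \<Delta> \<one> (\<lambda>a b. \<Delta> (h \<odot> b) (\<lambda>p q. t (\<epsilon> p) (F a q)))"
    by (subst counit_left) (intro L refl)+
  also have "\<dots> = \<Delta> \<one> (\<lambda>a b. \<Delta> h (\<lambda>h1 h2. \<Delta> b (\<lambda>c d. t (\<epsilon> (h1 \<odot> c)) (F a (h2 \<odot> d)))))"
    by (subst dsum_hmul[OF t]) (intro L refl)+
  also have "\<dots> = \<Delta> \<one> (\<lambda>a b. \<Delta> b (\<lambda>c d. \<Delta> h (\<lambda>h1 h2. t (\<epsilon> (h1 \<odot> c)) (F a (h2 \<odot> d)))))"
    by (subst dsum_swap) (rule refl)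
  also have "\<dots> = \<Delta> \<one> (\<lambda>a b. \<Delta> \<one> (\<lambda>c d. \<Delta> h (\<lambda>h1 h2. t (\<epsilon> (h1 \<odot> (c \<odot> b))) (F a (h2 \<odot> d)))))"
    by (rule weak_unit(1)[OF t, symmetric]) (intro L)
  also have "\<dots> = \<Delta> \<one> (\<lambda>c d. \<Delta> h (\<lambda>h1 h2. \<Delta> \<one> (\<lambda>a b. t (\<epsilon> (h1 \<odot> (c \<odot> b))) (F a (h2 \<odot> d)))))"
    by (subst dsum_swap) (subst dsum_swap[of H h], rule refl)
  also have "\<dots> = \<Delta> \<one> (\<lambda>c d. \<Delta> h (\<lambda>h1 h2. F (es (h1 \<odot> c)) (h2 \<odot> d)))"
    by (subst lmap_es_apply, intro L) (simp add: hmul_assoc)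
  also have "\<dots> = \<Delta> h (\<lambda>h1 h2. \<Delta> \<one> (\<lambda>c d. F (es (h1 \<odot> c)) (h2 \<odot> d)))"
    by (rule dsum_swap)
  also have "\<dots> = \<Delta> h (\<lambda>a b. F (es a) b)"
    by (rule dsum_one_right) (intro L)
  finally show ?thesis by simp
qed

lemma dsum_one_es: "blin t F \<Longrightarrow> \<Delta> \<one> (\<lambda>a b. F (es a) b) = \<Delta> \<one> F"
  and dsum_one_et: "blin t F \<Longrightarrow> \<Delta> \<one> (\<lambda>a b. F a (et b)) = \<Delta> \<one> F"
  by (simp_all add: dsum_es_left dsum_et_right)

text \<open>Since \<epsilon>_t(h) is a combination of legs 1_2, its coproduct is read off from
  \<Delta>^2(1); the two orders in \<open>weak_unit\<close> place \<epsilon>_t(h) on the right or on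
  the left of 1_1.\<close>

lemma dsum_et:
  assumes F: "blin t F"
  shows "\<Delta> (et h) F = \<Delta> \<one> (\<lambda>a b. F (a \<odot> et h) b)" (is ?A)
    and "\<Delta> (et h) F = \<Delta> \<one> (\<lambda>a b. F (et h \<odot> a) b)" (is ?B)
proof -
  note L = lin_all t blin_rules[OF F]
  have l: "lmap hs t (\<lambda>h. \<Delta> h F)" by (intro L F)
  have apply_et: "F (a \<odot> et h) b = \<Delta> \<one> (\<lambda>p q. t (\<epsilon> (p \<odot> h)) (F (a \<odot> q) b))"
    "F (et h \<odot> a) b = \<Delta> \<one> (\<lambda>p q. t (\<epsilon> (p \<odot> h)) (F (q \<odot> a) b))" for a b
    by (rule lmap_et_apply, intro L)+
  have "\<Delta> (et h) F = \<Delta> \<one> (\<lambda>p q. t (\<epsilon> (p \<odot> h)) (\<Delta> q F))"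
    by (rule lmap_et_apply[OF l])
  also have "\<dots> = \<Delta> \<one> (\<lambda>p q. \<Delta> q (\<lambda>c d. t (\<epsilon> (p \<odot> h)) (F c d)))"
    by (subst lmap_dsum[of t t]) (intro L refl)+
  finally have *: "\<Delta> (et h) F = \<Delta> \<one> (\<lambda>p q. \<Delta> q (\<lambda>c d. t (\<epsilon> (p \<odot> h)) (F c d)))" .
  also have "\<dots> = \<Delta> \<one> (\<lambda>p q. \<Delta> \<one> (\<lambda>c d. t (\<epsilon> (p \<odot> h)) (F (c \<odot> q) d)))"
    by (rule weak_unit(1)[OF t, symmetric]) (intro L)
  also have "\<dots> = \<Delta> \<one> (\<lambda>a b. F (a \<odot> et h) b)"
    unfolding apply_et by (rule dsum_swap)
  finally show ?A .
  note *
  also have "\<Delta> \<one> (\<lambda>p q. \<Delta> q (\<lambda>c d. t (\<epsilon> (p \<odot> h)) (F c d))) =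
      \<Delta> \<one> (\<lambda>p q. \<Delta> \<one> (\<lambda>c d. t (\<epsilon> (p \<odot> h)) (F (q \<odot> c) d)))"
    by (rule weak_unit(2)[OF t, symmetric]) (intro L)
  also have "\<dots> = \<Delta> \<one> (\<lambda>a b. F (et h \<odot> a) b)"
    unfolding apply_et by (rule dsum_swap)
  finally show ?B .
qed

lemma dsum_es:
  assumes F: "blin t F"
  shows "\<Delta> (es h) F = \<Delta> \<one> (\<lambda>a b. F a (es h \<odot> b))" (is ?A)
    and "\<Delta> (es h) F = \<Delta> \<one> (\<lambda>a b. F a (b \<odot> es h))" (is ?B)
proof -
  note L = lin_all t blin_rules[OF F]
  have l: "lmap hs t (\<lambda>h. \<Delta> h F)" by (intro L F)
  have "\<Delta> (es h) F = \<Delta> \<one> (\<lambda>p q. t (\<epsilon> (h \<odot> q)) (\<Delta> p F))"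
    by (rule lmap_es_apply[OF l])
  also have "\<dots> = \<Delta> \<one> (\<lambda>p q. \<Delta> p (\<lambda>c d. t (\<epsilon> (h \<odot> q)) (F c d)))"
    by (subst lmap_dsum[of t t]) (intro L refl)+
  also have "\<dots> = \<Delta> \<one> (\<lambda>p q. \<Delta> q (\<lambda>c d. t (\<epsilon> (h \<odot> d)) (F p c)))"
    by (rule coassoc[OF t]) (intro L)
  finally have *: "\<Delta> (es h) F = \<dots>" .
  also have "\<dots> = \<Delta> \<one> (\<lambda>p q. \<Delta> \<one> (\<lambda>c d. t (\<epsilon> (h \<odot> d)) (F p (c \<odot> q))))"
    by (rule weak_unit(1)[OF t, symmetric]) (intro L)
  also have "\<dots> = \<Delta> \<one> (\<lambda>a b. F a (es h \<odot> b))"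
    by (subst lmap_es_apply, intro L, rule refl)
  finally show ?A .
  note *
  also have "\<Delta> \<one> (\<lambda>p q. \<Delta> q (\<lambda>c d. t (\<epsilon> (h \<odot> d)) (F p c))) =
     \<Delta> \<one> (\<lambda>p q. \<Delta> \<one> (\<lambda>c d. t (\<epsilon> (h \<odot> d)) (F p (q \<odot> c))))"
    by (rule weak_unit(2)[OF t, symmetric]) (intro L)
  also have "\<dots> = \<Delta> \<one> (\<lambda>a b. F a (b \<odot> es h))"
    by (subst lmap_es_apply, intro L, rule refl)
  finally show ?B .
qed

text \<open>The copy of \<Delta>(1) in the coproduct of an element of H_t or H_s is absorbed by
  \<Delta>(h), so that only one leg is touched: the first for H_t, the second for H_s.\<close>

lemma dsum_hmul_et: "blin t F \<Longrightarrow> \<Delta> (h \<odot> et k) F = \<Delta> h (\<lambda>a b. F (a \<odot> et k) b)"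
  and dsum_et_hmul: "blin t F \<Longrightarrow> \<Delta> (et k \<odot> h) F = \<Delta> h (\<lambda>a b. F (et k \<odot> a) b)"
  and dsum_hmul_es: "blin t F \<Longrightarrow> \<Delta> (h \<odot> es k) F = \<Delta> h (\<lambda>a b. F a (b \<odot> es k))"
  and dsum_es_hmul: "blin t F \<Longrightarrow> \<Delta> (es k \<odot> h) F = \<Delta> h (\<lambda>a b. F a (es k \<odot> b))"
proof -
  assume F: "blin t F"
  note L = lin_all t blin_rules[OF F]
  have "\<Delta> (h \<odot> et k) F = \<Delta> h (\<lambda>a b. \<Delta> \<one> (\<lambda>c d. F (a \<odot> c \<odot> et k) (b \<odot> d)))"
    by (subst dsum_hmul[OF t F], subst dsum_et(1)) (intro L, simp add: hmul_assoc)
  also have "\<dots> = \<Delta> h (\<lambda>a b. F (a \<odot> et k) b)"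
    by (rule dsum_one_right) (intro L)
  finally show "\<Delta> (h \<odot> et k) F = \<dots>" .
  have "\<Delta> (et k \<odot> h) F = \<Delta> \<one> (\<lambda>a b. \<Delta> h (\<lambda>c d. F (et k \<odot> (a \<odot> c)) (b \<odot> d)))"
    by (subst dsum_hmul[OF t F], subst dsum_et(2)) (intro L, simp add: hmul_assoc)
  also have "\<dots> = \<Delta> h (\<lambda>a b. F (et k \<odot> a) b)"
    by (rule dsum_one_left) (intro L)
  finally show "\<Delta> (et k \<odot> h) F = \<dots>" .
  have "\<Delta> (h \<odot> es k) F = \<Delta> h (\<lambda>a b. \<Delta> \<one> (\<lambda>c d. F (a \<odot> c) (b \<odot> d \<odot> es k)))"
    by (subst dsum_hmul[OF t F], subst dsum_es(2)) (intro L, simp add: hmul_assoc)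
  also have "\<dots> = \<Delta> h (\<lambda>a b. F a (b \<odot> es k))"
    by (rule dsum_one_right) (intro L)
  finally show "\<Delta> (h \<odot> es k) F = \<dots>" .
  have "\<Delta> (es k \<odot> h) F = \<Delta> \<one> (\<lambda>a b. \<Delta> h (\<lambda>c d. F (a \<odot> c) (es k \<odot> (b \<odot> d))))"
    by (subst dsum_hmul[OF t F], subst dsum_es(1)) (intro L, simp add: hmul_assoc)
  also have "\<dots> = \<Delta> h (\<lambda>a b. F a (es k \<odot> b))"
    by (rule dsum_one_left) (intro L)
  finally show "\<Delta> (es k \<odot> h) F = \<dots>" .
qed

end

section \<open>H_t, H_s and the antipode on them\<close>

lemma et_one [simp]: "et \<one> = \<one>" and es_one [simp]: "es \<one> = \<one>"
  using counit_left[OF lmap_id, of \<one>] counit_right[OF lmap_id, of \<one>] by (simp_all add: et_eq es_eq)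

lemma dsum_hmul_right: "\<Delta> h F \<odot> y = \<Delta> h (\<lambda>a b. F a b \<odot> y)"
  and dsum_hmul_left: "y \<odot> \<Delta> h F = \<Delta> h (\<lambda>a b. y \<odot> F a b)"
  by (rule lmap_dsum[of hs hs], intro lin_all)+

text \<open>Both products expand over two copies of \<Delta>(1) and differ only in the order of the
  product in the middle leg.\<close>

lemma et_es_commute: "et h \<odot> es k = es k \<odot> et h"
proof -
  let ?F = "\<lambda>a c d. hs (\<epsilon> (a \<odot> h)) (hs (\<epsilon> (k \<odot> d)) c)"
  have sc_left: "hs c x \<odot> y = hs c (x \<odot> y)" and sc_right: "y \<odot> hs c x = hs c (y \<odot> x)" for c x y
    by (rule lmap_scale[of hs hs], intro lin_all)+
  have F: "tlin hs ?F" by (intro lin_all)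
  have comm: "hs c (hs d x) = hs d (hs c x)" for c d x
    using vector_space_hs by (simp add: vector_space_def mult.commute)
  have dsum_hs: "hs c (\<Delta> x G) = \<Delta> x (\<lambda>a b. hs c (G a b))" for c x G
    by (rule lmap_dsum[of hs hs], intro lin_all)
  have "es k \<odot> et h = \<Delta> \<one> (\<lambda>a b. \<Delta> \<one> (\<lambda>c d. ?F a (c \<odot> b) d))"
    unfolding et_eq es_eq dsum_hmul_left dsum_hmul_right sc_left sc_right dsum_hs ..
  also have "\<dots> = \<Delta> \<one> (\<lambda>a b. \<Delta> \<one> (\<lambda>c d. ?F a (b \<odot> c) d))"
    using weak_unit[OF vector_space_hs F] by simp
  also have "\<dots> = et h \<odot> es k"
    unfolding et_eq es_eq dsum_hmul_left dsum_hmul_right sc_left sc_right dsum_hs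
    by (subst dsum_swap) (simp add: comm)
  finally show ?thesis by simp
qed

lemma eps_hmul_et: "\<epsilon> (h \<odot> et k) = \<epsilon> (h \<odot> k)"
  and eps_es_hmul: "\<epsilon> (es h \<odot> k) = \<epsilon> (h \<odot> k)"
proof -
  have "\<epsilon> (h \<odot> et k) = \<Delta> \<one> (\<lambda>a b. \<epsilon> (a \<odot> k) * \<epsilon> (h \<odot> b))"
    by (rule lmap_et_apply[OF vector_space_field]) (intro lin_all)
  then show "\<epsilon> (h \<odot> et k) = \<epsilon> (h \<odot> k)" using eps_mult'[of \<one> h k] by (simp add: mult.commute)
  have "\<epsilon> (es h \<odot> k) = \<Delta> \<one> (\<lambda>a b. \<epsilon> (h \<odot> b) * \<epsilon> (a \<odot> k))"
    by (rule lmap_es_apply[OF vector_space_field, where f="\<lambda>x. \<epsilon> (x \<odot> k)"]) (intro lin_all)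
  then show "\<epsilon> (es h \<odot> k) = \<epsilon> (h \<odot> k)" using eps_mult'[of \<one> h k] by simp
qed

lemma et_hmul_et: "et (h \<odot> et k) = et (h \<odot> k)"
  and es_es_hmul: "es (es h \<odot> k) = es (h \<odot> k)"
  by (simp_all add: et_eq[of "h \<odot> _"] es_eq[of "_ \<odot> k"] hmul_assoc[symmetric] eps_hmul_et)
    (simp add: hmul_assoc eps_es_hmul)

lemma et_et_hmul: "et (et k \<odot> h) = et k \<odot> et h"
proof -
  have "et (et k \<odot> h) = \<Delta> h (\<lambda>a b. (et k \<odot> a) \<odot> S b)"
    unfolding ant_right[symmetric, of "et k \<odot> h"]
    by (rule dsum_et_hmul[OF vector_space_hs]) (intro lin_all)
  then show ?thesis by (simp add: hmul_assoc dsum_hmul_left[symmetric] ant_right)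
qed

lemma es_hmul_es: "es (h \<odot> es k) = es h \<odot> es k"
proof -
  have "es (h \<odot> es k) = \<Delta> h (\<lambda>a b. S a \<odot> (b \<odot> es k))"
    unfolding ant_left[symmetric, of "h \<odot> es k"]
    by (rule dsum_hmul_es[OF vector_space_hs]) (intro lin_all)
  then show ?thesis by (simp add: hmul_assoc[symmetric] dsum_hmul_right[symmetric] ant_left)
qed

lemma ant_es: "\<Delta> h (\<lambda>a b. es a \<odot> S b) = S h"
  using ant_ant[of h] by (simp add: dsum_hmul_right[symmetric] ant_left)

lemma ant_et: "\<Delta> h (\<lambda>a b. S a \<odot> et b) = S h"
proof -
  have "S h = \<Delta> h (\<lambda>a b. \<Delta> b (\<lambda>c d. S a \<odot> c \<odot> S d))"
    using ant_ant[of h] coassoc[OF vector_space_hs, of "\<lambda>a b c. S a \<odot> b \<odot> S c" h]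
    by (simp add: lin_all)
  then show ?thesis by (simp add: hmul_assoc dsum_hmul_left[symmetric] ant_right)
qed

text \<open>Expand S(z) = \<epsilon>_s(z_1) S(z_2) with \<Delta>(z) = z 1_1 \<otimes> 1_2. As 1_1
  may be replaced by \<epsilon>_s(1_1), the factor \<epsilon>_s(z) splits off, and 1_1 S(1_2) = 1
  remains. \<open>S_es\<close> is the mirror image.\<close>

lemma S_et: "S (et k) = es (et k)"
proof -
  have "S (et k) = \<Delta> \<one> (\<lambda>a b. es (et k \<odot> a) \<odot> S b)"
    unfolding ant_es[symmetric, of "et k"] by (rule dsum_et(2)[OF vector_space_hs]) (intro lin_all)
  also have "\<dots> = \<Delta> \<one> (\<lambda>a b. es (et k \<odot> es a) \<odot> S b)"
    by (rule dsum_one_es[OF vector_space_hs, symmetric]) (intro lin_all)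
  also have "\<dots> = \<Delta> \<one> (\<lambda>a b. es (et k) \<odot> a \<odot> S b)"
    unfolding es_hmul_es by (rule dsum_one_es[OF vector_space_hs]) (intro lin_all)
  also have "\<dots> = es (et k)"
    by (simp add: hmul_assoc dsum_hmul_left[symmetric] ant_right)
  finally show ?thesis .
qed

lemma S_es: "S (es k) = et (es k)"
proof -
  have "S (es k) = \<Delta> \<one> (\<lambda>a b. S a \<odot> et (b \<odot> es k))"
    unfolding ant_et[symmetric, of "es k"] by (rule dsum_es(2)[OF vector_space_hs]) (intro lin_all)
  also have "\<dots> = \<Delta> \<one> (\<lambda>a b. S a \<odot> et (et b \<odot> es k))"
    by (rule dsum_one_et[OF vector_space_hs, symmetric]) (intro lin_all)
  also have "\<dots> = \<Delta> \<one> (\<lambda>a b. S a \<odot> (b \<odot> et (es k)))"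
    unfolding et_et_hmul by (rule dsum_one_et[OF vector_space_hs]) (intro lin_all)
  also have "\<dots> = et (es k)"
    by (simp add: hmul_assoc[symmetric] dsum_hmul_right[symmetric] ant_left)
  finally show ?thesis .
qed

end

section \<open>The antipode reverses products and coproducts\<close>

context whopf
begin

lemma et_hmul: "et (h \<odot> k) = \<Delta> h (\<lambda>a b. a \<odot> et k \<odot> S b)"
  unfolding et_hmul_et[symmetric, of h k] ant_right[symmetric, of "h \<odot> et k"]
  by (rule dsum_hmul_et[OF vector_space_hs]) (intro lin_all)

lemma es_hmul: "es (h \<odot> k) = \<Delta> k (\<lambda>a b. S a \<odot> (es h \<odot> b))"
  unfolding es_es_hmul[symmetric, of h k] ant_left[symmetric, of "es h \<odot> k"]
  by (rule dsum_es_hmul[OF vector_space_hs]) (intro lin_all)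

text \<open>In the convolution algebra of maps from the tensor square of \<open>H\<close> to \<open>H\<close>, put
  \<open>f (h, k) = h k\<close>, \<open>f' (h, k) = S (h k)\<close> and \<open>g (h, k) = S k S h\<close>. Then \<open>f f' = f g\<close> and
  \<open>f' f = g f\<close>, so \<open>f' = f' f f' = f' f g = g f g = g\<close>.\<close>

lemma S_hmul: "S (h \<odot> k) = S k \<odot> S h"
proof -
  note v = vector_space_hs
  have "S (h \<odot> k) = \<Delta> h (\<lambda>h1 h2. \<Delta> k (\<lambda>k1 k2. S (h1 \<odot> k1) \<odot> et (h2 \<odot> k2)))"
    unfolding ant_et[symmetric, of "h \<odot> k"] by (rule dsum_hmul[OF v]) (intro lin_all)
  also have "\<dots> = \<Delta> h (\<lambda>h1 h2. \<Delta> k (\<lambda>k1 k2. \<Delta> h2 (\<lambda>p q. \<Delta> k2 (\<lambda>u w.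
      S (h1 \<odot> k1) \<odot> (p \<odot> u) \<odot> S w \<odot> S q))))"
    unfolding et_hmul by (simp add: dsum_hmul_left dsum_hmul_right ant_right[symmetric] hmul_assoc)
  also have "\<dots> = \<Delta> h (\<lambda>h1 h2. \<Delta> h2 (\<lambda>p q. \<Delta> k (\<lambda>k1 k2. \<Delta> k2 (\<lambda>u w.
      S (h1 \<odot> k1) \<odot> (p \<odot> u) \<odot> S w \<odot> S q))))"
    by (subst dsum_swap) (rule refl)
  also have "\<dots> = \<Delta> h (\<lambda>a q. \<Delta> a (\<lambda>h1 p. \<Delta> k (\<lambda>k1 k2. \<Delta> k2 (\<lambda>u w.
      S (h1 \<odot> k1) \<odot> (p \<odot> u) \<odot> S w \<odot> S q))))"
    by (rule coassoc[OF v, symmetric]) (intro lin_all)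
  also have "\<dots> = \<Delta> h (\<lambda>a q. \<Delta> a (\<lambda>h1 p. \<Delta> k (\<lambda>b w. \<Delta> b (\<lambda>k1 u.
      S (h1 \<odot> k1) \<odot> (p \<odot> u) \<odot> S w \<odot> S q))))"
    by (subst coassoc[OF v, symmetric]) (intro lin_all refl)+
  also have "\<dots> = \<Delta> h (\<lambda>a q. \<Delta> k (\<lambda>b w. \<Delta> (a \<odot> b) (\<lambda>x y. S x \<odot> y) \<odot> S w \<odot> S q))"
    by (subst dsum_swap, subst dsum_hmul[OF v]) (intro lin_all, simp add: dsum_hmul_right)
  also have "\<dots> = \<Delta> h (\<lambda>a q. \<Delta> k (\<lambda>b w. es (a \<odot> b) \<odot> S w \<odot> S q))"
    by (simp add: ant_left)
  also have "\<dots> = \<Delta> h (\<lambda>a q. \<Delta> k (\<lambda>b w. \<Delta> b (\<lambda>u x. S u \<odot> es a \<odot> (x \<odot> S w) \<odot> S q)))"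
    by (simp add: es_hmul dsum_hmul_right hmul_assoc)
  also have "\<dots> = \<Delta> h (\<lambda>a q. \<Delta> k (\<lambda>b w. \<Delta> w (\<lambda>u x. S b \<odot> es a \<odot> (u \<odot> S x) \<odot> S q)))"
    by (subst coassoc[OF v]) (intro lin_all refl)+
  \<comment> \<open>This is g f g = g: \<epsilon>_s(h_1) and \<epsilon>_t(k_2) commute, after which
    each stands next to the antipode that absorbs it.\<close>
  also have "\<dots> = \<Delta> h (\<lambda>a q. \<Delta> k (\<lambda>b w. (S b \<odot> et w) \<odot> (es a \<odot> S q)))"
  proof -
    have "\<Delta> w (\<lambda>u x. S b \<odot> es a \<odot> (u \<odot> S x) \<odot> S q) = S b \<odot> (es a \<odot> et w) \<odot> S q" for a b q w
      unfolding dsum_hmul_left[symmetric] dsum_hmul_right[symmetric] ant_right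
      by (simp only: hmul_assoc)
    then show ?thesis by (simp only: et_es_commute[symmetric] hmul_assoc)
  qed
  also have "\<dots> = S k \<odot> S h"
    by (simp only: dsum_hmul_left[symmetric] dsum_hmul_right[symmetric] ant_et ant_es)
  finally show ?thesis .
qed

context
  fixes t :: "'k \<Rightarrow> 'w::ab_group_add \<Rightarrow> 'w"
  assumes t: "vector_space t"
begin

text \<open>The legs of \<Delta>(1) may be taken in H_s and H_t, and there S coincides with
  \<epsilon>_t and \<epsilon>_s respectively.\<close>

lemma dsum_one_et_es:
  assumes F: "blin t F"
  shows "\<Delta> \<one> (\<lambda>a b. F (et a) b) = \<Delta> \<one> (\<lambda>a b. F (S a) b)"
    and "\<Delta> \<one> (\<lambda>a b. F a (es b)) = \<Delta> \<one> (\<lambda>a b. F a (S b))"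
proof -
  note L = lin_all t blin_rules[OF F]
  have "\<Delta> \<one> (\<lambda>a b. F (et a) b) = \<Delta> \<one> (\<lambda>a b. F (et (es a)) b)"
    by (rule dsum_one_es[OF t, symmetric]) (intro L)
  also have "\<dots> = \<Delta> \<one> (\<lambda>a b. F (S a) b)"
    unfolding S_es[symmetric] by (rule dsum_one_es[OF t]) (intro L)
  finally show "\<Delta> \<one> (\<lambda>a b. F (et a) b) = \<dots>" .
  have "\<Delta> \<one> (\<lambda>a b. F a (es b)) = \<Delta> \<one> (\<lambda>a b. F a (es (et b)))"
    by (rule dsum_one_et[OF t, symmetric]) (intro L)
  also have "\<dots> = \<Delta> \<one> (\<lambda>a b. F a (S b))"
    unfolding S_et[symmetric] by (rule dsum_one_et[OF t]) (intro L)
  finally show "\<Delta> \<one> (\<lambda>a b. F a (es b)) = \<dots>" .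
qed

text \<open>By \<open>dsum_one_et_es\<close>, S becomes a counital map on each leg. Expanding both
  brings in two new copies of \<Delta>(1); the original copy disappears through \<epsilon>(p 1_1)
  \<epsilon>(1_2 d) = \<epsilon>(p d).\<close>

lemma dsum_one_S:
  assumes F: "blin t F"
  shows "\<Delta> \<one> (\<lambda>a b. F (S b) (S a)) = \<Delta> \<one> F"
proof -
  note L = lin_all t blin_rules[OF F]
  interpret t: vector_space t by (rule t)
  have "\<Delta> \<one> (\<lambda>a b. F (S b) (S a)) = \<Delta> \<one> (\<lambda>a b. F (es b) (et a))"
    by (subst dsum_one_et_es(1)[where F="\<lambda>a b. F (es b) a"], intro L,
        subst dsum_one_et_es(2)[where F="\<lambda>a b. F b (S a)"], intro L, rule refl)
  also have "\<dots> = \<Delta> \<one> (\<lambda>a b. \<Delta> \<one> (\<lambda>c d. \<Delta> \<one> (\<lambda>p q. t (\<epsilon> (p \<odot> a) * \<epsilon> (b \<odot> d)) (F c q))))"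
  proof -
    have "F (es b) (et a) = \<Delta> \<one> (\<lambda>c d. \<Delta> \<one> (\<lambda>p q. t (\<epsilon> (p \<odot> a) * \<epsilon> (b \<odot> d)) (F c q)))" for a b
    proof -
      have "F (es b) (et a) = \<Delta> \<one> (\<lambda>c d. t (\<epsilon> (b \<odot> d)) (F c (et a)))"
        by (rule lmap_es_apply[OF t, where f="\<lambda>x. F x (et a)"]) (intro L)
      also have "\<dots> = \<Delta> \<one> (\<lambda>c d. \<Delta> \<one> (\<lambda>p q. t (\<epsilon> (p \<odot> a)) (t (\<epsilon> (b \<odot> d)) (F c q))))"
        by (subst lmap_et_apply[OF t]) (intro L refl)+
      finally show ?thesis by simp
    qed
    then show ?thesis by (simp only:)
  qed
  also have "\<dots> = \<Delta> \<one> (\<lambda>c d. \<Delta> \<one> (\<lambda>p q. \<Delta> \<one> (\<lambda>a b. t (\<epsilon> (p \<odot> a) * \<epsilon> (b \<odot> d)) (F c q))))"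
    by (subst dsum_swap) (subst (2) dsum_swap, rule refl)
  also have "\<dots> = \<Delta> \<one> (\<lambda>c d. \<Delta> \<one> (\<lambda>p q. t (\<epsilon> (p \<odot> d)) (F c q)))"
  proof -
    have "\<Delta> \<one> (\<lambda>a b. t (\<epsilon> (p \<odot> a) * \<epsilon> (b \<odot> d)) w) = t (\<epsilon> (p \<odot> d)) w" for p d w
      using lmap_dsum[of "(*)" t "\<lambda>c. t c w" H \<one> "\<lambda>a b. \<epsilon> (p \<odot> a) * \<epsilon> (b \<odot> d)"]
      by (simp add: eps_mult lmap_def t.scale_left_distrib)
    then show ?thesis by (simp only:)
  qed
  also have "\<dots> = \<Delta> \<one> (\<lambda>c d. F c (et d))"
    by (subst lmap_et_apply[OF t], intro L) (rule refl)
  also have "\<dots> = \<Delta> \<one> F"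
    by (rule dsum_one_et[OF t F])
  finally show ?thesis .
qed

text \<open>The coproduct of h_1 S(h_2), in the form it would take if S were already known to
  reverse coproducts. The inner legs h_2 S(h_3) form \<epsilon>_t, and this alone suffices to
  evaluate it.\<close>

lemma dsum_et_ant:
  assumes K: "blin t K"
  shows "\<Delta> (et h) K = \<Delta> h (\<lambda>a b. \<Delta> a (\<lambda>p q. \<Delta> b (\<lambda>u v. K (p \<odot> S v) (q \<odot> S u))))"
proof -
  note L = lin_all t blin_rules[OF K]
  have "\<Delta> h (\<lambda>a b. \<Delta> a (\<lambda>p q. \<Delta> b (\<lambda>u v. K (p \<odot> S v) (q \<odot> S u)))) =
      \<Delta> h (\<lambda>p r. \<Delta> r (\<lambda>q b. \<Delta> b (\<lambda>u v. K (p \<odot> S v) (q \<odot> S u))))"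
    by (rule coassoc[OF t]) (intro L)
  also have "\<dots> = \<Delta> h (\<lambda>p r. \<Delta> r (\<lambda>c v. \<Delta> c (\<lambda>q u. K (p \<odot> S v) (q \<odot> S u))))"
    by (subst coassoc[OF t, symmetric]) (intro L refl)+
  also have "\<dots> = \<Delta> h (\<lambda>p r. \<Delta> r (\<lambda>c v. K (p \<odot> S v) (et c)))"
    unfolding ant_right[symmetric] by (subst lmap_dsum[of hs t]) (intro L refl)+
  also have "\<dots> = \<Delta> h (\<lambda>a v. \<Delta> a (\<lambda>p c. K (p \<odot> S v) (et c)))"
    by (rule coassoc[OF t, symmetric]) (intro L)
  also have "\<dots> = \<Delta> h (\<lambda>a v. \<Delta> \<one> (\<lambda>x y. K (x \<odot> a \<odot> S v) y))"
    by (subst dsum_et_right[OF t]) (intro L refl)+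
  also have "\<dots> = \<Delta> \<one> (\<lambda>x y. \<Delta> h (\<lambda>a v. K (x \<odot> (a \<odot> S v)) y))"
    by (subst dsum_swap) (simp add: hmul_assoc)
  also have "\<dots> = \<Delta> \<one> (\<lambda>x y. K (x \<odot> et h) y)"
    by (subst lmap_dsum[of hs t "\<lambda>z. K (_ \<odot> z) _", symmetric]) (intro L, simp add: ant_right)
  also have "\<dots> = \<Delta> (et h) K"
    by (rule dsum_et(1)[OF t K, symmetric])
  finally show ?thesis by simp
qed

text \<open>Dual to \<open>S_hmul\<close>: in S(h) = S(h_1) \<epsilon>_t(h_2) the coproduct of the
  second factor already shows the reversed legs, by \<open>dsum_et_ant\<close>. What stands before
  them is \<epsilon>_s and is absorbed by \<open>ant_es\<close>; the remaining \<Delta>(1) is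
  rewritten as S(1_2) \<otimes> S(1_1) and vanishes into \<Delta>(h).\<close>

lemma dsum_S:
  assumes F: "blin t F"
  shows "\<Delta> (S h) F = \<Delta> h (\<lambda>a b. F (S b) (S a))"
proof -
  note L = lin_all t blin_rules[OF F]
  define K where "K d u v = \<Delta> d (\<lambda>d1 d2. F (u \<odot> S d2) (v \<odot> S d1))" for d u v
  have K: "blin t (K d)" for d
    unfolding K_def by (intro L)
  have lF: "lmap hs t (\<lambda>x. \<Delta> x F)" by (intro L F)
  have "\<Delta> (S h) F = \<Delta> h (\<lambda>a b. \<Delta> (S a \<odot> et b) F)"
    unfolding ant_et[symmetric, of h] by (rule lmap_dsum[OF lF])
  also have "\<dots> = \<Delta> h (\<lambda>a b. \<Delta> (S a) (\<lambda>p q. \<Delta> (et b) (\<lambda>u v. F (p \<odot> u) (q \<odot> v))))"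
    by (simp only: dsum_hmul[OF t F])
  also have "\<dots> = \<Delta> h (\<lambda>a b. \<Delta> (S a) (\<lambda>p q. \<Delta> b (\<lambda>c d. \<Delta> c (\<lambda>c1 c2. \<Delta> d (\<lambda>d1 d2.
      F (p \<odot> (c1 \<odot> S d2)) (q \<odot> (c2 \<odot> S d1)))))))"
    by (subst dsum_et_ant) (intro L refl)+
  also have "\<dots> = \<Delta> h (\<lambda>a b. \<Delta> b (\<lambda>c d. \<Delta> (S a \<odot> c) (K d)))"
    by (subst dsum_swap) (simp add: dsum_hmul[OF t K], simp add: K_def hmul_assoc)
  also have "\<dots> = \<Delta> h (\<lambda>x d. \<Delta> x (\<lambda>a c. \<Delta> (S a \<odot> c) (K d)))"
    by (rule coassoc[OF t, symmetric]) (unfold K_def, intro L)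
  also have "\<dots> = \<Delta> h (\<lambda>x d. \<Delta> (es x) (K d))"
  proof -
    have "\<Delta> (es x) (K d) = \<Delta> x (\<lambda>a c. \<Delta> (S a \<odot> c) (K d))" for x d
      unfolding ant_left[symmetric] by (rule lmap_dsum[of hs t]) (intro L K)
    then show ?thesis by (simp only:)
  qed
  also have "\<dots> = \<Delta> h (\<lambda>x d. \<Delta> \<one> (\<lambda>u v. \<Delta> d (\<lambda>d1 d2. F (u \<odot> S d2) (v \<odot> (es x \<odot> S d1)))))"
    by (simp only: dsum_es(2)[OF t K]) (simp add: K_def hmul_assoc)
  also have "\<dots> = \<Delta> h (\<lambda>x d. \<Delta> d (\<lambda>d1 d2. \<Delta> \<one> (\<lambda>u v. F (u \<odot> S d2) (v \<odot> (es x \<odot> S d1)))))"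
    by (subst (2) dsum_swap) (rule refl)
  also have "\<dots> = \<Delta> h (\<lambda>y d. \<Delta> y (\<lambda>x d1. \<Delta> \<one> (\<lambda>u v. F (u \<odot> S d) (v \<odot> (es x \<odot> S d1)))))"
    by (rule coassoc[OF t, symmetric]) (intro L)
  also have "\<dots> = \<Delta> h (\<lambda>y d. \<Delta> \<one> (\<lambda>u v. F (u \<odot> S d) (v \<odot> S y)))"
    by (subst lmap_dsum[of hs t "\<lambda>z. \<Delta> \<one> (\<lambda>u v. F (u \<odot> S _) (v \<odot> z))", symmetric])
      (intro L, simp add: ant_es)
  also have "\<dots> = \<Delta> h (\<lambda>y d. \<Delta> \<one> (\<lambda>u v. F (S v \<odot> S d) (S u \<odot> S y)))"
    by (subst dsum_one_S[symmetric]) (intro L refl)+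
  also have "\<dots> = \<Delta> h (\<lambda>y d. \<Delta> \<one> (\<lambda>u v. F (S (d \<odot> v)) (S (y \<odot> u))))"
    by (simp add: S_hmul)
  also have "\<dots> = \<Delta> h (\<lambda>a b. F (S b) (S a))"
    by (rule dsum_one_right[OF t]) (intro L)
  finally show ?thesis .
qed

text \<open>Insert the counit into 1_2 k and split by \<open>weak_unit\<close>: one copy of
  \<Delta>(1) is absorbed by \<Delta>(k), the other by \<epsilon>(x 1_1) \<epsilon>(1_2 k_1) =
  \<epsilon>(x k_1).\<close>

lemma dsum_eps_left:
  assumes f: "lmap hs t f"
  shows "\<Delta> k (\<lambda>a b. t (\<epsilon> (x \<odot> a)) (f b)) = \<Delta> \<one> (\<lambda>a b. t (\<epsilon> (x \<odot> a)) (f (b \<odot> k)))"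
proof -
  note L = lin_all t lmap_comp[OF f]
  interpret t: vector_space t by (rule t)
  have *: "\<Delta> \<one> (\<lambda>u v. \<Delta> k (\<lambda>a b. t (\<epsilon> (d \<odot> (u \<odot> a))) (f (v \<odot> b)))) =
      \<Delta> k (\<lambda>a b. t (\<epsilon> (d \<odot> a)) (f b))" for d
    by (rule dsum_one_left[OF t]) (intro L)
  have "\<Delta> \<one> (\<lambda>c d. t (\<epsilon> (x \<odot> c)) (f (d \<odot> k))) =
      \<Delta> \<one> (\<lambda>c d. t (\<epsilon> (x \<odot> c)) (\<Delta> d (\<lambda>u v. \<Delta> k (\<lambda>a b. t (\<epsilon> (u \<odot> a)) (f (v \<odot> b))))))"
    by (subst counit_left[OF f, symmetric], subst dsum_hmul[OF t]) (intro L refl)+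
  also have "\<dots> = \<Delta> \<one> (\<lambda>c d. \<Delta> d (\<lambda>u v. t (\<epsilon> (x \<odot> c)) (\<Delta> k (\<lambda>a b. t (\<epsilon> (u \<odot> a)) (f (v \<odot> b))))))"
    by (subst lmap_dsum[of t t]) (intro L refl)+
  also have "\<dots> = \<Delta> \<one> (\<lambda>c d. \<Delta> \<one> (\<lambda>u v. t (\<epsilon> (x \<odot> c))
      (\<Delta> k (\<lambda>a b. t (\<epsilon> (d \<odot> u \<odot> a)) (f (v \<odot> b))))))"
    by (rule weak_unit(2)[OF t, symmetric]) (intro L)
  also have "\<dots> = \<Delta> \<one> (\<lambda>c d. t (\<epsilon> (x \<odot> c)) (\<Delta> k (\<lambda>a b. t (\<epsilon> (d \<odot> a)) (f b))))"
    by (subst lmap_dsum[of t t, symmetric]) (intro L, simp add: hmul_assoc *)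
  also have "\<dots> = \<Delta> k (\<lambda>a b. \<Delta> \<one> (\<lambda>c d. t (\<epsilon> (x \<odot> c) * \<epsilon> (d \<odot> a)) (f b)))"
    by (subst lmap_dsum[of t t], intro L, subst dsum_swap) simp
  also have "\<dots> = \<Delta> k (\<lambda>a b. t (\<epsilon> (x \<odot> a)) (f b))"
  proof -
    have "\<Delta> \<one> (\<lambda>c d. t (\<epsilon> (x \<odot> c) * \<epsilon> (d \<odot> a)) w) = t (\<epsilon> (x \<odot> a)) w" for a w
      using lmap_dsum[of "(*)" t "\<lambda>c. t c w" H \<one> "\<lambda>c d. \<epsilon> (x \<odot> c) * \<epsilon> (d \<odot> a)"]
      by (simp add: eps_mult lmap_def t.scale_left_distrib)
    then show ?thesis by (simp only:)
  qed
  finally show ?thesis by simp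
qed

lemma dsum_et_left:
  assumes F: "blin t F"
  shows "\<Delta> k (\<lambda>a b. F (et a) b) = \<Delta> \<one> (\<lambda>a b. F (S a) (b \<odot> k))"
proof -
  note L = lin_all t blin_rules[OF F]
  have e: "F (et a) b = \<Delta> \<one> (\<lambda>p q. t (\<epsilon> (p \<odot> a)) (F q b))" for a b
    by (rule lmap_et_apply[OF t, where f="\<lambda>x. F x b"]) (intro L)
  have "\<Delta> k (\<lambda>a b. F (et a) b) = \<Delta> \<one> (\<lambda>p q. \<Delta> k (\<lambda>a b. t (\<epsilon> (p \<odot> a)) (F q b)))"
    unfolding e by (rule dsum_swap)
  also have "\<dots> = \<Delta> \<one> (\<lambda>p q. \<Delta> \<one> (\<lambda>a b. t (\<epsilon> (p \<odot> a)) (F q (b \<odot> k))))"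
    by (subst dsum_eps_left) (intro L refl)+
  also have "\<dots> = \<Delta> \<one> (\<lambda>a b. F (et a) (b \<odot> k))"
    unfolding e by (rule dsum_swap)
  also have "\<dots> = \<Delta> \<one> (\<lambda>a b. F (S a) (b \<odot> k))"
    by (rule dsum_one_et_es(1)) (intro L)
  finally show ?thesis .
qed

end

lemma S_es_eq_et_S: "S (es h) = et (S h)"
proof -
  have "S (es h) = \<Delta> h (\<lambda>a b. S b \<odot> S (S a))"
    unfolding ant_left[symmetric] by (subst lmap_dsum[of hs hs], intro lin_all) (simp add: S_hmul)
  also have "\<dots> = et (S h)"
    unfolding ant_right[symmetric] by (subst dsum_S[OF vector_space_hs]) (intro lin_all refl)+
  finally show ?thesis .
qed

lemma S_et_eq_es_S: "S (et h) = es (S h)"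
proof -
  have "S (et h) = \<Delta> h (\<lambda>a b. S (S b) \<odot> S a)"
    unfolding ant_right[symmetric] by (subst lmap_dsum[of hs hs], intro lin_all) (simp add: S_hmul)
  also have "\<dots> = es (S h)"
    unfolding ant_left[symmetric] by (subst dsum_S[OF vector_space_hs]) (intro lin_all refl)+
  finally show ?thesis .
qed

text \<open>Surjectivity of S is used here: every element is some S h, and S exchanges the two
  counital maps. The first equality guarantees that the preimage taken in \<open>ract\<close> exists
  for every z in H_t.\<close>

lemma range_et: "range et = S ` range es" and range_es: "range es = S ` range et"
  using bij_is_surj[OF bij_ant] by (auto simp: image_iff S_es_eq_et_S S_et_eq_es_S surj_def; metis)+

end

section \<open>Partial representations\<close>

text \<open>The ambient ring need not be unital; \<open>br \<one>\<close> is a unit only for the elements \<open>br h\<close>.\<close>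

locale partial_rep = whopf H
  for H :: "('k::field, 'h::ab_group_add) wha" +
  fixes rs :: "'k \<Rightarrow> 'r::ring \<Rightarrow> 'r" and br :: "'h \<Rightarrow> 'r"
  assumes vector_space_rs: "vector_space rs"
    and rs_mult_left: "rs c (x * y) = rs c x * y"
    and rs_mult_right: "rs c (x * y) = x * rs c y"
    and lmap_br_id: "lmap hs rs br"
    and br_one_left: "br \<one> * br h = br h"
    and br_one_right: "br h * br \<one> = br h"
    and br_mult_E: "\<Delta> k (\<lambda>a b. br h * br a * br (S b)) = \<Delta> k (\<lambda>a b. br (h \<odot> a) * br (S b))"
    and br_mult_Et: "\<Delta> k (\<lambda>a b. br h * br (S a) * br b) = \<Delta> k (\<lambda>a b. br (h \<odot> S a) * br b)"
    and E_mult_br: "\<Delta> h (\<lambda>a b. br a * br (S b) * br k) = \<Delta> h (\<lambda>a b. br a * br (S b \<odot> k))"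
    and Et_mult_br: "\<Delta> h (\<lambda>a b. br (S a) * br b * br k) = \<Delta> h (\<lambda>a b. br (S a) * br (b \<odot> k))"
    and br_expand: "\<Delta> h (\<lambda>a b. \<Delta> a (\<lambda>c d. br c * br (S d) * br b)) = br h"
begin

section \<open>E, E' and the adjoint action of H\<close>

definition "E h = \<Delta> h (\<lambda>a b. br a * br (S b))"
definition "Et h = \<Delta> h (\<lambda>a b. br (S a) * br b)"
definition "ad h x = \<Delta> h (\<lambda>a b. br a * x * br (S b))"

abbreviation "e \<equiv> br \<one>"

lemma lmap_br [lin_rules]: "lmap s hs g \<Longrightarrow> lmap s rs (\<lambda>x. br (g x))"
  by (rule lmap_comp[OF lmap_br_id])

lemma lmap_rmult_left [lin_rules]: "lmap s rs g \<Longrightarrow> lmap s rs (\<lambda>x. g x * y)"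
  by (simp add: lmap_def rs_mult_left distrib_right)

lemma lmap_rmult_right [lin_rules]: "lmap s rs g \<Longrightarrow> lmap s rs (\<lambda>x. y * g x)"
  by (simp add: lmap_def rs_mult_right distrib_left)

lemmas r_rules = lin_rules vector_space_rs vector_space_hs vector_space_field
lemmas dsum_mult = dsum_mult_left dsum_mult_right

lemma lmap_E [lin_rules]: "lmap s hs g \<Longrightarrow> lmap s rs (\<lambda>x. E (g x))"
  and lmap_Et [lin_rules]: "lmap s hs g \<Longrightarrow> lmap s rs (\<lambda>x. Et (g x))"
  and lmap_ad_left [lin_rules]: "lmap s hs g \<Longrightarrow> lmap s rs (\<lambda>x. ad (g x) y)"
  unfolding E_def Et_def ad_def by (intro r_rules; assumption)+

lemma lmap_ad_right [lin_rules]: "lmap s rs f \<Longrightarrow> lmap s rs (\<lambda>x. ad h (f x))"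
  unfolding ad_def by (intro r_rules)

lemmas r_all = lin_rules vector_space_rs vector_space_hs vector_space_field

lemma br_E: "br h * E k = \<Delta> k (\<lambda>a b. br (h \<odot> a) * br (S b))"
  and br_Et: "br h * Et k = \<Delta> k (\<lambda>a b. br (h \<odot> S a) * br b)"
  and E_br: "E h * br k = \<Delta> h (\<lambda>a b. br a * br (S b \<odot> k))"
  and Et_br: "Et h * br k = \<Delta> h (\<lambda>a b. br (S a) * br (b \<odot> k))"
  by (simp_all add: E_def Et_def dsum_mult mult.assoc br_mult_E[symmetric] br_mult_Et[symmetric]
      E_mult_br[symmetric] Et_mult_br[symmetric])

lemma br_eq_E: "\<Delta> h (\<lambda>a b. E a * br b) = br h"
  by (simp add: E_def dsum_mult br_expand)

lemma br_eq_Et: "\<Delta> h (\<lambda>a b. br a * Et b) = br h"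
proof -
  have "\<Delta> h (\<lambda>a b. \<Delta> a (\<lambda>c d. br c * br (S d) * br b)) = \<Delta> h (\<lambda>a b. \<Delta> b (\<lambda>c d. br a * br (S c) * br d))"
    by (rule coassoc[OF vector_space_rs]) (intro r_all)
  then show ?thesis unfolding br_expand by (simp add: Et_def dsum_mult mult.assoc)
qed

lemma Et_e: "Et h * e = Et h" and e_Et: "e * Et h = Et h"
  by (simp_all add: Et_def dsum_mult mult.assoc br_one_right)
    (simp_all add: mult.assoc[symmetric] br_one_left)

text \<open>Expanding [1] as E_(1_1) [1_2] produces [1_1][S(1_2) 1_3], hence
  [1_1][\<epsilon>_s(1_2)]; on the legs of \<Delta>(1) this \<epsilon>_s is S.\<close>

lemma E_one: "E \<one> = e"
proof -
  have "e = \<Delta> \<one> (\<lambda>a b. \<Delta> a (\<lambda>c d. br c * br (S d \<odot> b)))"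
    unfolding E_br[symmetric] by (rule br_eq_E[symmetric])
  also have "\<dots> = \<Delta> \<one> (\<lambda>a b. \<Delta> b (\<lambda>c d. br a * br (S c \<odot> d)))"
    by (rule coassoc[OF vector_space_rs]) (intro r_all)
  also have "\<dots> = \<Delta> \<one> (\<lambda>a b. br a * br (es b))"
    unfolding ant_left[symmetric] by (subst lmap_dsum[of hs rs]) (intro r_all refl)+
  also have "\<dots> = E \<one>"
    unfolding E_def by (rule dsum_one_et_es(2)[OF vector_space_rs]) (intro r_all)
  finally show ?thesis by simp
qed

lemma Et_one: "Et \<one> = e"
proof -
  have "e = \<Delta> \<one> (\<lambda>a b. \<Delta> b (\<lambda>c d. br (a \<odot> S c) * br d))"
    unfolding br_Et[symmetric] by (rule br_eq_Et[symmetric])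
  also have "\<dots> = \<Delta> \<one> (\<lambda>a b. \<Delta> a (\<lambda>c d. br (c \<odot> S d) * br b))"
    by (rule coassoc[OF vector_space_rs, symmetric]) (intro r_all)
  also have "\<dots> = \<Delta> \<one> (\<lambda>a b. br (et a) * br b)"
    unfolding ant_right[symmetric] by (subst lmap_dsum[of hs rs]) (intro r_all refl)+
  also have "\<dots> = Et \<one>"
    unfolding Et_def by (rule dsum_one_et_es(1)[OF vector_space_rs]) (intro r_all)
  finally show ?thesis by simp
qed

text \<open>The relation \<open>br_expand\<close> at S h would involve S(S h). Instead h_2 S(h_3) is
  collected inside a bracket to \<epsilon>_t(h_2), and trading that for \<Delta>(1) leaves [S h]
  E'_1.\<close>

lemma br_S_Et: "\<Delta> h (\<lambda>a b. Et a * br (S b)) = br (S h)"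
proof -
  have "\<Delta> h (\<lambda>a b. Et a * br (S b)) = \<Delta> h (\<lambda>a b. \<Delta> b (\<lambda>c d. br (S a) * br (c \<odot> S d)))"
    unfolding Et_br by (rule coassoc[OF vector_space_rs]) (intro r_all)
  also have "\<dots> = \<Delta> h (\<lambda>a b. br (S a) * br (et b))"
    unfolding ant_right[symmetric] by (subst lmap_dsum[of hs rs]) (intro r_all refl)+
  also have "\<dots> = \<Delta> \<one> (\<lambda>a b. br (S (a \<odot> h)) * br b)"
    by (rule dsum_et_right[OF vector_space_rs]) (intro r_all)
  also have "\<dots> = br (S h) * Et \<one>"
    by (simp add: S_hmul br_Et)
  finally show ?thesis by (simp add: Et_one br_one_right)
qed

text \<open>For y in H_s the coproduct is 1_1 \<otimes> 1_2 y, so E'_y [k] reduces to E'_1 [y k].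
  The consequence \<open>br_es_left\<close>, with \<open>br_es_right\<close>, lets the leg 1_1 of
  \<Delta>(1) enter and leave brackets.\<close>

lemma Et_es_br: "Et (es x) * br k = br (es x \<odot> k)"
proof -
  have "Et (es x) * br k = \<Delta> \<one> (\<lambda>a b. br (S a) * br ((b \<odot> es x) \<odot> k))"
    unfolding Et_br by (rule dsum_es(2)[OF vector_space_rs]) (intro r_all)
  also have "\<dots> = Et \<one> * br (es x \<odot> k)" by (simp add: Et_br hmul_assoc)
  finally show ?thesis by (simp add: Et_one br_one_left)
qed

lemma Et_es: "Et (es x) = br (es x)"
  using Et_es_br[of x \<one>] by (simp add: Et_e)

lemma br_es_left: "br (es x) * br k = br (es x \<odot> k)"
  using Et_es_br[of x k] by (simp add: Et_es)

lemma br_Et_et: "br k * Et (et x) = br (k \<odot> S (et x))"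
proof -
  have "br k * Et (et x) = \<Delta> \<one> (\<lambda>a b. br (k \<odot> S (a \<odot> et x)) * br b)"
    unfolding br_Et by (rule dsum_et(1)[OF vector_space_rs]) (intro r_all)
  also have "\<dots> = br (k \<odot> S (et x)) * Et \<one>" by (simp add: br_Et hmul_assoc S_hmul)
  finally show ?thesis by (simp add: Et_one br_one_right)
qed

lemma br_es_right: "br k * br (es x) = br (k \<odot> es x)"
proof -
  \<comment> \<open>On the right the available relation is \<open>br_Et_et\<close>, which concerns
    S(z) with z in H_t; H_s = S(H_t) supplies such a z.\<close>
  obtain x' where "es x = S (et x')" using range_es by blast
  moreover have "br (S (et x')) = Et (et x')"
    using br_Et_et[of \<one> x'] by (simp add: e_Et)
  ultimately show ?thesis by (simp add: br_Et_et)
qed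

lemma E_es_br: "E (es x) * br k = br (S (es x) \<odot> k)"
proof -
  have "E (es x) * br k = \<Delta> \<one> (\<lambda>a b. br a * br (S (es x \<odot> b) \<odot> k))"
    unfolding E_br by (rule dsum_es(1)[OF vector_space_rs]) (intro r_all)
  also have "\<dots> = E \<one> * br (S (es x) \<odot> k)" by (simp add: E_br hmul_assoc S_hmul)
  finally show ?thesis by (simp add: E_one br_one_left)
qed

text \<open>Inserting E' gives [x][S y] = E_(x_1) [x_2 S(y)]. For x = h k_1 and y = k_2 the last
  bracket contains k_2 S(k_3) = \<epsilon>_t(k_2), which is traded for \<Delta>(1) and absorbed by
  \<Delta>(h).\<close>

lemma br_E_commute: "br h * E k = \<Delta> h (\<lambda>a b. E (a \<odot> k) * br b)"
proof -
  note v = vector_space_rs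
  have 1: "br x * br (S y) = \<Delta> x (\<lambda>p q. E p * br (q \<odot> S y))" for x y
  proof -
    have "br x * br (S y) = \<Delta> x (\<lambda>p q. \<Delta> q (\<lambda>c d. br p * (br (S c) * br (d \<odot> S y))))"
      by (subst br_eq_Et[symmetric]) (simp add: dsum_mult_right mult.assoc Et_br dsum_mult_left)
    also have "\<dots> = \<Delta> x (\<lambda>p q. \<Delta> p (\<lambda>a c. br a * (br (S c) * br (q \<odot> S y))))"
      by (rule coassoc[OF v, symmetric]) (intro r_all)
    finally show ?thesis by (simp add: E_def dsum_mult_right mult.assoc)
  qed
  have "br h * E k = \<Delta> k (\<lambda>k1 k2. \<Delta> (h \<odot> k1) (\<lambda>p q. E p * br (q \<odot> S k2)))"
    unfolding br_E 1 ..
  also have "\<dots> = \<Delta> k (\<lambda>k1 k2. \<Delta> h (\<lambda>r1 r2. \<Delta> k1 (\<lambda>u v. E (r1 \<odot> u) * br (r2 \<odot> v \<odot> S k2))))"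
    by (subst dsum_hmul[OF v]) (intro r_all refl)+
  also have "\<dots> = \<Delta> h (\<lambda>r1 r2. \<Delta> k (\<lambda>k1 k2. \<Delta> k1 (\<lambda>u v. E (r1 \<odot> u) * br (r2 \<odot> v \<odot> S k2))))"
    by (rule dsum_swap)
  also have "\<dots> = \<Delta> h (\<lambda>r1 r2. \<Delta> k (\<lambda>u z. \<Delta> z (\<lambda>v w. E (r1 \<odot> u) * br (r2 \<odot> v \<odot> S w))))"
    by (subst coassoc[OF v]) (intro r_all refl)+
  also have "\<dots> = \<Delta> h (\<lambda>r1 r2. \<Delta> k (\<lambda>u z. E (r1 \<odot> u) * br (r2 \<odot> et z)))"
    unfolding ant_right[symmetric] hmul_assoc
    by (subst lmap_dsum[of hs rs "\<lambda>x. E _ * br (_ \<odot> x)"]) (intro r_all refl)+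
  also have "\<dots> = \<Delta> h (\<lambda>r1 r2. \<Delta> \<one> (\<lambda>x y. E (r1 \<odot> x \<odot> k) * br (r2 \<odot> y)))"
    by (subst dsum_et_right[OF v], intro r_all) (simp add: hmul_assoc)
  also have "\<dots> = \<Delta> h (\<lambda>a b. E (a \<odot> k) * br b)"
    by (rule dsum_one_right[OF v]) (intro r_all)
  finally show ?thesis .
qed

text \<open>The mirror image: E' is inserted in front of [S w], and \<epsilon>_t is collected in the
  first bracket.\<close>

lemma E_br_S_commute: "E k * br (S h) = \<Delta> h (\<lambda>a b. br (S a) * E (b \<odot> k))"
proof -
  note v = vector_space_rs
  have 1: "br c * br (S w) = \<Delta> w (\<lambda>p z. br (c \<odot> S p) * E z)" for c w
  proof -
    have "br c * br (S w) = \<Delta> w (\<lambda>x y. \<Delta> x (\<lambda>p q. br (c \<odot> S p) * br q * br (S y)))"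
      by (subst br_S_Et[symmetric])
        (simp add: dsum_mult_left mult.assoc[symmetric] br_Et dsum_mult_right)
    also have "\<dots> = \<Delta> w (\<lambda>p z. \<Delta> z (\<lambda>q y. br (c \<odot> S p) * br q * br (S y)))"
      by (rule coassoc[OF v]) (intro r_all)
    finally show ?thesis by (simp add: E_def dsum_mult_left mult.assoc)
  qed
  have "E k * br (S h) = \<Delta> k (\<lambda>c d. \<Delta> (h \<odot> d) (\<lambda>p z. br (c \<odot> S p) * E z))"
    unfolding E_br 1[symmetric] S_hmul ..
  also have "\<dots> = \<Delta> k (\<lambda>c d. \<Delta> h (\<lambda>a b. \<Delta> d (\<lambda>p z. br (c \<odot> S p \<odot> S a) * E (b \<odot> z))))"
    by (subst dsum_hmul[OF v], intro r_all) (simp add: S_hmul hmul_assoc)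
  also have "\<dots> = \<Delta> h (\<lambda>a b. \<Delta> k (\<lambda>c d. \<Delta> d (\<lambda>p z. br (c \<odot> S p \<odot> S a) * E (b \<odot> z))))"
    by (rule dsum_swap)
  also have "\<dots> = \<Delta> h (\<lambda>a b. \<Delta> k (\<lambda>x z. \<Delta> x (\<lambda>c p. br (c \<odot> S p \<odot> S a) * E (b \<odot> z))))"
    by (subst coassoc[OF v, symmetric]) (intro r_all refl)+
  also have "\<dots> = \<Delta> h (\<lambda>a b. \<Delta> k (\<lambda>x z. br (et x \<odot> S a) * E (b \<odot> z)))"
    unfolding ant_right[symmetric] by (subst lmap_dsum[of hs rs "\<lambda>x. br (x \<odot> S _) * E _"]) (intro r_all refl)+
  also have "\<dots> = \<Delta> h (\<lambda>a b. \<Delta> \<one> (\<lambda>x y. br (S (a \<odot> x)) * E (b \<odot> y \<odot> k)))"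
    by (subst dsum_et_left[OF v], intro r_all) (simp add: S_hmul hmul_assoc)
  also have "\<dots> = \<Delta> h (\<lambda>a b. br (S a) * E (b \<odot> k))"
    by (rule dsum_one_right[OF v]) (intro r_all)
  finally show ?thesis .
qed

lemma E_Et_commute: "Et h * E k = E k * Et h"
proof -
  have "Et h * E k = \<Delta> h (\<lambda>a r. \<Delta> r (\<lambda>u d. br (S a) * (E (u \<odot> k) * br d)))"
    unfolding Et_def dsum_mult_right mult.assoc br_E_commute dsum_mult_left ..
  also have "\<dots> = \<Delta> h (\<lambda>w d. \<Delta> w (\<lambda>a u. br (S a) * (E (u \<odot> k) * br d)))"
    by (rule coassoc[OF vector_space_rs, symmetric]) (intro r_all)
  also have "\<dots> = E k * Et h"
    by (simp add: Et_def dsum_mult_left mult.assoc[symmetric] E_br_S_commute dsum_mult_right)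
  finally show ?thesis .
qed

section \<open>The subalgebra A and the partial action on it\<close>

inductive_set asub :: "'r set" where
  one: "e \<in> asub"
| E: "E h \<in> asub"
| add: "x \<in> asub \<Longrightarrow> y \<in> asub \<Longrightarrow> x + y \<in> asub"
| scale: "x \<in> asub \<Longrightarrow> rs c x \<in> asub"
| mult: "x \<in> asub \<Longrightarrow> y \<in> asub \<Longrightarrow> x * y \<in> asub"

lemma zero_asub: "0 \<in> asub"
proof -
  interpret vector_space rs by (rule vector_space_rs)
  show ?thesis using asub.scale[OF asub.one, of 0] by simp
qed

lemma dsum_asub: "(\<And>a b. F a b \<in> asub) \<Longrightarrow> \<Delta> h F \<in> asub"
proof -
  assume F: "\<And>a b. F a b \<in> asub"
  have "(\<Sum>(a, b)\<leftarrow>xs. F a b) \<in> asub" for xs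
    by (induction xs) (auto intro: zero_asub asub.add F)
  then show ?thesis by (simp add: dsum_def)
qed

lemma Et_asub_commute: "a \<in> asub \<Longrightarrow> Et h * a = a * Et h"
proof (induction rule: asub.induct)
  case (mult x y)
  then show ?case by (metis mult.assoc)
qed (simp_all add: Et_e e_Et E_Et_commute distrib_left distrib_right
    rs_mult_left[symmetric] rs_mult_right[symmetric])

lemma br_es_asub_commute: "a \<in> asub \<Longrightarrow> br (es x) * a = a * br (es x)"
  using Et_asub_commute[of a "es x"] by (simp add: Et_es)

lemma br_asub_commute:
  assumes "a \<in> asub"
  shows "br h * a = \<Delta> h (\<lambda>p q. ad p a * br q)"
proof -
  have "\<Delta> h (\<lambda>p q. ad p a * br q) = \<Delta> h (\<lambda>p q. \<Delta> p (\<lambda>u v. br u * a * br (S v) * br q))"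
    by (simp add: ad_def dsum_mult_right)
  also have "\<dots> = \<Delta> h (\<lambda>u r. \<Delta> r (\<lambda>v q. br u * a * br (S v) * br q))"
    by (rule coassoc[OF vector_space_rs]) (intro r_all)
  also have "\<dots> = \<Delta> h (\<lambda>u r. br u * (a * Et r))"
    by (simp add: Et_def dsum_mult_left mult.assoc)
  also have "\<dots> = br h * a"
    by (simp add: Et_asub_commute[OF assms, symmetric] mult.assoc[symmetric] dsum_mult_right[symmetric] br_eq_Et)
  finally show ?thesis by simp
qed

text \<open>Multiplicativity of \<Psi> on elementary tensors, up to a factor of A on the left: E'
  appears to the right of b, commutes with it and is absorbed by [h].\<close>

lemma ad_mult_br:
  assumes "b \<in> asub"
  shows "\<Delta> h (\<lambda>p q. ad p b * br (q \<odot> g)) = br h * b * br g"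
proof -
  have "\<Delta> h (\<lambda>p q. ad p b * br (q \<odot> g)) = \<Delta> h (\<lambda>p q. \<Delta> p (\<lambda>u v. br u * b * br (S v) * br (q \<odot> g)))"
    by (simp add: ad_def dsum_mult_right)
  also have "\<dots> = \<Delta> h (\<lambda>u r. \<Delta> r (\<lambda>v q. br u * b * br (S v) * br (q \<odot> g)))"
    by (rule coassoc[OF vector_space_rs]) (intro r_all)
  also have "\<dots> = \<Delta> h (\<lambda>u r. br u * (b * Et r) * br g)"
    by (simp add: mult.assoc Et_br dsum_mult_left)
  also have "\<dots> = br h * b * br g"
    by (simp add: Et_asub_commute[OF assms, symmetric] mult.assoc[symmetric] dsum_mult_right[symmetric] br_eq_Et)
  finally show ?thesis .
qed

lemma ad_mult:
  assumes "a \<in> asub"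
  shows "ad h (a * b) = \<Delta> h (\<lambda>p q. ad p a * ad q b)"
proof -
  have "ad h (a * b) = \<Delta> h (\<lambda>p q. \<Delta> p (\<lambda>u v. ad u a * br v * b * br (S q)))"
    unfolding ad_def[of h] mult.assoc[symmetric] br_asub_commute[OF assms] dsum_mult_right ..
  also have "\<dots> = \<Delta> h (\<lambda>u r. \<Delta> r (\<lambda>v q. ad u a * br v * b * br (S q)))"
    by (rule coassoc[OF vector_space_rs]) (intro r_all)
  also have "\<dots> = \<Delta> h (\<lambda>u r. ad u a * ad r b)"
    by (simp add: ad_def[of _ b] dsum_mult_left mult.assoc)
  finally show ?thesis .
qed

lemma ad_E: "ad h (E k) = \<Delta> h (\<lambda>p q. E (p \<odot> k) * E q)"
proof -
  have "ad h (E k) = \<Delta> h (\<lambda>p q. \<Delta> p (\<lambda>u v. E (u \<odot> k) * br v * br (S q)))"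
    by (simp add: ad_def br_E_commute dsum_mult_right)
  also have "\<dots> = \<Delta> h (\<lambda>u r. \<Delta> r (\<lambda>v q. E (u \<odot> k) * br v * br (S q)))"
    by (rule coassoc[OF vector_space_rs]) (intro r_all)
  finally show ?thesis by (simp add: E_def[of "_ :: 'h"] dsum_mult_left mult.assoc)
qed

lemma ad_one: "ad h e = E h"
  by (simp add: ad_def E_def br_one_right)

lemma ad_asub: "a \<in> asub \<Longrightarrow> ad h a \<in> asub"
proof (induction arbitrary: h rule: asub.induct)
  case one
  then show ?case by (simp add: ad_one asub.E)
next
  case (E k)
  then show ?case by (auto simp: ad_E intro!: dsum_asub asub.mult asub.E)
next
  case (add x y)
  then show ?case using lmap_add[OF lmap_ad_right[OF lmap_id]] by (auto intro: asub.add)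
next
  case (scale x c)
  then show ?case using lmap_scale[OF lmap_ad_right[OF lmap_id]] by (auto intro: asub.scale)
next
  case (mult x y)
  then show ?case by (auto simp: ad_mult intro!: dsum_asub asub.mult)
qed

text \<open>E_p is the value of p on the unit, and it merges with the bracket that opens the action.
  This lemma and \<open>ad_mult_E\<close> range over the whole ring, as their use under arbitrary
  forms in \<open>corner_mult\<close> requires.\<close>

lemma E_mult_ad: "\<Delta> h (\<lambda>p q. E p * ad q c) = ad h c"
proof -
  have "\<Delta> h (\<lambda>p q. E p * ad q c) = \<Delta> h (\<lambda>p q. \<Delta> q (\<lambda>u v. E p * br u * c * br (S v)))"
    by (simp add: ad_def dsum_mult_left mult.assoc)
  also have "\<dots> = \<Delta> h (\<lambda>w v. \<Delta> w (\<lambda>p u. E p * br u * c * br (S v)))"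
    by (rule coassoc[OF vector_space_rs, symmetric]) (intro r_all)
  also have "\<dots> = ad h c"
    by (simp add: dsum_mult_right[symmetric] br_eq_E ad_def)
  finally show ?thesis .
qed

lemma ad_mult_E: "ad h (b * E g) = \<Delta> h (\<lambda>p q. ad p b * E (q \<odot> g))"
proof -
  have "\<Delta> h (\<lambda>p q. ad p b * E (q \<odot> g)) = \<Delta> h (\<lambda>p q. \<Delta> p (\<lambda>u v. br u * b * br (S v) * E (q \<odot> g)))"
    by (simp add: ad_def dsum_mult_right)
  also have "\<dots> = \<Delta> h (\<lambda>u r. \<Delta> r (\<lambda>v q. br u * b * br (S v) * E (q \<odot> g)))"
    by (rule coassoc[OF vector_space_rs]) (intro r_all)
  also have "\<dots> = ad h (b * E g)"
    by (simp add: ad_def mult.assoc E_br_S_commute dsum_mult_left)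
  finally show ?thesis by simp
qed

end

section \<open>The coaction on bilinear forms\<close>

context whopf
begin

lemma coassoc4:
  fixes t :: "'k \<Rightarrow> 'w::ab_group_add \<Rightarrow> 'w"
  assumes t: "vector_space t"
    and N: "\<And>q u v. lmap hs t (\<lambda>p. N p q u v)" "\<And>p u v. lmap hs t (\<lambda>q. N p q u v)"
      "\<And>p q v. lmap hs t (\<lambda>u. N p q u v)" "\<And>p q u. lmap hs t (\<lambda>v. N p q u v)"
  shows "\<Delta> k (\<lambda>a b. \<Delta> a (\<lambda>p q. \<Delta> b (\<lambda>u v. N p q u v))) =
    \<Delta> k (\<lambda>p r. \<Delta> r (\<lambda>m v. \<Delta> m (\<lambda>q u. N p q u v)))"
proof -
  note L = lin_all t N
  have "\<Delta> k (\<lambda>a b. \<Delta> a (\<lambda>p q. \<Delta> b (\<lambda>u v. N p q u v))) =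
      \<Delta> k (\<lambda>p r. \<Delta> r (\<lambda>q b. \<Delta> b (\<lambda>u v. N p q u v)))"
    by (rule coassoc[OF t]) (intro L)
  also have "\<dots> = \<Delta> k (\<lambda>p r. \<Delta> r (\<lambda>m v. \<Delta> m (\<lambda>q u. N p q u v)))"
    by (subst coassoc[OF t, symmetric]) (intro L refl)+
  finally show ?thesis .
qed

text \<open>Under the coaction, [k_1][S k_2] becomes [k_1][S k_4] \<otimes> k_2 S(k_3). The second
  factor is \<epsilon>_t, traded for \<Delta>(1) by \<open>dsum_et_right\<close>.\<close>

lemma dsum_S_collapse:
  fixes t :: "'k \<Rightarrow> 'w::ab_group_add \<Rightarrow> 'w"
  assumes t: "vector_space t" and M: "tlin t M"
  shows "\<Delta> k (\<lambda>a b. \<Delta> (S b) (\<lambda>u v. \<Delta> a (\<lambda>p q. M p u (q \<odot> v)))) =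
    \<Delta> k (\<lambda>a b. \<Delta> \<one> (\<lambda>y z. M (y \<odot> a) (S b) z))"
proof -
  note L = lin_all t tlin_rules[OF M]
  have "\<Delta> k (\<lambda>a b. \<Delta> (S b) (\<lambda>u v. \<Delta> a (\<lambda>p q. M p u (q \<odot> v)))) =
      \<Delta> k (\<lambda>a b. \<Delta> b (\<lambda>u v. \<Delta> a (\<lambda>p q. M p (S v) (q \<odot> S u))))"
    by (subst dsum_S[OF t]) (intro L refl)+
  also have "\<dots> = \<Delta> k (\<lambda>a b. \<Delta> a (\<lambda>p q. \<Delta> b (\<lambda>u v. M p (S v) (q \<odot> S u))))"
    by (subst dsum_swap) (rule refl)
  also have "\<dots> = \<Delta> k (\<lambda>p r. \<Delta> r (\<lambda>m v. \<Delta> m (\<lambda>q u. M p (S v) (q \<odot> S u))))"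
    by (rule coassoc4[OF t]) (intro L)+
  also have "\<dots> = \<Delta> k (\<lambda>p r. \<Delta> r (\<lambda>m v. M p (S v) (et m)))"
    unfolding ant_right[symmetric] by (subst lmap_dsum[of hs t]) (intro L refl)+
  also have "\<dots> = \<Delta> k (\<lambda>a b. \<Delta> a (\<lambda>p m. M p (S b) (et m)))"
    by (rule coassoc[OF t, symmetric]) (intro L)
  also have "\<dots> = \<Delta> k (\<lambda>a b. \<Delta> \<one> (\<lambda>y z. M (y \<odot> a) (S b) z))"
    by (subst dsum_et_right[OF t]) (intro L refl)+
  finally show ?thesis .
qed

text \<open>Under the coaction, [S k_1][k_2] becomes [S k_2][k_3] \<otimes> S(k_1) k_4: the first
  factor receives the two adjacent middle legs, so the relations for E' apply to it.\<close>

lemma dsum_S_middle: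
  fixes t :: "'k \<Rightarrow> 'w::ab_group_add \<Rightarrow> 'w"
  assumes t: "vector_space t"
    and N: "\<And>q u v. lmap hs t (\<lambda>p. N p q u v)" "\<And>p u v. lmap hs t (\<lambda>q. N p q u v)"
      "\<And>p q v. lmap hs t (\<lambda>u. N p q u v)" "\<And>p q u. lmap hs t (\<lambda>v. N p q u v)"
  shows "\<Delta> k (\<lambda>a b. \<Delta> b (\<lambda>c d. \<Delta> (S a) (\<lambda>u v. N u v c d))) =
    \<Delta> k (\<lambda>p r. \<Delta> r (\<lambda>m v. \<Delta> m (\<lambda>q u. N (S q) (S p) u v)))"
proof -
  note L = lin_all t N lmap_comp[OF N(1)] lmap_comp[OF N(2)]
  have "\<Delta> k (\<lambda>a b. \<Delta> b (\<lambda>c d. \<Delta> (S a) (\<lambda>u v. N u v c d))) =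
      \<Delta> k (\<lambda>a b. \<Delta> b (\<lambda>c d. \<Delta> a (\<lambda>u v. N (S v) (S u) c d)))"
    by (subst dsum_S[OF t]) (intro L refl)+
  also have "\<dots> = \<Delta> k (\<lambda>a b. \<Delta> a (\<lambda>u v. \<Delta> b (\<lambda>c d. N (S v) (S u) c d)))"
    by (subst dsum_swap) (rule refl)
  also have "\<dots> = \<Delta> k (\<lambda>p r. \<Delta> r (\<lambda>m v. \<Delta> m (\<lambda>q u. N (S q) (S p) u v)))"
    by (rule coassoc4[OF t]) (intro L)+
  finally show ?thesis .
qed

end

section \<open>The transposed coaction and the relations of I\<close>

context partial_rep
begin

definition bform :: "('r \<Rightarrow> 'h \<Rightarrow> 'k) \<Rightarrow> bool" where
  "bform \<gamma> \<longleftrightarrow> (\<forall>g. lmap rs (*) (\<lambda>x. \<gamma> x g)) \<and> (\<forall>x. lmap hs (*) (\<gamma> x))"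

lemma bformI: "(\<And>g. lmap rs (*) (\<lambda>x. \<gamma> x g)) \<Longrightarrow> (\<And>x. lmap hs (*) (\<lambda>g. \<gamma> x g)) \<Longrightarrow> bform \<gamma>"
  by (simp add: bform_def)

lemma bform_1: "bform \<gamma> \<Longrightarrow> lmap s rs f \<Longrightarrow> lmap s (*) (\<lambda>x. \<gamma> (f x) g)"
  and bform_2: "bform \<gamma> \<Longrightarrow> lmap s hs f' \<Longrightarrow> lmap s (*) (\<lambda>x. \<gamma> y (f' x))"
  by (simp_all add: lmap_def bform_def)

lemmas bform_rules = bform_1 bform_2

text \<open>The transpose of left multiplication by \<open>[h\<^sub>1] \<otimes> h\<^sub>2\<close>, the image of \<open>[h]\<close> under the coaction.\<close>

definition pull :: "('r \<Rightarrow> 'h \<Rightarrow> 'k) \<Rightarrow> 'h \<Rightarrow> 'r \<Rightarrow> 'h \<Rightarrow> 'k" where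
  "pull \<gamma> h x g = \<Delta> h (\<lambda>a b. \<gamma> (br a * x) (b \<odot> g))"

text \<open>The image \<open>[1\<^sub>1] \<otimes> 1\<^sub>2\<close> of the unit is only an idempotent; these are the forms on which it acts as
  the identity.\<close>

definition uforms :: "('r \<Rightarrow> 'h \<Rightarrow> 'k) set" where
  "uforms = {\<gamma>. bform \<gamma> \<and> pull \<gamma> \<one> = \<gamma>}"

lemma bform_pull: "bform \<gamma> \<Longrightarrow> bform (pull \<gamma> h)"
  by (rule bformI; unfold pull_def; intro r_all bform_rules; assumption?)

text \<open>The product to simplify is [h_1][1_1] \<otimes> h_2 1_2; since 1_1 lies in H_s it enters
  the bracket, and \<Delta>(h) \<Delta>(1) = \<Delta>(h).\<close>

lemma pull_uforms:
  assumes \<gamma>: "bform \<gamma>"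
  shows "pull \<gamma> h \<in> uforms"
proof -
  note v = vector_space_field and L = r_all bform_rules[OF \<gamma>]
  have "pull (pull \<gamma> h) \<one> x g = pull \<gamma> h x g" for x g
  proof -
    have "pull (pull \<gamma> h) \<one> x g = \<Delta> \<one> (\<lambda>c d. \<Delta> h (\<lambda>a b. \<gamma> (br a * br c * x) (b \<odot> d \<odot> g)))"
      by (simp add: pull_def mult.assoc hmul_assoc)
    also have "\<dots> = \<Delta> \<one> (\<lambda>c d. \<Delta> h (\<lambda>a b. \<gamma> (br (a \<odot> es c) * x) (b \<odot> d \<odot> g)))"
      unfolding br_es_right[symmetric] by (rule dsum_one_es[OF v, symmetric]) (intro L)
    also have "\<dots> = \<Delta> \<one> (\<lambda>c d. \<Delta> h (\<lambda>a b. \<gamma> (br (a \<odot> c) * x) (b \<odot> d \<odot> g)))"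
      by (rule dsum_one_es[OF v]) (intro L)
    also have "\<dots> = \<Delta> h (\<lambda>a b. \<Delta> \<one> (\<lambda>c d. \<gamma> (br (a \<odot> c) * x) (b \<odot> d \<odot> g)))"
      by (rule dsum_swap)
    also have "\<dots> = pull \<gamma> h x g"
      unfolding pull_def by (rule dsum_one_right[OF v]) (intro L)
    finally show ?thesis .
  qed
  then show ?thesis by (simp add: uforms_def bform_pull[OF \<gamma>] fun_eq_iff)
qed

context
  fixes \<gamma>
  assumes \<gamma>: "\<gamma> \<in> uforms"
begin

lemma uforms_bform: "bform \<gamma>" and pull_one: "pull \<gamma> \<one> = \<gamma>"
  using \<gamma> by (simp_all add: uforms_def)

lemmas form_rules = r_all bform_rules[OF uforms_bform]

lemma lmap_pull: "lmap hs (*) (\<lambda>h. pull \<gamma> h x g)"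
  unfolding pull_def by (intro form_rules)

lemma dsum_form: "\<Delta> k (\<lambda>a b. \<gamma> (F a b) g) = \<gamma> (\<Delta> k F) g"
  by (rule lmap_dsum[of rs "(*)", symmetric]) (intro form_rules)

text \<open>Deletes the \<Delta>(1) that \<open>dsum_S_collapse\<close> leaves in front: 1_1 leaves
  the bracket because it lies in H_s, and a form in \<open>uforms\<close> absorbs [1_1] \<otimes>
  1_2.\<close>

lemma pull_one_br: "\<Delta> \<one> (\<lambda>y z. \<gamma> (br (y \<odot> a) * x) (z \<odot> g)) = \<gamma> (br a * x) g"
proof -
  note v = vector_space_field
  have "\<Delta> \<one> (\<lambda>y z. \<gamma> (br (y \<odot> a) * x) (z \<odot> g)) = \<Delta> \<one> (\<lambda>y z. \<gamma> (br (es y) * br a * x) (z \<odot> g))"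
    unfolding br_es_left by (rule dsum_one_es[OF v, symmetric]) (intro form_rules)
  also have "\<dots> = \<Delta> \<one> (\<lambda>y z. \<gamma> (br y * br a * x) (z \<odot> g))"
    by (rule dsum_one_es[OF v]) (intro form_rules)
  also have "\<dots> = pull \<gamma> \<one> (br a * x) g"
    by (simp add: pull_def mult.assoc)
  finally show ?thesis by (simp add: pull_one)
qed

lemma pull_pull_S: "\<Delta> k (\<lambda>a b. pull (pull \<gamma> a) (S b) x g) = \<gamma> (E k * x) g"
proof -
  have "\<Delta> k (\<lambda>a b. pull (pull \<gamma> a) (S b) x g) =
      \<Delta> k (\<lambda>a b. \<Delta> (S b) (\<lambda>u v. \<Delta> a (\<lambda>p q. \<gamma> (br p * (br u * x)) (q \<odot> v \<odot> g))))"
    by (simp add: pull_def hmul_assoc)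
  also have "\<dots> = \<Delta> k (\<lambda>a b. \<Delta> \<one> (\<lambda>y z. \<gamma> (br (y \<odot> a) * (br (S b) * x)) (z \<odot> g)))"
    by (rule dsum_S_collapse[OF vector_space_field]) (intro form_rules)
  finally show ?thesis by (simp add: pull_one_br dsum_form E_def dsum_mult_right mult.assoc)
qed

text \<open>From here on the defining relations are checked one by one. Those with E collapse on
  both sides, here to E_h [k_1] \<otimes> k_2; those with E' are reduced by
  \<open>dsum_S_middle\<close> to the same relation in the first factor.\<close>

lemma pull_E_mult_br:
  "\<Delta> h (\<lambda>a b. pull (pull (pull \<gamma> a) (S b)) k x g) = \<Delta> h (\<lambda>a b. pull (pull \<gamma> a) (S b \<odot> k) x g)"
proof -
  have "\<Delta> h (\<lambda>a b. pull (pull \<gamma> a) (S b \<odot> k) x g) =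
      \<Delta> h (\<lambda>a b. \<Delta> (S b) (\<lambda>u v. \<Delta> k (\<lambda>k1 k2. \<Delta> a (\<lambda>p q.
        \<gamma> (br p * (br (u \<odot> k1) * x)) (q \<odot> v \<odot> (k2 \<odot> g))))))"
    unfolding pull_def
    by (subst dsum_hmul[OF vector_space_field], intro form_rules) (simp add: hmul_assoc)
  also have "\<dots> = \<Delta> h (\<lambda>a b. \<Delta> k (\<lambda>k1 k2. \<Delta> (S b) (\<lambda>u v. \<Delta> a (\<lambda>p q.
        \<gamma> (br p * (br (u \<odot> k1) * x)) (q \<odot> v \<odot> (k2 \<odot> g))))))"
    by (simp only: dsum_swap[of H "S _" k])
  also have "\<dots> = \<Delta> k (\<lambda>k1 k2. \<Delta> h (\<lambda>a b. \<Delta> (S b) (\<lambda>u v. \<Delta> a (\<lambda>p q.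
        \<gamma> (br p * (br (u \<odot> k1) * x)) (q \<odot> v \<odot> (k2 \<odot> g))))))"
    by (rule dsum_swap)
  also have "\<dots> = \<Delta> k (\<lambda>k1 k2. \<Delta> h (\<lambda>a b. \<Delta> \<one> (\<lambda>y z.
        \<gamma> (br (y \<odot> a) * (br (S b \<odot> k1) * x)) (z \<odot> (k2 \<odot> g)))))"
    by (subst dsum_S_collapse[OF vector_space_field]) (intro form_rules refl)+
  also have "\<dots> = \<Delta> k (\<lambda>k1 k2. \<gamma> (E h * br k1 * x) (k2 \<odot> g))"
    by (simp add: pull_one_br dsum_form E_br dsum_mult_right mult.assoc)
  also have "\<dots> = \<Delta> k (\<lambda>k1 k2. \<Delta> h (\<lambda>a b. pull (pull \<gamma> a) (S b) (br k1 * x) (k2 \<odot> g)))"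
    by (simp add: pull_pull_S mult.assoc)
  also have "\<dots> = \<Delta> h (\<lambda>a b. pull (pull (pull \<gamma> a) (S b)) k x g)"
    by (subst dsum_swap) (simp add: pull_def[of "pull _ _" k])
  finally show ?thesis by simp
qed

lemma pull_br_expand:
  "\<Delta> h (\<lambda>a b. \<Delta> a (\<lambda>c d. pull (pull (pull \<gamma> c) (S d)) b x g)) = pull \<gamma> h x g"
proof -
  have "\<Delta> a (\<lambda>c d. pull (pull (pull \<gamma> c) (S d)) b x g) = \<Delta> b (\<lambda>b1 b2. \<gamma> (E a * (br b1 * x)) (b2 \<odot> g))" for a b
    unfolding pull_pull_S[symmetric] by (subst dsum_swap) (simp add: pull_def[of "pull _ _" b])
  then have "\<Delta> h (\<lambda>a b. \<Delta> a (\<lambda>c d. pull (pull (pull \<gamma> c) (S d)) b x g)) =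
      \<Delta> h (\<lambda>a b. \<Delta> b (\<lambda>b1 b2. \<gamma> (E a * (br b1 * x)) (b2 \<odot> g)))"
    by (simp only:)
  also have "\<dots> = \<Delta> h (\<lambda>m b2. \<Delta> m (\<lambda>a b1. \<gamma> (E a * (br b1 * x)) (b2 \<odot> g)))"
    by (rule coassoc[OF vector_space_field, symmetric]) (intro form_rules)
  also have "\<dots> = pull \<gamma> h x g"
    by (simp add: dsum_form mult.assoc[symmetric] dsum_mult_right[symmetric] br_eq_E pull_def)
  finally show ?thesis .
qed

lemma pull_br_mult_Et:
  "\<Delta> k (\<lambda>a b. pull (pull (pull \<gamma> h) (S a)) b x g) = \<Delta> k (\<lambda>a b. pull (pull \<gamma> (h \<odot> S a)) b x g)"
proof -
  note v = vector_space_field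
  have "\<Delta> k (\<lambda>a b. pull (pull (pull \<gamma> h) (S a)) b x g) =
      \<Delta> k (\<lambda>a b. \<Delta> b (\<lambda>b1 b2. \<Delta> (S a) (\<lambda>u v. \<Delta> h (\<lambda>h1 h2.
        \<gamma> (br h1 * br u * br b1 * x) (h2 \<odot> v \<odot> (b2 \<odot> g))))))"
    by (simp add: pull_def mult.assoc hmul_assoc)
  also have "\<dots> = \<Delta> k (\<lambda>p r. \<Delta> r (\<lambda>m b. \<Delta> m (\<lambda>q u. \<Delta> h (\<lambda>h1 h2.
        \<gamma> (br h1 * br (S q) * br u * x) (h2 \<odot> S p \<odot> (b \<odot> g))))))"
    by (rule dsum_S_middle[OF v]) (intro form_rules)+
  also have "\<dots> = \<Delta> k (\<lambda>p r. \<Delta> r (\<lambda>m b. \<Delta> m (\<lambda>q u. \<Delta> h (\<lambda>h1 h2.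
        \<gamma> (br (h1 \<odot> S q) * br u * x) (h2 \<odot> S p \<odot> (b \<odot> g))))))"
    by (simp only: dsum_swap[of H _ h] dsum_form dsum_mult_right[symmetric] br_mult_Et)
  also have "\<dots> = \<Delta> k (\<lambda>a b. \<Delta> b (\<lambda>b1 b2. \<Delta> (S a) (\<lambda>u v. \<Delta> h (\<lambda>h1 h2.
        \<gamma> (br (h1 \<odot> u) * br b1 * x) (h2 \<odot> v \<odot> (b2 \<odot> g))))))"
    by (rule dsum_S_middle[OF v, symmetric]) (intro form_rules)+
  also have "\<dots> = \<Delta> k (\<lambda>a b. \<Delta> b (\<lambda>b1 b2. \<Delta> h (\<lambda>h1 h2. \<Delta> (S a) (\<lambda>u v.
        \<gamma> (br (h1 \<odot> u) * br b1 * x) (h2 \<odot> v \<odot> (b2 \<odot> g))))))"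
    by (simp only: dsum_swap[of H "S _" h])
  also have "\<dots> = \<Delta> k (\<lambda>a b. pull (pull \<gamma> (h \<odot> S a)) b x g)"
    unfolding pull_def
    by (subst dsum_hmul[OF v], intro form_rules) (simp add: mult.assoc)
  finally show ?thesis .
qed

lemma pull_Et_mult_br:
  "\<Delta> h (\<lambda>a b. pull (pull (pull \<gamma> (S a)) b) k x g) = \<Delta> h (\<lambda>a b. pull (pull \<gamma> (S a)) (b \<odot> k) x g)"
proof -
  note v = vector_space_field
  have "\<Delta> h (\<lambda>a b. pull (pull (pull \<gamma> (S a)) b) k x g) =
      \<Delta> h (\<lambda>a b. \<Delta> k (\<lambda>k1 k2. \<Delta> b (\<lambda>b1 b2. \<Delta> (S a) (\<lambda>u v.
        \<gamma> (br u * br b1 * br k1 * x) (v \<odot> (b2 \<odot> k2 \<odot> g))))))"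
    by (simp add: pull_def mult.assoc hmul_assoc)
  also have "\<dots> = \<Delta> k (\<lambda>k1 k2. \<Delta> h (\<lambda>a b. \<Delta> b (\<lambda>b1 b2. \<Delta> (S a) (\<lambda>u v.
        \<gamma> (br u * br b1 * br k1 * x) (v \<odot> (b2 \<odot> k2 \<odot> g))))))"
    by (rule dsum_swap)
  also have "\<dots> = \<Delta> k (\<lambda>k1 k2. \<Delta> h (\<lambda>p r. \<Delta> r (\<lambda>m b. \<Delta> m (\<lambda>q u.
        \<gamma> (br (S q) * br u * br k1 * x) (S p \<odot> (b \<odot> k2 \<odot> g))))))"
    by (subst dsum_S_middle[OF v]) (intro form_rules refl)+
  also have "\<dots> = \<Delta> k (\<lambda>k1 k2. \<Delta> h (\<lambda>p r. \<Delta> r (\<lambda>m b. \<Delta> m (\<lambda>q u.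
        \<gamma> (br (S q) * br (u \<odot> k1) * x) (S p \<odot> (b \<odot> k2 \<odot> g))))))"
    by (simp only: dsum_form dsum_mult_right[symmetric] Et_def[symmetric] Et_br)
  also have "\<dots> = \<Delta> k (\<lambda>k1 k2. \<Delta> h (\<lambda>a b. \<Delta> b (\<lambda>b1 b2. \<Delta> (S a) (\<lambda>u v.
        \<gamma> (br u * br (b1 \<odot> k1) * x) (v \<odot> (b2 \<odot> k2 \<odot> g))))))"
    by (subst dsum_S_middle[OF v]) (intro form_rules refl)+
  also have "\<dots> = \<Delta> h (\<lambda>a b. \<Delta> k (\<lambda>k1 k2. \<Delta> b (\<lambda>b1 b2. \<Delta> (S a) (\<lambda>u v.
        \<gamma> (br u * br (b1 \<odot> k1) * x) (v \<odot> (b2 \<odot> k2 \<odot> g))))))"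
    by (rule dsum_swap)
  also have "\<dots> = \<Delta> h (\<lambda>a b. \<Delta> b (\<lambda>b1 b2. \<Delta> k (\<lambda>k1 k2. \<Delta> (S a) (\<lambda>u v.
        \<gamma> (br u * br (b1 \<odot> k1) * x) (v \<odot> (b2 \<odot> k2 \<odot> g))))))"
    by (simp only: dsum_swap[of H k])
  also have "\<dots> = \<Delta> h (\<lambda>a b. pull (pull \<gamma> (S a)) (b \<odot> k) x g)"
    unfolding pull_def
    by (subst dsum_hmul[OF v], intro form_rules) (simp add: mult.assoc)
  finally show ?thesis .
qed

end

text \<open>Here the leftover \<Delta>(1) stands between h and k and is absorbed by \<Delta>(h)
  rather than by the form. The other side applies \<open>pull_pull_S\<close> to
  \<open>pull \<gamma> h\<close>, a form other than the given one.\<close>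

lemma pull_br_mult_E:
  assumes \<gamma>: "\<gamma> \<in> uforms"
  shows "\<Delta> k (\<lambda>a b. pull (pull (pull \<gamma> h) a) (S b) x g) = \<Delta> k (\<lambda>a b. pull (pull \<gamma> (h \<odot> a)) (S b) x g)"
proof -
  note v = vector_space_field and L = form_rules[OF \<gamma>]
  have "\<Delta> k (\<lambda>a b. pull (pull \<gamma> (h \<odot> a)) (S b) x g) =
      \<Delta> k (\<lambda>a b. \<Delta> (S b) (\<lambda>u v. \<Delta> h (\<lambda>h1 h2. \<Delta> a (\<lambda>p q.
        \<gamma> (br (h1 \<odot> p) * (br u * x)) (h2 \<odot> (q \<odot> v) \<odot> g)))))"
    unfolding pull_def by (subst dsum_hmul[OF v], intro L) (simp add: hmul_assoc)
  also have "\<dots> = \<Delta> k (\<lambda>a b. \<Delta> h (\<lambda>h1 h2. \<Delta> (S b) (\<lambda>u v. \<Delta> a (\<lambda>p q.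
        \<gamma> (br (h1 \<odot> p) * (br u * x)) (h2 \<odot> (q \<odot> v) \<odot> g)))))"
    by (simp only: dsum_swap[of H "S _" h])
  also have "\<dots> = \<Delta> h (\<lambda>h1 h2. \<Delta> k (\<lambda>a b. \<Delta> (S b) (\<lambda>u v. \<Delta> a (\<lambda>p q.
        \<gamma> (br (h1 \<odot> p) * (br u * x)) (h2 \<odot> (q \<odot> v) \<odot> g)))))"
    by (rule dsum_swap)
  also have "\<dots> = \<Delta> h (\<lambda>h1 h2. \<Delta> k (\<lambda>a b. \<Delta> \<one> (\<lambda>y z.
        \<gamma> (br (h1 \<odot> (y \<odot> a)) * (br (S b) * x)) (h2 \<odot> z \<odot> g))))"
    by (subst dsum_S_collapse[OF v]) (intro L refl)+
  also have "\<dots> = \<Delta> k (\<lambda>a b. \<Delta> h (\<lambda>h1 h2. \<Delta> \<one> (\<lambda>y z.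
        \<gamma> (br ((h1 \<odot> y) \<odot> a) * (br (S b) * x)) ((h2 \<odot> z) \<odot> g))))"
    by (subst dsum_swap) (simp add: hmul_assoc)
  also have "\<dots> = \<Delta> k (\<lambda>a b. \<Delta> h (\<lambda>h1 h2. \<gamma> (br (h1 \<odot> a) * (br (S b) * x)) (h2 \<odot> g)))"
    by (subst dsum_one_right[OF v]) (intro L refl)+
  also have "\<dots> = \<Delta> h (\<lambda>h1 h2. \<Delta> k (\<lambda>a b. \<gamma> (br (h1 \<odot> a) * (br (S b) * x)) (h2 \<odot> g)))"
    by (rule dsum_swap)
  also have "\<dots> = pull \<gamma> h (E k * x) g"
    by (simp add: dsum_form[OF \<gamma>] mult.assoc[symmetric] dsum_mult_right[symmetric] br_E pull_def)
  also have "\<dots> = \<Delta> k (\<lambda>a b. pull (pull (pull \<gamma> h) a) (S b) x g)"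
    using pull_pull_S[OF pull_uforms] \<gamma> by (simp add: uforms_def)
  finally show ?thesis by simp
qed

end

section \<open>The free algebra\<close>

lemmas fa_defs = fa_zero_def fa_one_def fa_gen_def fa_add_def fa_scale_def fa_diff_def

lemma FA_zero: "fa_zero \<in> FA" and FA_one: "fa_one \<in> FA" and FA_gen: "fa_gen h \<in> FA"
  by (simp_all add: FA_def fa_defs)

lemma FA_add: "(x :: ('k::comm_monoid_add, 'h) fa) \<in> FA \<Longrightarrow> y \<in> FA \<Longrightarrow> fa_add x y \<in> FA"
  unfolding FA_def fa_defs mem_Collect_eq
  by (erule (1) finite_subset[rotated, OF finite_UnI]) auto

lemma FA_scale: "(x :: ('k::field, 'h) fa) \<in> FA \<Longrightarrow> fa_scale c x \<in> FA"
  unfolding FA_def fa_defs mem_Collect_eq by (erule finite_subset[rotated]) auto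

lemma FA_diff: "(x :: ('k::field, 'h) fa) \<in> FA \<Longrightarrow> y \<in> FA \<Longrightarrow> fa_diff x y \<in> FA"
  by (simp add: fa_diff_def FA_add FA_scale)

lemma FA_sum: "set xs \<subseteq> FA \<Longrightarrow> fa_sum xs \<in> (FA :: ('k::field, 'h) fa set)"
  by (induction xs) (auto simp: fa_sum_def FA_zero FA_add)

lemma fa_mult_support:
  "{w. fa_mult x y w \<noteq> 0} \<subseteq> (\<lambda>(u, v). u @ v) ` ({u. x u \<noteq> 0} \<times> {v. y v \<noteq> 0})"
  for x :: "('k::field, 'h) fa"
proof
  fix w assume "w \<in> {w. fa_mult x y w \<noteq> 0}"
  then obtain i where "x (take i w) * y (drop i w) \<noteq> 0"
    unfolding fa_mult_def by (metis (mono_tags, lifting) mem_Collect_eq sum.not_neutral_contains_not_neutral)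
  then show "w \<in> (\<lambda>(u, v). u @ v) ` ({u. x u \<noteq> 0} \<times> {v. y v \<noteq> 0})"
    by (intro image_eqI[where x="(take i w, drop i w)"]) auto
qed

lemma FA_mult: "(x :: ('k::field, 'h) fa) \<in> FA \<Longrightarrow> y \<in> FA \<Longrightarrow> fa_mult x y \<in> FA"
  using finite_subset[OF fa_mult_support[of x y]] unfolding FA_def by blast

lemmas FA_rules = FA_zero FA_one FA_gen FA_add FA_scale FA_diff FA_mult

text \<open>A function on words is a linear form on the free algebra. Identities in
  \<open>FA\<close> are verified by pairing with all of them (\<open>pair_ext\<close>), and the
  transposed coaction reaches the free algebra through such functions.\<close>

definition pair :: "('h list \<Rightarrow> 'k) \<Rightarrow> ('k::field, 'h) fa \<Rightarrow> 'k" where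
  "pair W x = (\<Sum>w | x w \<noteq> 0. x w * W w)"

lemma pair_superset: "finite T \<Longrightarrow> {w. x w \<noteq> 0} \<subseteq> T \<Longrightarrow> pair W x = (\<Sum>w\<in>T. x w * W w)"
  unfolding pair_def by (rule sum.mono_neutral_left) auto

lemma pair_add: "x \<in> FA \<Longrightarrow> y \<in> FA \<Longrightarrow> pair W (fa_add x y) = pair W x + pair W y"
proof -
  assume xy: "x \<in> FA" "y \<in> FA"
  define T where "T = {w. x w \<noteq> 0} \<union> {w. y w \<noteq> 0}"
  have T: "finite T" using xy by (simp add: T_def FA_def)
  have "pair W z = (\<Sum>w\<in>T. z w * W w)" if "z = x \<or> z = y \<or> z = fa_add x y" for z
    by (rule pair_superset[OF T]) (use that in \<open>auto simp: T_def fa_add_def\<close>)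
  then show ?thesis by (simp add: fa_add_def distrib_right sum.distrib)
qed

lemma pair_scale: "x \<in> FA \<Longrightarrow> pair W (fa_scale c x) = c * pair W x"
  using pair_superset[of "{w. x w \<noteq> 0}" "fa_scale c x" W]
  by (auto simp: FA_def fa_scale_def pair_def sum_distrib_left mult.assoc)

lemma pair_one: "pair W fa_one = W []"
  using pair_superset[of "{[]}" fa_one W] by (auto simp: fa_one_def)

lemma pair_gen: "pair W (fa_gen h) = W [h]"
  using pair_superset[of "{[h]}" "fa_gen h" W] by (auto simp: fa_gen_def)

lemma pair_form_zero: "(\<And>w. W w = 0) \<Longrightarrow> pair W x = 0"
  by (simp add: pair_def)

lemma pair_mult:
  fixes x y :: "('k::field, 'h) fa"
  assumes x: "x \<in> FA" and y: "y \<in> FA"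
  shows "pair W (fa_mult x y) = pair (\<lambda>u. pair (\<lambda>v. W (u @ v)) y) x"
proof -
  let ?X = "{u. x u \<noteq> 0}" and ?Y = "{v. y v \<noteq> 0}"
  define T where "T = (\<lambda>(u, v). u @ v) ` (?X \<times> ?Y)"
  have T: "finite T" using x y by (simp add: T_def FA_def)
  let ?f = "\<lambda>(w, i). x (take i w) * y (drop i w) * W w"
  \<comment> \<open>A word with a cutting position is the same as a pair of words; pairs outside the
    supports contribute zero.\<close>
  let ?g = "\<lambda>(u, v). (u @ v, length u)"
  have "pair W (fa_mult x y) = (\<Sum>w\<in>T. fa_mult x y w * W w)"
    by (rule pair_superset[OF T]) (use fa_mult_support in \<open>auto simp: T_def\<close>)
  also have "\<dots> = (\<Sum>(w, i)\<in>Sigma T (\<lambda>w. {0..length w}). x (take i w) * y (drop i w) * W w)"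
    by (simp add: fa_mult_def sum_distrib_right sum.Sigma T)
  also have "\<dots> = (\<Sum>p\<in>?g ` (?X \<times> ?Y). ?f p)"
  proof (rule sum.mono_neutral_right)
    show "finite (Sigma T (\<lambda>w. {0..length w}))" using T by simp
    show "\<forall>p\<in>Sigma T (\<lambda>w. {0..length w}) - ?g ` (?X \<times> ?Y). ?f p = 0"
    proof
      fix p assume p: "p \<in> Sigma T (\<lambda>w. {0..length w}) - ?g ` (?X \<times> ?Y)"
      obtain w i where [simp]: "p = (w, i)" by (cases p)
      have "(take i w, drop i w) \<notin> ?X \<times> ?Y"
      proof
        assume "(take i w, drop i w) \<in> ?X \<times> ?Y"
        then have "?g (take i w, drop i w) \<in> ?g ` (?X \<times> ?Y)" by (rule imageI)
        with p show False by simp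
      qed
      then show "?f p = 0" by auto
    qed
  qed (auto simp: T_def)
  also have "\<dots> = (\<Sum>p\<in>?X \<times> ?Y. ?f (?g p))"
    by (subst sum.reindex) (auto simp: inj_on_def)
  also have "\<dots> = pair (\<lambda>u. pair (\<lambda>v. W (u @ v)) y) x"
    by (simp add: pair_def sum.cartesian_product case_prod_unfold sum_distrib_left mult.assoc)
  finally show ?thesis .
qed

lemma pair_swap: "pair (\<lambda>u. pair (\<lambda>v. W u v) y) x = pair (\<lambda>v. pair (\<lambda>u. W u v) x) y"
  by (simp add: pair_def sum_distrib_left) (subst sum.swap, simp add: mult.left_commute)

lemma pair_dsum: "pair (\<lambda>w. dsum H h (F w)) x = dsum H h (\<lambda>a b. pair (\<lambda>w. F w a b) x)"
proof -
  have "(\<Sum>w\<in>T. x w * (\<Sum>(a, b)\<leftarrow>xs. F w a b)) = (\<Sum>(a, b)\<leftarrow>xs. \<Sum>w\<in>T. x w * F w a b)" for T xs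
    by (induction xs) (auto simp: distrib_left sum.distrib)
  then show ?thesis by (simp add: pair_def dsum_def)
qed

lemma pair_delta: "x \<in> FA \<Longrightarrow> pair (\<lambda>v. if v = w then 1 else 0) x = x w"
  by (auto simp: pair_def FA_def if_distrib[of "(*) _"] cong: if_cong)

lemma pair_ext:
  assumes "x \<in> FA" "y \<in> FA" "\<And>W. pair W x = pair W y"
  shows "x = y"
  using assms(3)[of "\<lambda>v. if v = _ then 1 else 0"] by (auto simp: pair_delta[OF assms(1)] pair_delta[OF assms(2)])

lemma fa_mult_assoc:
  fixes x y z :: "('k::field, 'h) fa"
  shows "x \<in> FA \<Longrightarrow> y \<in> FA \<Longrightarrow> z \<in> FA \<Longrightarrow> fa_mult (fa_mult x y) z = fa_mult x (fa_mult y z)"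
  by (rule pair_ext) (simp_all add: FA_mult pair_mult)

lemma fa_mult_one_right: "x \<in> FA \<Longrightarrow> fa_mult x fa_one = (x :: ('k::field, 'h) fa)"
  by (rule pair_ext) (simp_all add: FA_mult FA_one pair_mult pair_one)

lemma fa_mult_one_left: "x \<in> FA \<Longrightarrow> fa_mult fa_one x = (x :: ('k::field, 'h) fa)"
  by (rule pair_ext) (simp_all add: FA_mult FA_one pair_mult pair_one)

lemma fa_mult_add_left: "fa_mult (fa_add x y) z = fa_add (fa_mult x z) (fa_mult y z)"
  and fa_mult_add_right: "fa_mult z (fa_add x y) = fa_add (fa_mult z x) (fa_mult z y)"
  and fa_mult_scale_left: "fa_mult (fa_scale c x) z = fa_scale c (fa_mult x z)"
  and fa_mult_scale_right: "fa_mult z (fa_scale c x) = fa_scale c (fa_mult z x)"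
  by (simp_all add: fa_mult_def fa_defs algebra_simps sum.distrib sum_distrib_left)

text \<open>Words are products of generators, and a finitely supported function can be stripped of
  one word of its support at a time.\<close>

lemma FA_induct [consumes 1, case_names zero one gen add scale mult]:
  fixes x :: "('k::field, 'h) fa"
  assumes "x \<in> FA"
    and zero: "P fa_zero" and one: "P fa_one" and gen: "\<And>h. P (fa_gen h)"
    and add: "\<And>x y. x \<in> FA \<Longrightarrow> y \<in> FA \<Longrightarrow> P x \<Longrightarrow> P y \<Longrightarrow> P (fa_add x y)"
    and scale: "\<And>c x. x \<in> FA \<Longrightarrow> P x \<Longrightarrow> P (fa_scale c x)"
    and mult: "\<And>x y. x \<in> FA \<Longrightarrow> y \<in> FA \<Longrightarrow> P x \<Longrightarrow> P y \<Longrightarrow> P (fa_mult x y)"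
  shows "P x"
proof -
  define \<delta> :: "'h list \<Rightarrow> ('k, 'h) fa" where "\<delta> w = (\<lambda>v. if v = w then 1 else 0)" for w
  have \<delta>: "\<delta> w \<in> FA" and pair_\<delta>: "pair W (\<delta> w) = W w" for w W
    using pair_superset[of "{w}" "\<delta> w" W] by (auto simp: \<delta>_def FA_def)
  have word: "P (\<delta> w)" for w
  proof (induction w)
    case Nil
    then show ?case using one by (simp add: \<delta>_def fa_one_def)
  next
    case (Cons h w)
    have "\<delta> (h # w) = fa_mult (fa_gen h) (\<delta> w)"
      by (rule pair_ext) (simp_all add: \<delta> FA_mult FA_gen pair_mult pair_\<delta> pair_gen)
    then show ?case using mult[OF FA_gen \<delta> gen Cons] by simp
  qed
  have "P x" if "finite T" "{w. x w \<noteq> 0} \<subseteq> T" for T x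
    using that
  proof (induction T arbitrary: x rule: finite_induct)
    case empty
    then have "x = fa_zero" by (auto simp: fa_zero_def)
    then show ?case using zero by simp
  next
    case (insert w T)
    let ?y = "x(w := 0)"
    have y: "{w. ?y w \<noteq> 0} \<subseteq> T" using insert.prems by auto
    then have "?y \<in> FA" using finite_subset[OF y insert.hyps(1)] by (simp add: FA_def)
    moreover have "x = fa_add (fa_scale (x w) (\<delta> w)) ?y"
      by (auto simp: fa_add_def fa_scale_def \<delta>_def fun_eq_iff)
    ultimately show ?case
      using add[OF FA_scale[OF \<delta>] _ scale[OF \<delta> word] insert.IH[OF y]] by metis
  qed
  then show ?thesis using assms(1) by (auto simp: FA_def)
qed

text \<open>The type \<open>fa\<close> also contains functions of infinite support, on which
  \<open>pair\<close> is not additive; linearity is therefore asked for on \<open>FA\<close>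
  only.\<close>

definition fa_lin :: "('k::field \<Rightarrow> 'w::ab_group_add \<Rightarrow> 'w) \<Rightarrow> (('k, 'h) fa \<Rightarrow> 'w) \<Rightarrow> bool" where
  "fa_lin t f \<longleftrightarrow> (\<forall>x\<in>FA. \<forall>y\<in>FA. f (fa_add x y) = f x + f y) \<and> (\<forall>c. \<forall>x\<in>FA. f (fa_scale c x) = t c (f x))"

lemma fa_lin_add: "fa_lin t f \<Longrightarrow> x \<in> FA \<Longrightarrow> y \<in> FA \<Longrightarrow> f (fa_add x y) = f x + f y"
  and fa_lin_scale: "fa_lin t f \<Longrightarrow> x \<in> FA \<Longrightarrow> f (fa_scale c x) = t c (f x)"
  by (simp_all add: fa_lin_def)

lemma fa_lin_zero: "fa_lin t f \<Longrightarrow> f fa_zero = 0"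
  using fa_lin_add[of t f fa_zero fa_zero] by (simp add: FA_zero) (simp add: fa_defs)

lemma fa_lin_sum: "fa_lin t f \<Longrightarrow> set xs \<subseteq> FA \<Longrightarrow> f (fa_sum xs) = (\<Sum>x\<leftarrow>xs. f x)"
proof (induction xs)
  case Nil
  then show ?case by (simp add: fa_sum_def fa_lin_zero)
next
  case (Cons x xs)
  then show ?case using FA_sum[of xs] by (simp add: fa_sum_def fa_lin_add)
qed

lemma fa_lin_diff:
  assumes "vector_space t" "fa_lin t f" "x \<in> FA" "y \<in> FA"
  shows "f (fa_diff x y) = f x - f y"
proof -
  interpret vector_space t by fact
  show ?thesis using assms by (simp add: fa_diff_def fa_lin_add fa_lin_scale FA_scale)
qed

lemma fa_lin_pair: "fa_lin (*) (pair W)"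
  by (simp add: fa_lin_def pair_add pair_scale)

lemmas pair_diff = fa_lin_diff[OF vector_space_field fa_lin_pair]

lemma fa_lin_cm_sum:
  assumes "fa_lin t f" "\<And>a b. F a b \<in> FA"
  shows "f (fa_sum (map (\<lambda>(a, b). F a b) (cm H h))) = dsum H h (\<lambda>a b. f (F a b))"
  using fa_lin_sum[OF assms(1), of "map (\<lambda>(a, b). F a b) (cm H h)"] assms(2)
  by (auto simp: dsum_def case_prod_unfold o_def)

lemma fa_lin_cm2L_sum:
  assumes "fa_lin t f" "\<And>a b c. F a b c \<in> FA"
  shows "f (fa_sum (map (\<lambda>(a, b, c). F a b c) (cm2L H h))) = dsum H h (\<lambda>a b. dsum H a (\<lambda>c d. f (F c d b)))"
  using fa_lin_sum[OF assms(1), of "map (\<lambda>(a, b, c). F a b c) (cm2L H h)"] assms(2)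
  by (auto simp: dsum_def cm2L_def case_prod_unfold o_def map_concat sum_list_concat)

lemma FA_cm_sum: "(\<And>a b. F a b \<in> FA) \<Longrightarrow> fa_sum (map (\<lambda>(a, b). F a b) xs) \<in> (FA :: ('k::field, 'h) fa set)"
  by (rule FA_sum) auto

lemma parI_gens_FA: "r \<in> parI_gens H \<Longrightarrow> r \<in> FA"
  unfolding parI_gens_def by (auto intro!: FA_rules FA_sum)

lemma parI_FA: "r \<in> parI H \<Longrightarrow> r \<in> FA"
  by (induction rule: parI.induct) (auto intro: FA_rules parI_gens_FA)

section \<open>The universal partial representation and the partial smash product\<close>

text \<open>\<kappa> stands for the quotient map by \<open>parI H\<close>. It is described by its
  kernel and not as a surjection, so the ambient ring may be larger than the universal
  algebra.\<close>

locale universal_rep = whopf H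
  for H :: "('k::field, 'h::ab_group_add) wha" +
  fixes rs :: "'k \<Rightarrow> 'r::ring \<Rightarrow> 'r" and \<kappa> :: "('k, 'h) fa \<Rightarrow> 'r"
  assumes vector_space_rs: "vector_space rs"
    and rs_mult_left: "rs c (x * y) = rs c x * y"
    and rs_mult_right: "rs c (x * y) = x * rs c y"
    and fa_lin_\<kappa>: "fa_lin rs \<kappa>"
    and \<kappa>_mult: "u \<in> FA \<Longrightarrow> v \<in> FA \<Longrightarrow> \<kappa> (fa_mult u v) = \<kappa> u * \<kappa> v"
    and \<kappa>_eq_iff: "u \<in> FA \<Longrightarrow> v \<in> FA \<Longrightarrow> \<kappa> u = \<kappa> v \<longleftrightarrow> parcong H u v"
begin

definition br :: "'h \<Rightarrow> 'r" where "br h = \<kappa> (fa_gen h)"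

lemmas \<kappa>_add = fa_lin_add[OF fa_lin_\<kappa>]
  and \<kappa>_scale = fa_lin_scale[OF fa_lin_\<kappa>]
  and \<kappa>_zero = fa_lin_zero[OF fa_lin_\<kappa>]
  and \<kappa>_diff = fa_lin_diff[OF vector_space_rs fa_lin_\<kappa>]
  and \<kappa>_cm_sum = fa_lin_cm_sum[OF fa_lin_\<kappa>]

lemma \<kappa>_parI: "r \<in> parI H \<Longrightarrow> \<kappa> r = 0"
proof -
  assume r: "r \<in> parI H"
  then have "parcong H r fa_zero" by (simp add: parcong_def fa_defs)
  then show "\<kappa> r = 0" using \<kappa>_eq_iff[OF parI_FA[OF r] FA_zero] \<kappa>_zero by simp
qed

lemma \<kappa>_gens: "r \<in> parI_gens H \<Longrightarrow> \<kappa> r = 0"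
  by (intro \<kappa>_parI parI.gen)

lemma \<kappa>_one: "\<kappa> fa_one = br \<one>"
proof -
  have "fa_diff (fa_gen \<one>) fa_one \<in> parI_gens H" by (simp add: parI_gens_def)
  from \<kappa>_gens[OF this] show ?thesis by (simp add: \<kappa>_diff FA_rules br_def)
qed

lemmas \<kappa>_simps = \<kappa>_diff \<kappa>_add \<kappa>_scale \<kappa>_mult FA_rules br_def[symmetric]

lemma dsum_diff: "dsum H h (\<lambda>a b. F a b - G a b) = dsum H h F - (dsum H h G :: 'w::ab_group_add)"
  by (simp add: dsum_def case_prod_unfold sum_list_subtractf)

sublocale partial_rep H rs br
proof
  show "rs c (x * y) = rs c x * y" for c x y by (rule rs_mult_left)
  show "rs c (x * y) = x * rs c y" for c x y by (rule rs_mult_right)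
  show "lmap hs rs br"
    unfolding lmap_def
  proof (intro conjI allI)
    show "br (h + g) = br h + br g" for h g
    proof -
      have "fa_diff (fa_gen (h + g)) (fa_add (fa_gen h) (fa_gen g)) \<in> parI_gens H"
        unfolding parI_gens_def by blast
      from \<kappa>_gens[OF this] show ?thesis by (simp add: \<kappa>_simps)
    qed
    show "br (hs c h) = rs c (br h)" for c h
    proof -
      have "fa_diff (fa_gen (hs c h)) (fa_scale c (fa_gen h)) \<in> parI_gens H"
        unfolding parI_gens_def by blast
      from \<kappa>_gens[OF this] show ?thesis by (simp add: \<kappa>_simps)
    qed
  qed
  show "br \<one> * br h = br h" for h
    using \<kappa>_mult[OF FA_one FA_gen, of h] by (simp add: \<kappa>_one br_def[symmetric] fa_mult_one_left FA_gen)
  show "br h * br \<one> = br h" for h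
    using \<kappa>_mult[OF FA_gen FA_one, of h] by (simp add: \<kappa>_one br_def[symmetric] fa_mult_one_right FA_gen)
  fix h k
  have "\<kappa> (fa_sum (map (\<lambda>(a,b). fa_diff (fa_mult3 (fa_gen h) (fa_gen a) (fa_gen (S b)))
      (fa_mult (fa_gen (h \<odot> a)) (fa_gen (S b)))) (cm H k))) = 0"
    by (rule \<kappa>_gens, unfold parI_gens_def) blast
  then show "\<Delta> k (\<lambda>a b. br h * br a * br (S b)) = \<Delta> k (\<lambda>a b. br (h \<odot> a) * br (S b))"
    by (subst (asm) \<kappa>_cm_sum) (simp_all add: \<kappa>_simps dsum_diff)
  have "\<kappa> (fa_sum (map (\<lambda>(a,b). fa_diff (fa_mult3 (fa_gen h) (fa_gen (S a)) (fa_gen b))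
      (fa_mult (fa_gen (h \<odot> S a)) (fa_gen b))) (cm H k))) = 0"
    by (rule \<kappa>_gens, unfold parI_gens_def) blast
  then show "\<Delta> k (\<lambda>a b. br h * br (S a) * br b) = \<Delta> k (\<lambda>a b. br (h \<odot> S a) * br b)"
    by (subst (asm) \<kappa>_cm_sum) (simp_all add: \<kappa>_simps dsum_diff)
  have "\<kappa> (fa_sum (map (\<lambda>(a,b). fa_diff (fa_mult3 (fa_gen a) (fa_gen (S b)) (fa_gen k))
      (fa_mult (fa_gen a) (fa_gen (S b \<odot> k)))) (cm H h))) = 0"
    by (rule \<kappa>_gens, unfold parI_gens_def) blast
  then show "\<Delta> h (\<lambda>a b. br a * br (S b) * br k) = \<Delta> h (\<lambda>a b. br a * br (S b \<odot> k))"
    by (subst (asm) \<kappa>_cm_sum) (simp_all add: \<kappa>_simps dsum_diff)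
  have "\<kappa> (fa_sum (map (\<lambda>(a,b). fa_diff (fa_mult3 (fa_gen (S a)) (fa_gen b) (fa_gen k))
      (fa_mult (fa_gen (S a)) (fa_gen (b \<odot> k)))) (cm H h))) = 0"
    by (rule \<kappa>_gens, unfold parI_gens_def) blast
  then show "\<Delta> h (\<lambda>a b. br (S a) * br b * br k) = \<Delta> h (\<lambda>a b. br (S a) * br (b \<odot> k))"
    by (subst (asm) \<kappa>_cm_sum) (simp_all add: \<kappa>_simps dsum_diff)
  have "\<kappa> (fa_diff (fa_gen h)
      (fa_sum (map (\<lambda>(a,b,c). fa_mult3 (fa_gen a) (fa_gen (S b)) (fa_gen c)) (cm2L H h)))) = 0"
    by (rule \<kappa>_gens, unfold parI_gens_def) blast
  then have "br h = \<kappa> (fa_sum (map (\<lambda>(a,b,c). fa_mult3 (fa_gen a) (fa_gen (S b)) (fa_gen c)) (cm2L H h)))"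
    by (subst (asm) \<kappa>_diff) (auto intro!: FA_sum FA_rules simp: br_def)
  also have "\<dots> = \<Delta> h (\<lambda>a b. \<Delta> a (\<lambda>c d. br c * br (S d) * br b))"
    by (subst fa_lin_cm2L_sum[OF fa_lin_\<kappa>]) (simp_all add: \<kappa>_simps)
  finally show "\<Delta> h (\<lambda>a b. \<Delta> a (\<lambda>c d. br c * br (S d) * br b)) = br h" ..
qed (rule vector_space.vector_space_assms[OF vector_space_rs])+

section \<open>The coaction on the universal algebra\<close>

lemma foldl_pull_uforms: "\<gamma> \<in> uforms \<Longrightarrow> foldl pull \<gamma> w \<in> uforms"
  by (induction w arbitrary: \<gamma>) (simp_all add: pull_uforms[OF uforms_bform])

text \<open>For right multiples in \<open>pull_parI\<close>: the element of the ideal acts on the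
  form first, and pulling along the remaining word is linear in the form.\<close>

lemma pair_foldl_pull_zero:
  "(\<And>x g. pair (\<lambda>u. \<gamma> u x g) y = 0) \<Longrightarrow> pair (\<lambda>u. foldl pull (\<gamma> u) w x g) y = 0"
proof (induction w arbitrary: \<gamma> x g)
  case (Cons h w)
  have "pair (\<lambda>u. pull (\<gamma> u) h x g) y = 0" for x g
    by (simp add: pull_def pair_dsum Cons.prems) (simp add: dsum_def case_prod_unfold)
  from Cons.IH[OF this] show ?case by simp
qed simp

text \<open>Well-definedness of the coaction: pulling along the letters of a word is the transpose
  of left multiplication by its image, and the ideal thus acts as zero. The form varies in the
  induction because left multiples pass to \<open>foldl pull \<gamma> u\<close>.\<close>

lemma pull_parI: "r \<in> parI H \<Longrightarrow> \<gamma> \<in> uforms \<Longrightarrow> pair (\<lambda>w. foldl pull \<gamma> w x g) r = 0"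
proof (induction arbitrary: \<gamma> x g rule: parI.induct)
  case (gen r)
  note \<gamma> = gen(2)
  let ?W = "\<lambda>w. foldl pull \<gamma> w x g"
  note sum = fa_lin_cm_sum[OF fa_lin_pair] fa_lin_cm2L_sum[OF fa_lin_pair]
  note simps = pair_diff pair_add pair_scale pair_mult pair_gen pair_one FA_rules dsum_diff
  note lin = lmap_pull[OF \<gamma>]
  from gen(1) consider
      h g' where "r = fa_diff (fa_gen (h + g')) (fa_add (fa_gen h) (fa_gen g'))"
    | c h where "r = fa_diff (fa_gen (hs c h)) (fa_scale c (fa_gen h))"
    | "r = fa_diff (fa_gen \<one>) fa_one"
    | h k where "r = fa_sum (map (\<lambda>(a,b). fa_diff (fa_mult3 (fa_gen h) (fa_gen a) (fa_gen (S b)))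
                                    (fa_mult (fa_gen (h \<odot> a)) (fa_gen (S b)))) (cm H k))"
    | h k where "r = fa_sum (map (\<lambda>(a,b). fa_diff (fa_mult3 (fa_gen h) (fa_gen (S a)) (fa_gen b))
                                    (fa_mult (fa_gen (h \<odot> S a)) (fa_gen b))) (cm H k))"
    | h k where "r = fa_sum (map (\<lambda>(a,b). fa_diff (fa_mult3 (fa_gen a) (fa_gen (S b)) (fa_gen k))
                                    (fa_mult (fa_gen a) (fa_gen (S b \<odot> k)))) (cm H h))"
    | h k where "r = fa_sum (map (\<lambda>(a,b). fa_diff (fa_mult3 (fa_gen (S a)) (fa_gen b) (fa_gen k))
                                    (fa_mult (fa_gen (S a)) (fa_gen (b \<odot> k)))) (cm H h))"
    | h where "r = fa_diff (fa_gen h)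
        (fa_sum (map (\<lambda>(a,b,c). fa_mult3 (fa_gen a) (fa_gen (S b)) (fa_gen c)) (cm2L H h)))"
    unfolding parI_gens_def by blast
  then show ?case
  proof cases
    case 1
    then show ?thesis by (simp add: simps lmap_add[OF lin])
  next
    case 2
    then show ?thesis by (simp add: simps lmap_scale[OF lin])
  next
    case 3
    then show ?thesis by (simp add: simps pull_one[OF \<gamma>])
  next
    case (4 h k)
    show ?thesis unfolding 4 by (subst sum(1)) (simp_all add: simps pull_br_mult_E[OF \<gamma>])
  next
    case (5 h k)
    show ?thesis unfolding 5 by (subst sum(1)) (simp_all add: simps pull_br_mult_Et[OF \<gamma>])
  next
    case (6 h k)
    show ?thesis unfolding 6 by (subst sum(1)) (simp_all add: simps pull_E_mult_br[OF \<gamma>])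
  next
    case (7 h k)
    show ?thesis unfolding 7 by (subst sum(1)) (simp_all add: simps pull_Et_mult_br[OF \<gamma>])
  next
    case (8 h)
    show ?thesis unfolding 8
      by (subst pair_diff) (auto intro!: FA_sum FA_rules simp: sum(2) simps pull_br_expand[OF \<gamma>])
  qed
next
  case zero
  show ?case by (rule fa_lin_zero[OF fa_lin_pair])
next
  case (add y z)
  then show ?case by (simp add: pair_add parI_FA[OF add.hyps(1)] parI_FA[OF add.hyps(2)])
next
  case (scale y c)
  then show ?case by (simp add: pair_scale parI_FA[OF scale.hyps])
next
  case (lmul y a)
  show ?case
    by (simp add: pair_mult parI_FA[OF lmul.hyps(1)] lmul.hyps lmul.IH[OF foldl_pull_uforms[OF lmul.prems]] pair_form_zero)
next
  case (rmul y a)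
  have "pair (\<lambda>u. foldl pull (foldl pull \<gamma> u) v x g) y = 0" for v
    by (rule pair_foldl_pull_zero) (rule rmul.IH[OF rmul.prems])
  then show ?case
    by (simp add: pair_mult parI_FA[OF rmul.hyps(1)] rmul.hyps pair_swap[of _ a] pair_form_zero)
qed

lemma Eel_FA: "Eel H h \<in> FA"
  unfolding Eel_def by (intro FA_cm_sum FA_rules)

lemma \<kappa>_Eel: "\<kappa> (Eel H h) = E h"
  unfolding Eel_def by (subst \<kappa>_cm_sum) (simp_all add: \<kappa>_simps E_def)

lemma Agen_FA: "a \<in> Agen H \<Longrightarrow> a \<in> FA"
  by (induction rule: Agen.induct) (auto intro: FA_rules Eel_FA)

lemma \<kappa>_Agen: "a \<in> Agen H \<Longrightarrow> \<kappa> a \<in> asub"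
  by (induction rule: Agen.induct) (auto simp: \<kappa>_simps Agen_FA \<kappa>_one \<kappa>_Eel intro: asub.intros)

lemma asub_\<kappa>: "x \<in> asub \<Longrightarrow> \<exists>a\<in>Agen H. \<kappa> a = x"
proof (induction rule: asub.induct)
  case one
  show ?case using \<kappa>_one Agen.one by blast
next
  case (E h)
  show ?case using \<kappa>_Eel Agen.E by blast
next
  case (add x y)
  then show ?case using \<kappa>_add Agen_FA Agen.add by metis
next
  case (scale x c)
  then show ?case using \<kappa>_scale Agen_FA Agen.scale by metis
next
  case (mult x y)
  then show ?case using \<kappa>_mult Agen_FA Agen.mult by metis
qed

lemma Apar_iff: "a \<in> Apar H \<longleftrightarrow> a \<in> FA \<and> \<kappa> a \<in> asub"
proof
  assume "a \<in> Apar H"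
  then obtain b where "a \<in> FA" "b \<in> Agen H" "parcong H a b" by (auto simp: Apar_def)
  then show "a \<in> FA \<and> \<kappa> a \<in> asub" using \<kappa>_eq_iff[of a b] \<kappa>_Agen Agen_FA by metis
next
  assume a: "a \<in> FA \<and> \<kappa> a \<in> asub"
  then obtain b where "b \<in> Agen H" "\<kappa> b = \<kappa> a" using asub_\<kappa> by blast
  then show "a \<in> Apar H" using a \<kappa>_eq_iff[of a b] Agen_FA by (auto simp: Apar_def)
qed

text \<open>Coinvariance of A. The property is inherited by products, so \<open>pull_pull_S\<close>
  settles \<open>Agen\<close>, and \<open>pull_parI\<close> carries the result over to
  \<open>Apar\<close>.\<close>

lemma pair_pull_Apar:
  assumes "a \<in> Apar H" "\<gamma> \<in> uforms"
  shows "pair (\<lambda>w. foldl pull \<gamma> w x g) a = \<gamma> (\<kappa> a * x) g"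
proof -
  have Agen: "pair (\<lambda>w. foldl pull \<gamma> w x g) a = \<gamma> (\<kappa> a * x) g" if "a \<in> Agen H" "\<gamma> \<in> uforms" for a \<gamma> x g
    using that
  proof (induction arbitrary: \<gamma> x g rule: Agen.induct)
    case one
    \<comment> \<open>A form in \<open>uforms\<close> does not see the factor e, since [1_1] e =
      [1_1].\<close>
    have "\<gamma> (e * x) g = pull \<gamma> \<one> (e * x) g" using pull_one[OF one] by simp
    also have "\<dots> = pull \<gamma> \<one> x g"
      by (simp add: pull_def mult.assoc[symmetric] br_one_right)
    finally show ?case by (simp add: pair_one \<kappa>_one pull_one[OF one])
  next
    case (E h)
    show ?case
      unfolding \<kappa>_Eel pull_pull_S[OF E, symmetric] unfolding Eel_def
      by (subst fa_lin_cm_sum[OF fa_lin_pair]) (simp_all add: FA_rules pair_mult pair_gen)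
  next
    case (add y z)
    then show ?case
      using lmap_add[OF bform_1[OF uforms_bform[OF add.prems] lmap_id]]
      by (simp add: pair_add Agen_FA \<kappa>_add distrib_right)
  next
    case (scale y c)
    then show ?case
      using lmap_scale[OF bform_1[OF uforms_bform[OF scale.prems] lmap_id]]
      by (simp add: pair_scale Agen_FA \<kappa>_scale rs_mult_left[symmetric])
  next
    case (mult y z)
    then show ?case
      by (simp add: pair_mult Agen_FA foldl_pull_uforms \<kappa>_mult mult.assoc)
  qed
  obtain b where b: "b \<in> Agen H" "parcong H a b" "a \<in> FA" using assms(1) by (auto simp: Apar_def)
  then have "pair (\<lambda>w. foldl pull \<gamma> w x g) a = pair (\<lambda>w. foldl pull \<gamma> w x g) b"
    using pull_parI[OF _ assms(2), of "fa_diff a b" x g] by (simp add: parcong_def pair_diff Agen_FA)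
  moreover have "\<kappa> a = \<kappa> b" using b \<kappa>_eq_iff Agen_FA by blast
  ultimately show ?thesis using Agen[OF b(1) assms(2)] by simp
qed

end

section \<open>Forms on the smash product\<close>

context universal_rep
begin

lemma act_FA: "a \<in> FA \<Longrightarrow> act H h a \<in> FA"
  unfolding act_def by (intro FA_cm_sum FA_rules)

lemma \<kappa>_act: "a \<in> FA \<Longrightarrow> \<kappa> (act H h a) = ad h (\<kappa> a)"
  unfolding act_def by (subst \<kappa>_cm_sum) (simp_all add: \<kappa>_simps ad_def)

lemma Apar_FA: "a \<in> Apar H \<Longrightarrow> a \<in> FA"
  and Apar_one: "fa_one \<in> Apar H"
  and Apar_add: "a \<in> Apar H \<Longrightarrow> b \<in> Apar H \<Longrightarrow> fa_add a b \<in> Apar H"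
  and Apar_scale: "a \<in> Apar H \<Longrightarrow> fa_scale c a \<in> Apar H"
  and Apar_mult: "a \<in> Apar H \<Longrightarrow> b \<in> Apar H \<Longrightarrow> fa_mult a b \<in> Apar H"
  and Apar_act: "a \<in> Apar H \<Longrightarrow> act H h a \<in> Apar H"
  by (auto simp: Apar_iff \<kappa>_simps \<kappa>_one \<kappa>_act act_FA intro: asub.intros ad_asub)

text \<open>Forms are taken on the ring rather than on representatives, so compatibility with
  \<open>parcong\<close> is automatic.\<close>

definition val :: "('r \<Rightarrow> 'h \<Rightarrow> 'w) \<Rightarrow> ('k, 'h) stens \<Rightarrow> 'w::comm_monoid_add" where
  "val f s = (\<Sum>(a, h)\<leftarrow>s. f (\<kappa> a) h)"

lemma val_Nil: "val f [] = 0" and val_Cons: "val f ((a, h) # s) = f (\<kappa> a) h + val f s"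
  and val_append: "val f (s @ t) = val f s + val f t"
  by (simp_all add: val_def)

lemma val_cong: "(\<And>a h. (a, h) \<in> set s \<Longrightarrow> f (\<kappa> a) h = f' (\<kappa> a) h) \<Longrightarrow> val f s = val f' s"
  unfolding val_def by (intro arg_cong[where f=sum_list] map_cong) auto

lemma AtensD: "s \<in> Atens H \<Longrightarrow> (a, h) \<in> set s \<Longrightarrow> a \<in> Apar H"
  by (auto simp: Atens_def)

lemma val_tscale:
  fixes t :: "'k \<Rightarrow> 'w::ab_group_add \<Rightarrow> 'w"
  assumes "s \<in> Atens H" "\<And>a h. (a, h) \<in> set s \<Longrightarrow> f (rs c (\<kappa> a)) h = t c (f (\<kappa> a) h)" "lmap t t (t c)"
  shows "val f (tscale c s) = t c (val f s)"
  using assms(1,2)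
proof (induction s)
  case Nil
  show ?case using lmap_zero[OF assms(3)] by (simp add: val_def tscale_def)
next
  case (Cons p s)
  obtain a h where [simp]: "p = (a, h)" by (cases p)
  have "a \<in> FA" using Cons.prems(1) by (auto simp: Atens_def Apar_FA)
  with Cons show ?case
    by (simp add: val_def tscale_def Atens_def \<kappa>_scale lmap_add[OF assms(3)])
qed

lemma val_smul:
  assumes "s \<in> Atens H" "t \<in> Atens H"
  shows "val f (smul H s t) = val (\<lambda>x h. val (\<lambda>y g. \<Delta> h (\<lambda>p q. f (x * ad p y) (q \<odot> g))) t) s"
proof -
  have inner: "val f (concat (map (\<lambda>(b, g). map (\<lambda>(h1, h2). (fa_mult a (act H h1 b), h2 \<odot> g)) (cm H h)) t)) =
      val (\<lambda>y g. \<Delta> h (\<lambda>p q. f (\<kappa> a * ad p y) (q \<odot> g))) t" if "a \<in> Apar H" for a h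
    using assms(2)
  proof (induction t)
    case (Cons p t)
    obtain b g where [simp]: "p = (b, g)" by (cases p)
    have "a \<in> FA" "b \<in> FA" using Cons.prems that by (auto simp: Atens_def Apar_FA)
    then have "val f (map (\<lambda>(h1, h2). (fa_mult a (act H h1 b), h2 \<odot> g)) (cm H h)) =
        \<Delta> h (\<lambda>p q. f (\<kappa> a * ad p (\<kappa> b)) (q \<odot> g))"
      by (simp add: val_def dsum_def case_prod_unfold o_def \<kappa>_mult \<kappa>_act act_FA)
    moreover have "t \<in> Atens H" using Cons.prems by (simp add: Atens_def)
    ultimately show ?case using Cons.IH by (simp add: val_append val_Cons)
  qed (simp add: val_Nil)
  show ?thesis
    using assms(1)
  proof (induction s)
    case (Cons p s)
    obtain a h where [simp]: "p = (a, h)" by (cases p)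
    have "a \<in> Apar H" "s \<in> Atens H" using Cons.prems by (auto simp: Atens_def)
    then show ?case using Cons.IH inner[of a h] by (simp add: smul_def val_append val_Cons)
  qed (simp add: smul_def val_Nil)
qed

lemma Atens_append: "s \<in> Atens H \<Longrightarrow> t \<in> Atens H \<Longrightarrow> s @ t \<in> Atens H"
  and Atens_tscale: "s \<in> Atens H \<Longrightarrow> tscale c s \<in> Atens H"
  and Atens_smul: "s \<in> Atens H \<Longrightarrow> t \<in> Atens H \<Longrightarrow> smul H s t \<in> Atens H"
  by (fastforce simp: Atens_def tscale_def smul_def intro: Apar_scale Apar_mult Apar_act)+

lemma Atens_single: "[(a, h)] \<in> Atens H \<longleftrightarrow> a \<in> Apar H"
  by (simp add: Atens_def)

lemma Atens_psgen: "a \<in> Apar H \<Longrightarrow> psgen H a h \<in> Atens H"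
  by (simp add: psgen_def Atens_smul Atens_single Apar_one)

text \<open>The transpose of right multiplication by the unit of the partial smash product.\<close>

definition corner :: "('r \<Rightarrow> 'h \<Rightarrow> 'w) \<Rightarrow> 'r \<Rightarrow> 'h \<Rightarrow> 'w::comm_monoid_add" where
  "corner f x h = \<Delta> h (\<lambda>p q. f (x * E p) q)"

lemma val_psgen: "a \<in> Apar H \<Longrightarrow> val f (psgen H a h) = corner f (\<kappa> a) h"
  by (simp add: psgen_def val_smul Atens_single Apar_one val_Cons val_Nil \<kappa>_one ad_one corner_def)

lemma bform_corner: "bform f \<Longrightarrow> bform (corner f)"
  by (rule bformI; unfold corner_def; intro r_all bform_rules; assumption?)

lemma lmap_val [lin_rules]:
  "vector_space t \<Longrightarrow> (\<And>y g. lmap s t (\<lambda>x. F x y g)) \<Longrightarrow> lmap s t (\<lambda>x. val (F x) u)"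
  for t :: "'k \<Rightarrow> 'w::ab_group_add \<Rightarrow> 'w"
proof (induction u)
  case Nil
  then interpret vector_space t by simp
  show ?case by (simp add: val_Nil lmap_def)
next
  case (Cons p u)
  then interpret vector_space t by simp
  obtain b g where [simp]: "p = (b, g)" by (cases p)
  have "lmap s t (\<lambda>x. F x (\<kappa> b) g)" "lmap s t (\<lambda>x. val (F x) u)"
    using Cons by auto
  then show ?case by (simp add: val_Cons lmap_def scale_right_distrib)
qed

lemma corner_mult:
  assumes f: "bform f"
  shows "\<Delta> h (\<lambda>u v. corner (\<lambda>y g. \<Delta> v (\<lambda>p q. f (x * E u * ad p y) (q \<odot> g))) y g) =
    \<Delta> h (\<lambda>p q. corner f (x * ad p y) (q \<odot> g))"
proof -
  note v = vector_space_field and L = r_all bform_rules[OF f]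
  have f_sum: "\<Delta> w (\<lambda>a b. f (x * F a b) z) = f (x * \<Delta> w F) z" for w F z
    by (rule lmap_dsum[of rs "(*)" "\<lambda>r. f (x * r) z", symmetric]) (intro L)
  have "\<Delta> h (\<lambda>u v. corner (\<lambda>y g. \<Delta> v (\<lambda>p q. f (x * E u * ad p y) (q \<odot> g))) y g) =
      \<Delta> g (\<lambda>g1 g2. \<Delta> h (\<lambda>u v. \<Delta> v (\<lambda>p q. f (x * (E u * ad p (y * E g1))) (q \<odot> g2))))"
    unfolding corner_def by (subst dsum_swap) (simp add: mult.assoc)
  also have "\<dots> = \<Delta> g (\<lambda>g1 g2. \<Delta> h (\<lambda>w q. \<Delta> w (\<lambda>u p. f (x * (E u * ad p (y * E g1))) (q \<odot> g2))))"
    by (subst coassoc[OF v, symmetric]) (intro L refl)+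
  also have "\<dots> = \<Delta> g (\<lambda>g1 g2. \<Delta> h (\<lambda>w q. \<Delta> w (\<lambda>p r. f (x * (ad p y * E (r \<odot> g1))) (q \<odot> g2))))"
    unfolding f_sum E_mult_ad unfolding ad_mult_E ..
  also have "\<dots> = \<Delta> g (\<lambda>g1 g2. \<Delta> h (\<lambda>p z. \<Delta> z (\<lambda>r q. f (x * (ad p y * E (r \<odot> g1))) (q \<odot> g2))))"
    by (subst coassoc[OF v]) (intro L refl)+
  also have "\<dots> = \<Delta> h (\<lambda>p z. \<Delta> z (\<lambda>r q. \<Delta> g (\<lambda>g1 g2. f (x * (ad p y * E (r \<odot> g1))) (q \<odot> g2))))"
    by (subst dsum_swap) (simp only: dsum_swap[of H g])
  also have "\<dots> = \<Delta> h (\<lambda>p q. corner f (x * ad p y) (q \<odot> g))"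
    unfolding corner_def by (subst dsum_hmul[OF v], intro L) (simp add: mult.assoc)
  finally show ?thesis .
qed

lemma val_dsum: "\<Delta> h (\<lambda>u v. val (F u v) s) = val (\<lambda>y g. \<Delta> h (\<lambda>u v. F u v y g)) s"
proof (induction s)
  case Nil
  show ?case by (simp add: val_Nil dsum_def case_prod_unfold)
next
  case (Cons p s)
  then show ?case by (cases p) (simp add: val_Cons dsum_add)
qed

text \<open>Products of generators reduce to sums of generators already before passing to the tensor product
  over \<open>H\<^sub>t\<close>, so there is no need to show that \<open>smul\<close> respects \<open>teqA\<close>.\<close>

lemma PSgen_corner:
  "s \<in> PSgen H \<Longrightarrow> s \<in> Atens H \<and> (\<exists>L\<in>Atens H. \<forall>f. bform f \<longrightarrow> val f s = val (corner f) L)"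
proof (induction rule: PSgen.induct)
  case (gen a h)
  then show ?case
    by (auto simp: Atens_psgen val_psgen val_Cons val_Nil Atens_single intro!: bexI[where x="[(a, h)]"])
next
  case zero
  show ?case by (intro conjI bexI[where x="[]"]) (simp_all add: Atens_def val_Nil)
next
  case (add s t)
  then obtain L M where "L \<in> Atens H" "\<forall>f. bform f \<longrightarrow> val f s = val (corner f) L"
    "M \<in> Atens H" "\<forall>f. bform f \<longrightarrow> val f t = val (corner f) M" by blast
  with add show ?case by (auto simp: val_append Atens_append intro!: bexI[where x="L @ M"])
next
  case (scale s c)
  then obtain L where L: "L \<in> Atens H" "\<forall>f. bform f \<longrightarrow> val f s = val (corner f) L" by blast
  have tscale: "val f (tscale c u) = c * val f u" if "bform f" "u \<in> Atens H" for f u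
    using that lmap_scale[OF bform_1[OF that(1) lmap_id]] lmap_scale_right[OF vector_space_field lmap_id]
    by (intro val_tscale)
  show ?case
    using scale L by (auto simp: tscale bform_corner Atens_tscale intro!: bexI[where x="tscale c L"])
next
  case (mult s t)
  then obtain L M where L: "L \<in> Atens H" "\<And>f. bform f \<Longrightarrow> val f s = val (corner f) L"
    and M: "M \<in> Atens H" "\<And>f. bform f \<Longrightarrow> val f t = val (corner f) M" by blast
  have "val f (smul H s t) = val (corner f) (smul H L M)" if f: "bform f" for f
  proof -
    define F where "F x h = (\<lambda>y g. \<Delta> h (\<lambda>p q. f (x * ad p y) (q \<odot> g)))" for x h
    note R = r_all lmap_val bform_rules[OF f]
    have F: "bform (F x h)" for x h
      unfolding F_def by (rule bformI) (intro R)+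
    have F': "bform (\<lambda>x h. val (corner (F x h)) M)"
      unfolding F_def corner_def by (rule bformI) (intro R)+
    have "val f (smul H s t) = val (\<lambda>x h. val (F x h) t) s"
      using mult by (simp add: val_smul F_def)
    also have "\<dots> = val (corner (\<lambda>x h. val (corner (F x h)) M)) L"
      using M(2)[OF F] L(2)[OF F'] by simp
    also have "\<dots> = val (\<lambda>x h. val (\<lambda>y g. \<Delta> h (\<lambda>p q. corner f (x * ad p y) (q \<odot> g))) M) L"
    proof (rule val_cong)
      fix a h
      have "corner (\<lambda>x h. val (corner (F x h)) M) (\<kappa> a) h =
          val (\<lambda>y g. \<Delta> h (\<lambda>u v. corner (F (\<kappa> a * E u) v) y g)) M"
        by (subst corner_def) (rule val_dsum)
      then show "corner (\<lambda>x h. val (corner (F x h)) M) (\<kappa> a) h =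
          val (\<lambda>y g. \<Delta> h (\<lambda>p q. corner f (\<kappa> a * ad p y) (q \<odot> g))) M"
        unfolding F_def corner_mult[OF f] .
    qed
    also have "\<dots> = val (corner f) (smul H L M)"
      using L(1) M(1) by (simp add: val_smul)
    finally show ?thesis .
  qed
  with mult L M show ?case by (auto simp: Atens_smul intro!: bexI[where x="smul H L M"])
qed

text \<open>The coaction multiplies by brackets, which leaves A, whereas a balanced form is
  constrained only on representatives of A. Composing it with a projection onto A and a choice of
  representatives yields a form on the whole ring.\<close>

lemma balforms_extend:
  assumes \<beta>: "\<beta> \<in> balforms H"
  obtains f where "bform f" "\<And>a h. a \<in> Apar H \<Longrightarrow> f (\<kappa> a) h = \<beta> a h"
proof -
  obtain \<pi> where \<pi>_lin: "lmap rs rs \<pi>" and \<pi>_in: "\<And>x. \<pi> x \<in> asub" and \<pi>: "\<And>x. x \<in> asub \<Longrightarrow> \<pi> x = x"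
    using subspace_projection[OF vector_space_rs zero_asub asub.add asub.scale] by blast
  define \<sigma> where "\<sigma> x = (SOME a. a \<in> Apar H \<and> \<kappa> a = x)" for x
  have \<sigma>: "\<sigma> x \<in> Apar H \<and> \<kappa> (\<sigma> x) = x" if "x \<in> asub" for x
  proof -
    obtain b where "b \<in> Agen H" "\<kappa> b = x" using asub_\<kappa>[OF \<open>x \<in> asub\<close>] by blast
    then have "b \<in> Apar H \<and> \<kappa> b = x" using \<open>x \<in> asub\<close> by (simp add: Apar_iff Agen_FA)
    then have "\<exists>a. a \<in> Apar H \<and> \<kappa> a = x" by blast
    then show ?thesis unfolding \<sigma>_def by (rule someI_ex)
  qed
  have wd: "\<beta> a h = \<beta> b h" if "a \<in> Apar H" "b \<in> Apar H" "\<kappa> a = \<kappa> b" for a b h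
    using that \<beta> \<kappa>_eq_iff[of a b] by (simp add: balforms_def Apar_FA)
  have add: "\<beta> (fa_add a b) h = \<beta> a h + \<beta> b h" if "a \<in> Apar H" "b \<in> Apar H" for a b h
    using that \<beta> by (simp add: balforms_def)
  have scale: "\<beta> (fa_scale c a) h = c * \<beta> a h" if "a \<in> Apar H" for a c h
    using that \<beta> by (simp add: balforms_def)
  have lin: "lmap hs (*) (\<beta> a)" if "a \<in> Apar H" for a
    using that \<beta> linear_iff_lmap[OF vector_space_hs vector_space_field] by (auto simp: balforms_def)
  define f where "f x h = \<beta> (\<sigma> (\<pi> x)) h" for x h
  have "bform f"
  proof (rule bformI)
    fix g
    show "lmap rs (*) (\<lambda>x. f x g)"
      unfolding lmap_def
    proof (intro conjI allI)
      fix x y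
      have "\<beta> (\<sigma> (\<pi> (x + y))) g = \<beta> (fa_add (\<sigma> (\<pi> x)) (\<sigma> (\<pi> y))) g"
        by (rule wd) (use \<sigma>[OF \<pi>_in, of "x + y"] \<sigma>[OF \<pi>_in, of x] \<sigma>[OF \<pi>_in, of y] in \<open>auto simp: Apar_add \<kappa>_add Apar_FA lmap_add[OF \<pi>_lin]\<close>)
      then show "f (x + y) g = f x g + f y g"
        using \<sigma>[OF \<pi>_in] by (simp add: f_def add)
    next
      fix c x
      have "\<beta> (\<sigma> (\<pi> (rs c x))) g = \<beta> (fa_scale c (\<sigma> (\<pi> x))) g"
        by (rule wd) (use \<sigma>[OF \<pi>_in, of "rs c x"] \<sigma>[OF \<pi>_in, of x] in \<open>auto simp: Apar_scale \<kappa>_scale Apar_FA lmap_scale[OF \<pi>_lin]\<close>)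
      then show "f (rs c x) g = c * f x g"
        using \<sigma>[OF \<pi>_in] by (simp add: f_def scale)
    qed
  next
    show "lmap hs (*) (\<lambda>g. f x g)" for x
      unfolding f_def using lin \<sigma>[OF \<pi>_in] by blast
  qed
  moreover have "f (\<kappa> a) h = \<beta> a h" if "a \<in> Apar H" for a h
  proof -
    have a: "\<kappa> a \<in> asub" using that by (simp add: Apar_iff)
    have "\<beta> (\<sigma> (\<kappa> a)) h = \<beta> a h"
      by (rule wd) (use \<sigma>[OF a] that in simp_all)
    then show ?thesis by (simp add: f_def \<pi>[OF a])
  qed
  ultimately show ?thesis using that by blast
qed

section \<open>The comparison map \<Psi> and its injectivity\<close>

definition \<Psi> :: "('k, 'h) stens \<Rightarrow> 'r" where "\<Psi> = val (\<lambda>x h. x * br h)"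

lemma form_\<Psi>:
  assumes "lmap rs (*) \<phi>"
  shows "\<phi> (\<Psi> s) = val (\<lambda>x h. \<phi> (x * br h)) s"
proof (induction s)
  case Nil
  show ?case using lmap_zero[OF assms] by (simp add: \<Psi>_def val_Nil)
next
  case (Cons p s)
  then show ?case by (cases p) (simp add: \<Psi>_def val_Cons lmap_add[OF assms])
qed

lemma \<Psi>_teqA:
  assumes s: "s \<in> Atens H" and t: "t \<in> Atens H" and eq: "teqA H s t"
  shows "\<Psi> s = \<Psi> t"
proof (rule functionals_separate[OF vector_space_rs])
  fix \<phi> assume \<phi>: "lmap rs (*) \<phi>"
  define \<beta> where "\<beta> a h = \<phi> (\<kappa> a * br h)" for a h
  have ract: "\<beta> (ract H a z) h = \<beta> a (z \<odot> h)" if a: "a \<in> Apar H" and z: "z \<in> range et" for a z h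
  proof -
    define y where "y = inv_into (range es) S z"
    have z': "z \<in> S ` range es" using z range_et by simp
    then have "y \<in> range es" "S y = z"
      unfolding y_def by (auto intro: inv_into_into f_inv_into_f)
    then obtain x where x: "y = es x" "z = S (es x)" by auto
    have "\<kappa> (ract H a z) = \<kappa> a * E y"
      by (simp add: ract_def y_def[symmetric] \<kappa>_mult Apar_FA[OF a] act_FA FA_one \<kappa>_act \<kappa>_one ad_one)
    then show ?thesis by (simp add: \<beta>_def x mult.assoc E_es_br)
  qed
  have lin: "lmap hs (*) (\<lambda>h. \<phi> (\<kappa> a * br h))" for a
    by (intro lmap_comp[OF \<phi>] r_all)
  have "\<beta> \<in> balforms H"
    unfolding balforms_def
  proof (intro CollectI conjI ballI allI impI)
    show "Vector_Spaces.linear hs (*) (\<beta> a)" for a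
      unfolding linear_iff_lmap[OF vector_space_hs vector_space_field] \<beta>_def by (rule lin)
    show "\<beta> a h = \<beta> a' h" if "a \<in> Apar H" "a' \<in> Apar H" "parcong H a a'" for a a' h
      using that \<kappa>_eq_iff[of a a'] by (simp add: \<beta>_def Apar_FA)
  qed (auto simp: ract, auto simp: \<beta>_def Apar_FA \<kappa>_add \<kappa>_scale distrib_right rs_mult_left[symmetric]
      lmap_add[OF \<phi>] lmap_scale[OF \<phi>])
  then have "(\<Sum>(a, h)\<leftarrow>s. \<beta> a h) = (\<Sum>(a, h)\<leftarrow>t. \<beta> a h)"
    using eq by (simp add: teqA_def)
  then show "\<phi> (\<Psi> s) = \<phi> (\<Psi> t)"
    by (simp add: form_\<Psi>[OF \<phi>] val_def \<beta>_def)
qed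

lemma \<Psi>_append: "\<Psi> (s @ t) = \<Psi> s + \<Psi> t"
  by (simp add: \<Psi>_def val_append)

lemma \<Psi>_tscale: "s \<in> Atens H \<Longrightarrow> \<Psi> (tscale c s) = rs c (\<Psi> s)"
  unfolding \<Psi>_def
  by (rule val_tscale[where t=rs]) (simp_all add: rs_mult_left lmap_scale_right[OF vector_space_rs lmap_id])

lemma val_mult_left: "(x :: 'r) * val F s = val (\<lambda>y g. x * F y g) s"
  by (induction s) (auto simp: val_Nil val_Cons distrib_left)

lemma val_mult_right: "val F s * (x :: 'r) = val (\<lambda>y g. F y g * x) s"
  by (induction s) (auto simp: val_Nil val_Cons distrib_right)

lemma \<Psi>_smul: "s \<in> Atens H \<Longrightarrow> t \<in> Atens H \<Longrightarrow> \<Psi> (smul H s t) = \<Psi> s * \<Psi> t"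
  unfolding \<Psi>_def
  by (subst val_smul, assumption, assumption, subst val_mult_right, subst val_mult_left, intro val_cong)
    (auto simp: mult.assoc dsum_mult_left[symmetric] ad_mult_br Apar_iff dest!: AtensD)

lemma corner_br: "corner (\<lambda>x h. x * br h) x h = x * br h"
  by (simp add: corner_def mult.assoc dsum_mult_left[symmetric] br_eq_E)

lemma \<Psi>_psgen: "a \<in> Apar H \<Longrightarrow> \<Psi> (psgen H a h) = \<kappa> a * br h"
  by (simp add: \<Psi>_def val_psgen corner_br)

lemma \<Psi>_surj: "x \<in> FA \<Longrightarrow> \<exists>s\<in>PSgen H. \<Psi> s = \<kappa> x"
proof (induction rule: FA_induct)
  case zero
  show ?case by (rule bexI[where x="[]"]) (simp_all add: \<Psi>_def val_Nil \<kappa>_zero PSgen.zero)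
next
  case one
  show ?case by (rule bexI[where x="psgen H fa_one \<one>"])
      (simp_all add: \<Psi>_psgen Apar_one \<kappa>_one br_one_left PSgen.gen)
next
  case (gen h)
  show ?case by (rule bexI[where x="psgen H fa_one h"])
      (simp_all add: \<Psi>_psgen Apar_one \<kappa>_one br_one_left br_def[symmetric] PSgen.gen)
next
  case (add x y)
  then obtain s t where "s \<in> PSgen H" "t \<in> PSgen H" "\<Psi> s = \<kappa> x" "\<Psi> t = \<kappa> y" by blast
  with add show ?case by (intro bexI[where x="s @ t"]) (simp_all add: \<Psi>_append \<kappa>_add PSgen.add)
next
  case (scale c x)
  then obtain s where "s \<in> PSgen H" "\<Psi> s = \<kappa> x" by blast
  with scale show ?case using PSgen_corner
    by (intro bexI[where x="tscale c s"]) (simp_all add: \<Psi>_tscale \<kappa>_scale PSgen.scale)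
next
  case (mult x y)
  then obtain s t where "s \<in> PSgen H" "t \<in> PSgen H" "\<Psi> s = \<kappa> x" "\<Psi> t = \<kappa> y" by blast
  with mult show ?case using PSgen_corner
    by (intro bexI[where x="smul H s t"]) (simp_all add: \<Psi>_smul \<kappa>_mult PSgen.mult)
qed

text \<open>A lift of \<Psi> to the free algebra (\<open>\<kappa>_flat\<close>), where the action of
  words on forms can be evaluated.\<close>

definition flat :: "('k, 'h) stens \<Rightarrow> ('k, 'h) fa" where
  "flat s = fa_sum (map (\<lambda>(a, h). fa_mult a (fa_gen h)) s)"

lemma flat_Nil: "flat [] = fa_zero" and flat_Cons: "flat ((a, h) # s) = fa_add (fa_mult a (fa_gen h)) (flat s)"
  by (simp_all add: flat_def fa_sum_def)

lemma flat_FA: "s \<in> Atens H \<Longrightarrow> flat s \<in> FA"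
  unfolding flat_def by (rule FA_sum) (auto simp: Atens_def Apar_FA FA_rules)

lemma fa_lin_flat:
  assumes "fa_lin t f" "s \<in> Atens H" "\<And>a h. (a, h) \<in> set s \<Longrightarrow> f (fa_mult a (fa_gen h)) = F (\<kappa> a) h"
  shows "f (flat s) = val F s"
  using assms(2,3)
proof (induction s)
  case Nil
  show ?case using fa_lin_zero[OF assms(1)] by (simp add: flat_Nil val_Nil)
next
  case (Cons p s)
  obtain a h where [simp]: "p = (a, h)" by (cases p)
  have "s \<in> Atens H" "a \<in> FA" using Cons.prems(1) by (auto simp: Atens_def Apar_FA)
  with Cons show ?case
    by (simp add: flat_Cons val_Cons fa_lin_add[OF assms(1)] flat_FA FA_rules)
qed

lemma \<kappa>_flat: "s \<in> Atens H \<Longrightarrow> \<kappa> (flat s) = \<Psi> s"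
  unfolding \<Psi>_def by (rule fa_lin_flat[OF fa_lin_\<kappa>])
    (auto simp: \<kappa>_mult FA_gen br_def Apar_FA dest: AtensD)

text \<open>The word function \<open>?W\<close> vanishes on the ideal, and its value at the lift of
  a [h] is that of \<open>corner f\<close> at a and h. Hence the value of \<open>corner f\<close>
  depends only on the image under \<Psi>.\<close>

lemma val_corner_cong:
  assumes f: "bform f" and s: "s \<in> Atens H" and t: "t \<in> Atens H" and eq: "\<Psi> s = \<Psi> t"
  shows "val (corner f) s = val (corner f) t"
proof -
  note v = vector_space_field and R = r_all bform_rules[OF f]
  \<comment> \<open>The transpose of x \<otimes> h \<mapsto> x [S h_1] \<otimes> h_2, to be composed
    with the coaction.\<close>
  define \<gamma>0 where "\<gamma>0 x h = \<Delta> h (\<lambda>a b. f (x * br (S a)) b)" for x h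
  have \<gamma>0: "bform \<gamma>0" unfolding \<gamma>0_def by (rule bformI) (intro R)+
  note R0 = r_all bform_rules[OF \<gamma>0]
  \<comment> \<open>Pulling along 1 forces membership in \<open>uforms\<close>. The factor [1_1]
    \<otimes> 1_2 so introduced is removed below: as 1_1 lies in H_s, [1_1] commutes with a, and
    \<Delta>(h) absorbs the copy of \<Delta>(1).\<close>
  define \<gamma> where "\<gamma> = pull \<gamma>0 \<one>"
  have \<gamma>: "\<gamma> \<in> uforms" unfolding \<gamma>_def by (rule pull_uforms[OF \<gamma>0])
  \<comment> \<open>Evaluating at e \<otimes> 1 recovers the image of a word from left
    multiplication by it.\<close>
  let ?W = "\<lambda>w. foldl pull \<gamma> w e \<one>"
  have W: "pair ?W (fa_mult a (fa_gen h)) = corner f (\<kappa> a) h" if a: "a \<in> Apar H" for a h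
  proof -
    have "pair ?W (fa_mult a (fa_gen h)) = \<Delta> h (\<lambda>p q. \<gamma> (\<kappa> a * br p) q)"
      by (simp add: pair_mult pair_gen Apar_FA[OF a] FA_gen pull_def pair_dsum pair_pull_Apar[OF a \<gamma>] br_one_right)
    also have "\<dots> = \<Delta> \<one> (\<lambda>c d. \<Delta> h (\<lambda>p q. \<gamma>0 (br c * \<kappa> a * br p) (d \<odot> q)))"
      unfolding \<gamma>_def pull_def by (subst dsum_swap) (simp add: mult.assoc)
    also have "\<dots> = \<Delta> \<one> (\<lambda>c d. \<Delta> h (\<lambda>p q. \<gamma>0 (br (es c) * \<kappa> a * br p) (d \<odot> q)))"
      by (rule dsum_one_es[OF v, symmetric]) (intro R0)
    also have "\<dots> = \<Delta> \<one> (\<lambda>c d. \<Delta> h (\<lambda>p q. \<gamma>0 (\<kappa> a * br (es c \<odot> p)) (d \<odot> q)))"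
      using a by (simp add: br_es_asub_commute Apar_iff mult.assoc br_es_left)
    also have "\<dots> = \<Delta> \<one> (\<lambda>c d. \<Delta> h (\<lambda>p q. \<gamma>0 (\<kappa> a * br (c \<odot> p)) (d \<odot> q)))"
      by (rule dsum_one_es[OF v]) (intro R0)
    also have "\<dots> = \<Delta> h (\<lambda>p q. \<gamma>0 (\<kappa> a * br p) q)"
      by (rule dsum_one_left[OF v]) (intro R0)
    also have "\<dots> = \<Delta> h (\<lambda>p q. \<Delta> q (\<lambda>u w. f (\<kappa> a * (br p * br (S u))) w))"
      by (simp add: \<gamma>0_def mult.assoc)
    also have "\<dots> = \<Delta> h (\<lambda>m w. \<Delta> m (\<lambda>p u. f (\<kappa> a * (br p * br (S u))) w))"
      by (rule coassoc[OF v, symmetric]) (intro R)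
    also have "\<dots> = corner f (\<kappa> a) h"
    proof -
      have "f (\<kappa> a * E m) w = \<Delta> m (\<lambda>p u. f (\<kappa> a * (br p * br (S u))) w)" for m w
        unfolding E_def by (rule lmap_dsum[of rs "(*)" "\<lambda>r. f (\<kappa> a * r) w"]) (intro R)
      then show ?thesis by (simp only: corner_def)
    qed
    finally show ?thesis .
  qed
  have flat: "pair ?W (flat u) = val (corner f) u" if "u \<in> Atens H" for u
    using that by (intro fa_lin_flat[OF fa_lin_pair]) (auto simp: W dest: AtensD)
  have "fa_diff (flat s) (flat t) \<in> parI H"
    using \<kappa>_eq_iff[OF flat_FA[OF s] flat_FA[OF t]] eq by (simp add: \<kappa>_flat s t parcong_def)
  from pull_parI[OF this \<gamma>, of e \<one>] have "pair ?W (flat s) = pair ?W (flat t)"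
    by (simp add: pair_diff flat_FA s t)
  then show ?thesis by (simp add: flat s t)
qed

text \<open>Through L and M, s and t become tensors multiplied by the unit. The form \<phi>(a [h])
  is unchanged by \<open>corner\<close>, so \<Psi> does not see this unit and takes equal values at
  L and M, to which \<open>val_corner_cong\<close> applies.\<close>

lemma PSgen_inj:
  assumes s: "s \<in> PSgen H" and t: "t \<in> PSgen H" and eq: "\<Psi> s = \<Psi> t"
  shows "teqA H s t"
proof -
  obtain L where L: "L \<in> Atens H" "\<And>f. bform f \<Longrightarrow> val f s = val (corner f) L"
    using PSgen_corner[OF s] by blast
  obtain M where M: "M \<in> Atens H" "\<And>f. bform f \<Longrightarrow> val f t = val (corner f) M"
    using PSgen_corner[OF t] by blast
  have "\<Psi> L = \<Psi> M"
  proof (rule functionals_separate[OF vector_space_rs])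
    fix \<phi> assume \<phi>: "lmap rs (*) \<phi>"
    let ?f = "\<lambda>x h. \<phi> (x * br h)"
    have f: "bform ?f" by (rule bformI) (intro lmap_comp[OF \<phi>] r_all)+
    have "corner ?f = ?f"
      by (simp add: corner_def fun_eq_iff mult.assoc lmap_dsum[OF \<phi>, symmetric]
          dsum_mult_left[symmetric] br_eq_E)
    then show "\<phi> (\<Psi> L) = \<phi> (\<Psi> M)"
      using L(2)[OF f] M(2)[OF f] eq by (simp add: form_\<Psi>[OF \<phi>, symmetric])
  qed
  show ?thesis
    unfolding teqA_def
  proof
    fix \<beta> assume "\<beta> \<in> balforms H"
    then obtain f where f: "bform f" "\<And>a h. a \<in> Apar H \<Longrightarrow> f (\<kappa> a) h = \<beta> a h"
      using balforms_extend by blast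
    have "(\<Sum>(a, h)\<leftarrow>u. \<beta> a h) = val f u" if "u \<in> Atens H" for u
      unfolding val_def using that f(2)
      by (intro arg_cong[where f=sum_list] map_cong) (auto dest: AtensD)
    moreover have "val f s = val f t"
      using L(2)[OF f(1)] M(2)[OF f(1)] val_corner_cong[OF f(1) L(1) M(1) \<open>\<Psi> L = \<Psi> M\<close>] by simp
    ultimately show "(\<Sum>(a, h)\<leftarrow>s. \<beta> a h) = (\<Sum>(a, h)\<leftarrow>t. \<beta> a h)"
      using PSgen_corner s t by simp
  qed
qed

text \<open>The isomorphism picks a preimage under \<Psi> in \<open>PSgen\<close>. By
  \<open>PSgen_inj\<close> each identity that it must satisfy can be checked after applying \<Psi>,
  where it becomes a property of \<kappa>.\<close>

lemma Hpar_PS_iso_exists: "\<exists>\<phi>. Hpar_PS_iso H \<phi>"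
proof
  define \<phi> where "\<phi> x = (SOME s. s \<in> PSgen H \<and> \<Psi> s = \<kappa> x)" for x
  have \<phi>: "\<phi> x \<in> PSgen H \<and> \<Psi> (\<phi> x) = \<kappa> x" if "x \<in> FA" for x
    unfolding \<phi>_def by (rule someI_ex) (use \<Psi>_surj[OF that] in blast)
  have Atens: "s \<in> Atens H" if "s \<in> PSgen H" for s using PSgen_corner that by blast
  have refl: "teqA H s s" for s by (simp add: teqA_def)
  show "Hpar_PS_iso H \<phi>"
    unfolding Hpar_PS_iso_def
  proof (intro conjI ballI allI)
    show "\<phi> x \<in> PS H" if "x \<in> FA" for x
      using \<phi>[OF that] Atens refl by (auto simp: PS_def)
    show "parcong H x y \<longleftrightarrow> teqA H (\<phi> x) (\<phi> y)" if "x \<in> FA" "y \<in> FA" for x y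
      using \<phi> that \<kappa>_eq_iff[OF that] PSgen_inj \<Psi>_teqA Atens by metis
    show "\<exists>x\<in>FA. teqA H (\<phi> x) t" if PS: "t \<in> PS H" for t
    proof -
      obtain s where t: "t \<in> Atens H" and s: "s \<in> PSgen H" "teqA H t s"
        using PS by (auto simp: PS_def)
      have "\<Psi> (\<phi> (flat s)) = \<Psi> s"
        using \<phi>[OF flat_FA] \<kappa>_flat Atens[OF s(1)] by simp
      then have "teqA H (\<phi> (flat s)) s"
        using PSgen_inj \<phi>[OF flat_FA] Atens[OF s(1)] s(1) by blast
      then show ?thesis using s(2) flat_FA[OF Atens[OF s(1)]] by (auto simp: teqA_def)
    qed
    show "teqA H (\<phi> (fa_add x y)) (\<phi> x @ \<phi> y)" if "x \<in> FA" "y \<in> FA" for x y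
      using \<phi> that by (intro PSgen_inj) (simp_all add: FA_add PSgen.add \<Psi>_append \<kappa>_add)
    show "teqA H (\<phi> (fa_scale c x)) (tscale c (\<phi> x))" if "x \<in> FA" for c x
      using \<phi> that by (intro PSgen_inj) (simp_all add: FA_scale PSgen.scale \<Psi>_tscale \<kappa>_scale Atens)
    show "teqA H (\<phi> (fa_mult x y)) (smul H (\<phi> x) (\<phi> y))" if "x \<in> FA" "y \<in> FA" for x y
      using \<phi> that by (intro PSgen_inj) (simp_all add: FA_mult PSgen.mult \<Psi>_smul \<kappa>_mult Atens)
    show "teqA H (\<phi> fa_one) (psgen H fa_one \<one>)"
      using \<phi>[OF FA_one] by (intro PSgen_inj)
        (simp_all add: PSgen.gen Apar_one \<Psi>_psgen \<kappa>_one br_one_left)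
  qed
qed

end

section \<open>A ring type containing the universal algebra\<close>

definition fun_scale :: "'k::times \<Rightarrow> ('x \<Rightarrow> 'k) \<Rightarrow> 'x \<Rightarrow> 'k" where
  "fun_scale c u = (\<lambda>i. c * u i)"

lemma vector_space_fun_scale: "vector_space (fun_scale :: 'k::field \<Rightarrow> ('x \<Rightarrow> 'k) \<Rightarrow> 'x \<Rightarrow> 'k)"
  by unfold_locales (auto simp: fun_scale_def fun_eq_iff algebra_simps)

text \<open>The quotient of the free algebra by \<open>parI H\<close> depends on the term \<open>H\<close>, so it is not a type. It acts
  faithfully on a complement of \<open>parI H\<close> by left multiplication, and extending these operators
  by zero embeds it into the following ring, with a unit different from the identity.\<close>

typedef (overloaded) ('x, 'k) fun_endo =
  "{f :: ('x \<Rightarrow> 'k::field) \<Rightarrow> ('x \<Rightarrow> 'k). lmap fun_scale fun_scale f}"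
  by (rule exI[where x="\<lambda>x. x"]) (simp add: lmap_id)

lemma lmap_Rep: "lmap fun_scale fun_scale (Rep_fun_endo f)"
  using Rep_fun_endo[of f] by simp

lemma Rep_Abs: "lmap fun_scale fun_scale f \<Longrightarrow> Rep_fun_endo (Abs_fun_endo f) = f"
  by (simp add: Abs_fun_endo_inverse)

instantiation fun_endo :: (type, field) ring
begin

definition "0 = Abs_fun_endo (\<lambda>_. 0)"
definition "f + g = Abs_fun_endo (\<lambda>u. Rep_fun_endo f u + Rep_fun_endo g u)"
definition "- f = Abs_fun_endo (\<lambda>u. - Rep_fun_endo f u)"
definition "f - g = Abs_fun_endo (\<lambda>u. Rep_fun_endo f u - Rep_fun_endo g u)"
definition "f * g = Abs_fun_endo (\<lambda>u. Rep_fun_endo f (Rep_fun_endo g u))"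

lemma Rep_ops:
  "Rep_fun_endo 0 = (\<lambda>_. 0)"
  "Rep_fun_endo (f + g) = (\<lambda>u. Rep_fun_endo f u + Rep_fun_endo g u)"
  "Rep_fun_endo (- f) = (\<lambda>u. - Rep_fun_endo f u)"
  "Rep_fun_endo (f - g) = (\<lambda>u. Rep_fun_endo f u - Rep_fun_endo g u)"
  "Rep_fun_endo (f * g) = (\<lambda>u. Rep_fun_endo f (Rep_fun_endo g u))"
  using lmap_Rep[of f] lmap_Rep[of g]
  unfolding zero_fun_endo_def plus_fun_endo_def uminus_fun_endo_def minus_fun_endo_def times_fun_endo_def
  by (intro Rep_Abs; simp add: lmap_def; simp add: fun_scale_def fun_eq_iff algebra_simps)+

instance
  by standard (simp_all add: Rep_fun_endo_inject[symmetric] Rep_ops fun_eq_iff lmap_add[OF lmap_Rep])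

end

definition endo_scale :: "'k::field \<Rightarrow> ('x, 'k) fun_endo \<Rightarrow> ('x, 'k) fun_endo" where
  "endo_scale c f = Abs_fun_endo (\<lambda>u. fun_scale c (Rep_fun_endo f u))"

lemma Rep_endo_scale: "Rep_fun_endo (endo_scale c f) = (\<lambda>u. fun_scale c (Rep_fun_endo f u))"
  using lmap_Rep[of f] unfolding endo_scale_def
  by (intro Rep_Abs; simp add: lmap_def; simp add: fun_scale_def fun_eq_iff algebra_simps)

lemma vector_space_endo_scale: "vector_space (endo_scale :: 'k::field \<Rightarrow> ('x, 'k) fun_endo \<Rightarrow> _)"
  by unfold_locales
    (simp_all add: Rep_fun_endo_inject[symmetric] Rep_ops Rep_endo_scale fun_scale_def fun_eq_iff algebra_simps)

lemma fa_eq_fun: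
  "fa_add x y = x + y" "fa_zero = 0" "fa_scale c x = fun_scale c x" "fa_diff x y = x - y"
  for x y :: "('k::field, 'h) fa"
  by (auto simp: fa_defs fun_scale_def fun_eq_iff)

text \<open>A projection onto \<open>FA\<close>, as the type also has functions of infinite support,
  followed by the projection that kills \<open>parI H\<close>.\<close>

lemma normal_form:
  obtains nf :: "('k::field, 'h::ab_group_add) fa \<Rightarrow> ('k, 'h) fa"
  where "lmap fun_scale fun_scale nf" "\<And>u. nf u \<in> FA" "\<And>u. u \<in> FA \<Longrightarrow> u - nf u \<in> parI H"
    "\<And>u. u \<in> parI H \<Longrightarrow> nf u = 0"
proof -
  note vs = vector_space_fun_scale
  have FA: "(0 :: ('k, 'h) fa) \<in> FA"
    "\<And>u v :: ('k, 'h) fa. u \<in> FA \<Longrightarrow> v \<in> FA \<Longrightarrow> u + v \<in> FA"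
    "\<And>c (u :: ('k, 'h) fa). u \<in> FA \<Longrightarrow> fun_scale c u \<in> FA"
    unfolding fa_eq_fun[symmetric] by (rule FA_zero FA_add FA_scale; assumption)+
  have I: "0 \<in> parI H" "\<And>u v. u \<in> parI H \<Longrightarrow> v \<in> parI H \<Longrightarrow> u + v \<in> parI H"
    "\<And>c u. u \<in> parI H \<Longrightarrow> fun_scale c u \<in> parI H"
    unfolding fa_eq_fun[symmetric] by (rule parI.zero parI.add parI.scale; assumption)+
  obtain p :: "('k, 'h) fa \<Rightarrow> ('k, 'h) fa"
    where p: "lmap fun_scale fun_scale p" "\<And>u. p u \<in> FA" "\<And>u. u \<in> FA \<Longrightarrow> p u = u"
    using subspace_projection[OF vs FA] by blast
  obtain q where q: "lmap fun_scale fun_scale q" "\<And>u. q u \<in> parI H" "\<And>u. u \<in> parI H \<Longrightarrow> q u = u"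
    using subspace_projection[OF vs I] by blast
  define nf where "nf u = p u - q (p u)" for u
  show ?thesis
  proof (rule that[of nf])
    show "lmap fun_scale fun_scale nf"
      by (simp add: lmap_def nf_def lmap_add[OF p(1)] lmap_add[OF q(1)] lmap_scale[OF p(1)] lmap_scale[OF q(1)])
        (simp add: fun_scale_def fun_eq_iff algebra_simps)
    show "nf u \<in> FA" for u
      using FA_diff[OF p(2) parI_FA[OF q(2)]] by (simp add: nf_def fa_eq_fun)
    show "u - nf u \<in> parI H" if "u \<in> FA" for u
      using q(2)[of u] by (simp add: nf_def p(3)[OF that])
    show "nf u = 0" if "u \<in> parI H" for u
      using p(3)[OF parI_FA[OF that]] q(3)[OF that] by (simp add: nf_def)
  qed
qed

text \<open>Normalising before and after multiplication by x gives operators that are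
  multiplicative, because \<open>parI H\<close> is a left ideal (\<open>nf_mult\<close>), and that
  depend only on the class of x, because it is a right ideal.\<close>

lemma universal_rep_exists:
  fixes H :: "('k::field, 'h::ab_group_add) wha"
  assumes "whopf H"
  shows "\<exists>\<kappa> :: ('k, 'h) fa \<Rightarrow> ('h list, 'k) fun_endo. universal_rep H endo_scale \<kappa>"
proof -
  obtain nf :: "('k, 'h) fa \<Rightarrow> ('k, 'h) fa" where lin: "lmap fun_scale fun_scale nf"
    and FA: "\<And>u. nf u \<in> FA" and cong: "\<And>u. u \<in> FA \<Longrightarrow> u - nf u \<in> parI H"
    and zero: "\<And>u. u \<in> parI H \<Longrightarrow> nf u = 0"
    using normal_form by blast
  have diff: "nf (u - v) = nf u - nf v" for u v
  proof -
    have "nf u = nf (u - v) + nf v" using lmap_add[OF lin, of "u - v" v] by simp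
    then show ?thesis by simp
  qed
  have mult_diff: "fa_mult x (u - v) = fa_mult x u - fa_mult x v"
    "fa_mult (u - v) x = fa_mult u x - fa_mult v x" for x u v :: "('k, 'h) fa"
    unfolding fa_eq_fun(4)[symmetric] fa_diff_def
    by (simp_all only: fa_mult_add_left fa_mult_add_right fa_mult_scale_left fa_mult_scale_right)
  have nf_mult: "nf (fa_mult x (nf u)) = nf (fa_mult x u)" if "x \<in> FA" "u \<in> FA" for x u
    using zero[OF parI.lmul[OF cong[OF that(2)] that(1)]] by (simp add: mult_diff diff)
  have mult_linear: "fa_mult x (u + v) = fa_mult x u + fa_mult x v"
    "fa_mult x (fun_scale c u) = fun_scale c (fa_mult x u)" for c and x u v :: "('k, 'h) fa"
    unfolding fa_eq_fun[symmetric] by (rule fa_mult_add_right fa_mult_scale_right)+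
  define \<kappa> where "\<kappa> x = Abs_fun_endo (\<lambda>v. nf (fa_mult x (nf v)))" for x
  have Rep: "Rep_fun_endo (\<kappa> x) = (\<lambda>v. nf (fa_mult x (nf v)))" for x
    unfolding \<kappa>_def
    by (rule Rep_Abs) (simp add: lmap_def lmap_add[OF lin] lmap_scale[OF lin] mult_linear)
  have "universal_rep H endo_scale \<kappa>"
  proof (intro universal_rep.intro universal_rep_axioms.intro)
    show "whopf H" by fact
    show "vector_space (endo_scale :: 'k \<Rightarrow> ('h list, 'k) fun_endo \<Rightarrow> _)"
      by (rule vector_space_endo_scale)
    show "endo_scale c (x * y) = endo_scale c x * y" "endo_scale c (x * y) = x * endo_scale c y"
      for c and x y :: "('h list, 'k) fun_endo"
      by (simp_all add: Rep_fun_endo_inject[symmetric] Rep_ops Rep_endo_scale lmap_scale[OF lmap_Rep])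
    show "fa_lin endo_scale \<kappa>"
      by (simp add: fa_lin_def Rep_fun_endo_inject[symmetric] Rep_ops Rep_endo_scale Rep
          fa_mult_add_left fa_mult_scale_left)
        (simp add: fa_eq_fun lmap_add[OF lin] lmap_scale[OF lin])
    show "\<kappa> (fa_mult x y) = \<kappa> x * \<kappa> y" if "x \<in> FA" "y \<in> FA" for x y
      using that by (simp add: Rep_fun_endo_inject[symmetric] Rep_ops Rep nf_mult FA FA_mult fa_mult_assoc)
    show "\<kappa> x = \<kappa> y \<longleftrightarrow> parcong H x y" if xy: "x \<in> FA" "y \<in> FA" for x y
    proof
      assume "parcong H x y"
      then have "x - y \<in> parI H" by (simp add: parcong_def fa_eq_fun)
      then have "nf (fa_mult x (nf v)) = nf (fa_mult y (nf v))" for v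
        using zero[OF parI.rmul[OF _ FA[of v]], of "x - y"] by (simp add: mult_diff diff)
      then show "\<kappa> x = \<kappa> y" by (simp add: \<kappa>_def)
    next
      assume "\<kappa> x = \<kappa> y"
      \<comment> \<open>Applied to 1, the operator returns the normal form of x, which determines
        its class.\<close>
      then have "Rep_fun_endo (\<kappa> x) fa_one = Rep_fun_endo (\<kappa> y) fa_one" by simp
      then have "nf x = nf y"
        using xy by (simp add: Rep nf_mult FA_one fa_mult_one_right)
      then show "parcong H x y"
        using cong[OF FA_diff[OF xy]] by (simp add: parcong_def fa_eq_fun diff)
    qed
  qed
  then show ?thesis by (rule exI[where x=\<kappa>])
qed

theorem theorem4p7:
  fixes H :: "('k::field, 'h::ab_group_add) wha"
  assumes "weak_hopf_algebra H"
    and "bij (ant H)"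
  shows "\<exists>\<phi>. Hpar_PS_iso H \<phi>"
proof -
  have "whopf H" using assms by (rule whopf.intro)
  then obtain \<kappa> :: "('k, 'h) fa \<Rightarrow> ('h list, 'k) fun_endo" where "universal_rep H endo_scale \<kappa>"
    using universal_rep_exists by blast
  then show ?thesis by (rule universal_rep.Hpar_PS_iso_exists)
qed

end
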